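(* Let $I_0\subset R=K[x,y]$ be a lex-segment ideal with $\dim_K(R/I_0)<\infty$. Then the map of affine varieties $$\psi:\mathscr{A}_{I_0}\longrightarrow V(I_0),\qquad \psi(A)=I_t(X+A),$$ is well defined (that is, $I_t(X+A)\in V(I_0)$ for every $A\in\mathscr{A}_{I_0}$) and bijective.
   Context: $K$ is a field of any characteristic, $R=K[x,y]$. Initial terms and initial ideals $\operatorname{in}(\cdot)$ are taken with respect to the degree reverse lexicographic (DRL) term order induced by $x>y$ (compare total degree first; among monomials of the same degree, the one with the higher power of $x$ is larger). A monomial ideal $I_0\subset R$ is a lex-segment ideal if for every monomial $u\in I_0$ of degree $d$, all monomials $v$ of degree $d$ with $v>_{\mathrm{Lex}}u$ (where $x>y$) also lie in $I_0$. For a monomial ideal $I_0$ with $\dim_K(R/I_0)<\infty$ put $t=\min\{j: x^j\in I_0\}$, $m_0=0$, $m_i=\min\{j: x^{t-i}y^j\in I_0\}$ for $1\le i\le t$, so that $I_0=(x^t,x^{t-1}y^{m_1},\ldots,xy^{m_{t-1}},y^{m_t})$ and $0=m_0\le m_1\le\cdots\le m_t$; put $d_i=m_i-m_{i-1}$ for $1\le i\le t$. $X$ is the $(t+1)\times t$ matrix with $X_{i,i}=y^{d_i}$, $X_{i+1,i}=-x$ for $1\le i\le t$, and all other entries $0$. Let $u_{i,j}=i-j+m_j-m_{i-1}$ for $1\le i\le t+1$, $1\le j\le t$. $\mathscr{A}_{I_0}$ is the set of all $(t+1)\times t$ matrices $A=(a_{i,j})$ with entries in $K[y]$ such that $$\deg(a_{i,j})\le\begin{cases}\min\{u_{i,j}-1,\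 d_i-1\}&\text{if } i\le j,\\ \min\{u_{i,j},\ d_j-1\}&\text{if } i>j,\end{cases}$$ with the convention that $a_{i,j}=0$ when the bound is negative (and the zero polynomial satisfies every bound). Via the coefficients of the entries, $\mathscr{A}_{I_0}$ is an affine space $\mathbb{A}^N$ over $K$. $I_t(M)$ denotes the ideal generated by the $t\times t$ minors of the matrix $M$. $V(I_0)=\{I\subset R \text{ ideal}: \operatorname{in}(I)=I_0\}$ (homogeneous or not), regarded as an affine variety with coordinates the coefficients of the non-leading terms in the reduced Gröbner basis of $I$. *)

theory Defs
  imports
    "HOL-Computational_Algebra.Polynomial"
    "Jordan_Normal_Form.Determinant"
    "Jordan_Normal_Form.DL_Submatrix"
begin

text \<open>
  The ring \<open>K[x,y]\<close> is \<^typ>\<open>'a poly poly\<close> with \<open>K = 'a\<close>: the outer variable is \<open>x\<close>, the inner one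
  is \<open>y\<close>, so constant outer polynomials form the subring \<open>K[y]\<close>. The exponent \<open>(a, b)\<close> stands for
  the monomial \<open>x^a y^b\<close>.
\<close>

section \<open>Ideals\<close>

interpretation ring_module: Modules.module "(*) :: 'a::comm_ring_1 \<Rightarrow> 'a \<Rightarrow> 'a"
  by unfold_locales (simp_all add: algebra_simps)

abbreviation is_ideal :: "'a::comm_ring_1 set \<Rightarrow> bool" where
  "is_ideal \<equiv> ring_module.subspace"

abbreviation ideal_gen :: "'a::comm_ring_1 set \<Rightarrow> 'a set" where
  "ideal_gen \<equiv> ring_module.span"

interpretation K_space: Vector_Spaces.vector_space "\<lambda>(c::'a::field) (f::'a poly poly). smult [:c:] f"
  by unfold_locales (simp_all add: smult_add_right mult.commute flip: smult_add_left one_pCons)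

text \<open>\<open>dim_K (R/I) < \<infinity>\<close>: the classes of finitely many elements span \<open>R/I\<close> over \<open>K\<close>.\<close>

definition finite_dim_quotient :: "'a::field poly poly set \<Rightarrow> bool" where
  "finite_dim_quotient I \<longleftrightarrow> (\<exists>B. finite B \<and> (\<forall>f. \<exists>g \<in> K_space.span B. f - g \<in> I))"

section \<open>Monomials, term orders, initial ideals\<close>

definition mono2 :: "nat \<times> nat \<Rightarrow> 'a::field poly poly" where
  "mono2 m = monom (monom 1 (snd m)) (fst m)"

definition coeff2 :: "'a::zero poly poly \<Rightarrow> nat \<times> nat \<Rightarrow> 'a" where
  "coeff2 f m = coeff (coeff f (fst m)) (snd m)"

definition supp :: "'a::zero poly poly \<Rightarrow> (nat \<times> nat) set" where
  "supp f = {m. coeff2 f m \<noteq> 0}"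

definition monomial_ideal :: "'a::field poly poly set \<Rightarrow> bool" where
  "monomial_ideal I \<longleftrightarrow> (\<exists>S. I = ideal_gen (mono2 ` S))"

definition tdeg :: "nat \<times> nat \<Rightarrow> nat" where
  "tdeg m = fst m + snd m"

definition lex_less :: "nat \<times> nat \<Rightarrow> nat \<times> nat \<Rightarrow> bool" where
  "lex_less m n \<longleftrightarrow> fst m < fst n \<or> (fst m = fst n \<and> snd m < snd n)"

definition drl_less :: "nat \<times> nat \<Rightarrow> nat \<times> nat \<Rightarrow> bool" where
  "drl_less m n \<longleftrightarrow> tdeg m < tdeg n \<or> (tdeg m = tdeg n \<and> fst m < fst n)"

definition lex_segment_ideal :: "'a::field poly poly set \<Rightarrow> bool" where
  "lex_segment_ideal I \<longleftrightarrow> monomial_ideal I \<and>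
     (\<forall>u v. mono2 u \<in> I \<and> tdeg v = tdeg u \<and> lex_less u v \<longrightarrow> mono2 v \<in> I)"

text \<open>Exponent of the DRL-initial term; meaningful only for nonzero polynomials.\<close>

definition init_exp :: "'a::field poly poly \<Rightarrow> nat \<times> nat" where
  "init_exp f = (THE m. m \<in> supp f \<and> (\<forall>n \<in> supp f. n \<noteq> m \<longrightarrow> drl_less n m))"

definition init_ideal :: "'a::field poly poly set \<Rightarrow> 'a poly poly set" where
  "init_ideal I = ideal_gen {mono2 (init_exp f) | f. f \<in> I \<and> f \<noteq> 0}"

definition V :: "'a::field poly poly set \<Rightarrow> 'a poly poly set set" where
  "V I0 = {I. is_ideal I \<and> init_ideal I = I0}"

section \<open>The numbers and matrices attached to a monomial ideal\<close>

definition t_of :: "'a::field poly poly set \<Rightarrow> nat" where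
  "t_of I0 = (LEAST j. mono2 (j, 0) \<in> I0)"

definition m_of :: "'a::field poly poly set \<Rightarrow> nat \<Rightarrow> nat" where
  "m_of I0 i = (if i = 0 then 0 else (LEAST j. mono2 (t_of I0 - i, j) \<in> I0))"

definition d_of :: "'a::field poly poly set \<Rightarrow> nat \<Rightarrow> int" where
  "d_of I0 i = int (m_of I0 i) - int (m_of I0 (i - 1))"

definition u_of :: "'a::field poly poly set \<Rightarrow> nat \<Rightarrow> nat \<Rightarrow> int" where
  "u_of I0 i j = int i - int j + int (m_of I0 j) - int (m_of I0 (i - 1))"

definition deg_bound :: "'a::field poly poly set \<Rightarrow> nat \<Rightarrow> nat \<Rightarrow> int" where
  "deg_bound I0 i j =
     (if i \<le> j then min (u_of I0 i j - 1) (d_of I0 i - 1)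
      else min (u_of I0 i j) (d_of I0 j - 1))"

text \<open>
  The indices of \<^const>\<open>d_of\<close>, \<^const>\<open>u_of\<close> and \<^const>\<open>deg_bound\<close> start at 1, those of matrices at 0.
\<close>

definition X_mat :: "'a::field poly poly set \<Rightarrow> 'a poly poly mat" where
  "X_mat I0 = mat (t_of I0 + 1) (t_of I0)
     (\<lambda>(i, j). if i = j then mono2 (0, nat (d_of I0 (i + 1)))
               else if i = j + 1 then - mono2 (1, 0) else 0)"

definition A_space :: "'a::field poly poly set \<Rightarrow> 'a poly mat set" where
  "A_space I0 = {A \<in> carrier_mat (t_of I0 + 1) (t_of I0).
     \<forall>i \<in> {1..t_of I0 + 1}. \<forall>j \<in> {1..t_of I0}.
       A $$ (i - 1, j - 1) = 0 \<or> int (degree (A $$ (i - 1, j - 1))) \<le> deg_bound I0 i j}"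

definition minors_ideal :: "nat \<Rightarrow> 'a::comm_ring_1 mat \<Rightarrow> 'a set" where
  "minors_ideal k M = ideal_gen {det (submatrix M P Q) | P Q.
     P \<subseteq> {..<dim_row M} \<and> Q \<subseteq> {..<dim_col M} \<and> card P = k \<and> card Q = k}"

definition psi :: "'a::field poly poly set \<Rightarrow> 'a poly mat \<Rightarrow> 'a poly poly set" where
  "psi I0 A = minors_ideal (t_of I0) (X_mat I0 + map_mat (\<lambda>p. [:p:]) A)"

section \<open>Affine coordinates and polynomial maps\<close>

definition is_reduced_gb :: "'a::field poly poly set \<Rightarrow> 'a poly poly set \<Rightarrow> bool" where
  "is_reduced_gb I G \<longleftrightarrow> finite G \<and> G \<subseteq> I \<and> 0 \<notin> G \<and>
     ideal_gen ((\<lambda>g. mono2 (init_exp g)) ` G) = init_ideal I \<and>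
     (\<forall>g \<in> G. coeff2 g (init_exp g) = 1 \<and>
        (\<forall>m \<in> supp g. (mono2 m :: 'a poly poly) \<notin> ideal_gen ((\<lambda>h. mono2 (init_exp h)) ` (G - {g}))))"

definition reduced_gb :: "'a::field poly poly set \<Rightarrow> 'a poly poly set" where
  "reduced_gb I = (THE G. is_reduced_gb I G)"

definition min_gen_exps :: "'a::field poly poly set \<Rightarrow> (nat \<times> nat) set" where
  "min_gen_exps I0 = {m. mono2 m \<in> I0 \<and>
     (\<forall>n. n \<noteq> m \<and> fst n \<le> fst m \<and> snd n \<le> snd m \<longrightarrow> mono2 n \<notin> I0)}"

text \<open>
  For \<open>I \<in> V I0\<close> the initial monomials of the reduced Groebner basis are those with exponent in
  \<open>min_gen_exps I0\<close>. The coordinates on \<open>V I0\<close> are \<open>V_coord m n\<close> with \<open>m \<in> min_gen_exps I0\<close> and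
  \<open>n \<noteq> m\<close>: the coefficient at \<open>n\<close> of the basis element with initial monomial \<open>m\<close>.
\<close>

definition V_coord :: "nat \<times> nat \<Rightarrow> nat \<times> nat \<Rightarrow> 'a::field poly poly set \<Rightarrow> 'a" where
  "V_coord m n I = coeff2 (THE g. g \<in> reduced_gb I \<and> init_exp g = m) n"

definition A_coords :: "'a::field poly poly set \<Rightarrow> ('a poly mat \<Rightarrow> 'a) set" where
  "A_coords I0 = {\<lambda>A. coeff (A $$ (i, j)) k | i j k. i < t_of I0 + 1 \<and> j < t_of I0}"

inductive_set poly_functions :: "('p \<Rightarrow> 'a::comm_ring_1) set \<Rightarrow> ('p \<Rightarrow> 'a) set"
  for C :: "('p \<Rightarrow> 'a) set" where
  const: "(\<lambda>_. c) \<in> poly_functions C"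
| coord: "f \<in> C \<Longrightarrow> f \<in> poly_functions C"
| add: "f \<in> poly_functions C \<Longrightarrow> g \<in> poly_functions C \<Longrightarrow> (\<lambda>p. f p + g p) \<in> poly_functions C"
| mult: "f \<in> poly_functions C \<Longrightarrow> g \<in> poly_functions C \<Longrightarrow> (\<lambda>p. f p * g p) \<in> poly_functions C"

text \<open>A map from \<open>A_space I0\<close> to \<open>V I0\<close> that is polynomial in coordinates.\<close>

definition regular_map ::
  "'a::field poly poly set \<Rightarrow> ('a poly mat \<Rightarrow> 'a poly poly set) \<Rightarrow> bool" where
  "regular_map I0 F \<longleftrightarrow>
     (\<forall>m \<in> min_gen_exps I0. \<forall>n. n \<noteq> m \<longrightarrow>
        (\<exists>P \<in> poly_functions (A_coords I0). \<forall>A \<in> A_space I0. V_coord m n (F A) = P A))"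

end

theory Submission
  imports Defs "Jordan_Normal_Form.Char_Poly"
begin

text \<open>
  The lex-segment property says exactly that \<open>m\<^sub>0 < m\<^sub>1 < \<dots> < m\<^sub>t\<close>. The generator
  \<open>x^(t-j) y^(m\<^sub>j)\<close> has degree \<open>t + v\<^sub>j\<close> with \<open>v\<^sub>j = m\<^sub>j - j\<close>, and \<open>v\<close> is nondecreasing. Rows and
  columns of matrices count from \<open>0\<close>: row \<open>i\<close> belongs to a polynomial \<open>f\<^sub>i\<close>, column \<open>j\<close> to a
  relation for \<open>x f\<^bsub>j+1\<^esub>\<close>.

  Let \<open>I\<close> have initial ideal \<open>I\<^sub>0\<close>. The elements of \<open>I\<close> of \<open>x\<close>-degree at most \<open>t\<close> form a free
  \<open>K[y]\<close>-module with a basis \<open>f\<^sub>0, \<dots>, f\<^sub>t\<close> such that \<open>in(f\<^sub>j) = x^(t-j) y^(m\<^sub>j)\<close> and only \<open>f\<^sub>0\<close> has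
  \<open>x\<close>-degree \<open>t\<close>. Hence \<open>x f\<^bsub>j+1\<^esub>\<close> is again a \<open>K[y]\<close>-combination of the \<open>f\<^sub>i\<close>. Division
  (\<open>standard_representation\<close>) bounds the degrees of the coefficients, and the coefficients
  form a matrix \<open>C\<close> with \<open>f (X + C) = 0\<close>.

  The central lemma is \<open>syz_lead\<close>: if \<open>C\<close> obeys these bounds, every nonzero solution of
  \<open>h (X + C) = 0\<close> has the leading exponents of the generators of \<open>I\<^sub>0\<close>, all shifted by the same
  vector. The signed maximal minors of \<open>X + C\<close> are a solution whose entry \<open>0\<close> is a
  characteristic polynomial, monic of degree \<open>t\<close> in \<open>x\<close>; this excludes a shift, so the
  minors generate an ideal with initial ideal \<open>I\<^sub>0\<close> (\<open>lead_exps_minors\<close>). The lemma also applies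
  to the difference of two solutions: one that is monic of degree \<open>t\<close> in entry \<open>0\<close> is the
  vector of minors (\<open>syz_eq_minor\<close>). So every \<open>I\<close> is an ideal of minors of \<open>X + C\<close> for some
  bounded \<open>C\<close>.

  That \<open>C\<close> depends on the basis \<open>f\<close>. Bases differ by matrices \<open>1 + B\<close> that respect the term order,
  and the matrices in \<open>A_space\<close> are normal forms for this action: each bounded \<open>C\<close> is conjugate
  to exactly one of them (\<open>conjugate_normal_exists\<close>, \<open>conjugate_normal_unique\<close>). The reason is
  that the conjugation equation can be solved for one coefficient after the other: an entry
  above or below the diagonal is divided by the power of \<open>y\<close> in the diagonal of \<open>X\<close>, the
  remainder is an entry of the normal form and the quotient is an entry of \<open>B\<close>. Existence
  gives surjectivity (\<open>minors_surjective\<close>) and uniqueness gives injectivity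
  (\<open>minors_injective\<close>).

  The map is regular since minors are polynomial in the entries of the matrix and the
  reduced Groebner basis is obtained from them by division with monic divisors
  (\<open>remainder_poly_functions\<close>).
\<close>

(* Exponents are pairs, but statements about all exponents are used without splitting them. *)
declare split_paired_All [simp del] split_paired_Ex [simp del]

section \<open>Supports, leading exponents, normal forms\<close>

definition dvd2 :: "nat \<times> nat \<Rightarrow> nat \<times> nat \<Rightarrow> bool" where
  "dvd2 m n \<longleftrightarrow> fst m \<le> fst n \<and> snd m \<le> snd n"

text \<open>
  A relation rather than a function, so that no value has to be invented for the zero
  polynomial.
\<close>

definition lead :: "'a::zero poly poly \<Rightarrow> nat \<times> nat \<Rightarrow> bool" where
  "lead f m \<longleftrightarrow> coeff2 f m \<noteq> 0 \<and> (\<forall>n. coeff2 f n \<noteq> 0 \<longrightarrow> n = m \<or> drl_less n m)"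

lemma coeff2_simps [simp]:
  "coeff2 0 m = 0" "coeff2 (f + g) m = coeff2 f m + coeff2 g m"
  "coeff2 (f - g) m = coeff2 f m - coeff2 g m" "coeff2 (- f) m = - coeff2 f m"
  for f g :: "'a::field poly poly"
  by (simp_all add: coeff2_def)

lemma coeff2_smult_const [simp]: "coeff2 (smult [:c:] f) m = c * coeff2 f m"
  for f :: "'a::field poly poly"
  by (simp add: coeff2_def)

lemma coeff2_sum: "coeff2 (\<Sum>i\<in>S. f i) m = (\<Sum>i\<in>S. coeff2 (f i) m)"
  for f :: "'b \<Rightarrow> 'a::field poly poly"
  by (simp add: coeff2_def coeff_sum)

lemma coeff2_mono2: "coeff2 (mono2 m :: 'a::field poly poly) n = (if n = m then 1 else 0)"
  by (cases m; cases n) (auto simp: coeff2_def mono2_def)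

lemma coeff2_mono2_mult:
  "coeff2 (mono2 m * f) n = (if dvd2 m n then coeff2 f (fst n - fst m, snd n - snd m) else 0)"
  for f :: "'a::field poly poly"
  by (auto simp: coeff2_def mono2_def dvd2_def coeff_monom_mult)

lemma dvd2_refl [simp]: "dvd2 m m"
  by (simp add: dvd2_def)

lemma dvd2_trans: "dvd2 k m \<Longrightarrow> dvd2 m n \<Longrightarrow> dvd2 k n"
  by (auto simp: dvd2_def)

lemma mono2_mult: "mono2 (a, b) * mono2 (c, d) = (mono2 (a + c, b + d) :: 'a::field poly poly)"
  by (simp add: mono2_def mult_monom)

lemma mono2_dvd2: "dvd2 m n \<Longrightarrow> (mono2 n :: 'a::field poly poly) = mono2 (fst n - fst m, snd n - snd m) * mono2 m"
  by (cases m; cases n) (simp add: dvd2_def mono2_mult)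

lemma poly2_eqI: "(\<And>m. coeff2 f m = coeff2 g m) \<Longrightarrow> f = g" for f g :: "'a::zero poly poly"
  by (auto simp: coeff2_def poly_eq_iff)

lemma in_supp: "m \<in> supp f \<longleftrightarrow> coeff2 f m \<noteq> 0"
  by (simp add: supp_def)

lemma finite_supp: "finite (supp f)" for f :: "'a::zero poly poly"
proof -
  have "supp f \<subseteq> (SIGMA a:{..degree f}. {..degree (coeff f a)})"
    by (auto simp: in_supp coeff2_def intro!: le_degree)
  thus ?thesis by (rule finite_subset) auto
qed

lemma nonzero_supp: "f \<noteq> 0 \<Longrightarrow> \<exists>m. coeff2 f m \<noteq> 0" for f :: "'a::field poly poly"
  by (metis poly2_eqI coeff2_simps(1))

lemma sum_supp: "f = (\<Sum>m\<in>supp f. smult [:coeff2 f m:] (mono2 m))" for f :: "'a::field poly poly"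
proof (rule poly2_eqI)
  fix n
  have "coeff2 (\<Sum>m\<in>supp f. smult [:coeff2 f m:] (mono2 m)) n =
      (\<Sum>m\<in>supp f. if n = m then coeff2 f m else 0)"
    by (simp add: coeff2_sum coeff2_mono2 if_distrib cong: if_cong)
  also have "\<dots> = coeff2 f n"
    by (simp add: finite_supp) (simp add: in_supp)
  finally show "coeff2 f n = coeff2 (\<Sum>m\<in>supp f. smult [:coeff2 f m:] (mono2 m)) n" by simp
qed

lemma drl_total: "m = n \<or> drl_less m n \<or> drl_less n m"
  by (cases m; cases n) (auto simp: drl_less_def tdeg_def)

lemma drl_irrefl [simp]: "\<not> drl_less m m"
  by (simp add: drl_less_def)

lemma drl_trans: "drl_less k m \<Longrightarrow> drl_less m n \<Longrightarrow> drl_less k n"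
  by (auto simp: drl_less_def)

lemma wfp_drl: "wfp drl_less"
  unfolding wfp_def
  by (rule wf_subset[OF wf_inv_image[OF wf_lex_prod[OF wf_less_than wf_less_than]],
        of _ "\<lambda>m. (tdeg m, fst m)"]) (auto simp: drl_less_def)

lemma finite_drl: "finite {n. drl_less n m}"
  by (rule finite_subset[of _ "{..tdeg m} \<times> {..tdeg m}"]) (auto simp: drl_less_def tdeg_def)

lemma drl_shift: "drl_less (fst m + a, snd m + b) (fst n + a, snd n + b) \<longleftrightarrow> drl_less m n"
  by (auto simp: drl_less_def tdeg_def)

lemma drl_dvd2: "dvd2 m n \<Longrightarrow> m = n \<or> drl_less m n"
  by (cases m; cases n) (auto simp: drl_less_def tdeg_def dvd2_def)

lemma drl_finite_max:
  assumes "finite S" "S \<noteq> {}"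
  shows "\<exists>m\<in>S. \<forall>n\<in>S. n = m \<or> drl_less n m"
  using assms
proof (induction S rule: finite_ne_induct)
  case (insert x S)
  then obtain m where m: "m \<in> S" "\<forall>n\<in>S. n = m \<or> drl_less n m" by blast
  show ?case
  proof (cases "drl_less m x")
    case True
    hence "\<forall>n\<in>S. drl_less n x" using m drl_trans by metis
    thus ?thesis by auto
  next
    case False
    hence "x = m \<or> drl_less x m" using drl_total[of m x] by auto
    thus ?thesis using m by auto
  qed
qed simp

lemma lead_exists: "f \<noteq> 0 \<Longrightarrow> \<exists>m. lead f m" for f :: "'a::field poly poly"
proof -
  assume "f \<noteq> 0"
  hence "supp f \<noteq> {}" using nonzero_supp[of f] in_supp[of _ f] by blast
  from drl_finite_max[OF finite_supp this] obtain m
    where "m \<in> supp f" "\<forall>n\<in>supp f. n = m \<or> drl_less n m" by blast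
  thus "\<exists>m. lead f m" by (intro exI[of _ m]) (simp add: lead_def in_supp)
qed

lemma lead_unique: "lead f m \<Longrightarrow> lead f n \<Longrightarrow> m = n"
  unfolding lead_def using drl_trans[of n m n] drl_irrefl[of n] by auto

lemma lead_nonzero: "lead f m \<Longrightarrow> f \<noteq> 0" for f :: "'a::field poly poly"
  by (auto simp: lead_def)

lemma init_exp_lead: "lead f m \<Longrightarrow> init_exp f = m" for f :: "'a::field poly poly"
  unfolding init_exp_def
proof (rule the_equality)
  fix n assume "lead f m" "n \<in> supp f \<and> (\<forall>k\<in>supp f. k \<noteq> n \<longrightarrow> drl_less k n)"
  thus "n = m" by (intro lead_unique[of f]) (auto simp: lead_def in_supp)
qed (auto simp: lead_def in_supp)

lemma lead_init_exp: "f \<noteq> 0 \<Longrightarrow> lead f (init_exp f)" for f :: "'a::field poly poly"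
  using lead_exists[of f] init_exp_lead by blast

lemma lead_mono2_mult:
  fixes f :: "'a::field poly poly"
  assumes "lead f m"
  shows "lead (mono2 n * f) (fst m + fst n, snd m + snd n)"
proof -
  have "k = (fst m + fst n, snd m + snd n) \<or> drl_less k (fst m + fst n, snd m + snd n)"
    if "coeff2 (mono2 n * f) k \<noteq> 0" for k
  proof -
    from that have k: "dvd2 n k" "coeff2 f (fst k - fst n, snd k - snd n) \<noteq> 0"
      by (auto simp: coeff2_mono2_mult split: if_splits)
    hence "(fst k - fst n, snd k - snd n) = m \<or> drl_less (fst k - fst n, snd k - snd n) m"
      using assms by (auto simp: lead_def)
    thus ?thesis
      using drl_shift[of "(fst k - fst n, snd k - snd n)" "fst n" "snd n" m] k(1)
      by (cases k) (auto simp: dvd2_def)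
  qed
  thus ?thesis using assms by (auto simp: lead_def coeff2_mono2_mult dvd2_def)
qed

lemma lead_smult:
  fixes f :: "'a::field poly poly"
  assumes "lead f m" "p \<noteq> 0"
  shows "lead (smult p f) (fst m, snd m + degree p)"
proof -
  have c: "coeff2 (smult p f) k = (\<Sum>i\<le>snd k. coeff p i * coeff2 f (fst k, snd k - i))" for k
    by (simp add: coeff2_def coeff_mult)
  have small: "coeff2 f (a, b) = 0" if "\<not> (drl_less (a,b) m \<or> (a,b) = m)" for a b
    using assms(1) that by (auto simp: lead_def)
  have "coeff2 (smult p f) (fst m, snd m + degree p) =
     (\<Sum>i\<in>{degree p}. coeff p i * coeff2 f (fst m, snd m + degree p - i))"
    unfolding c fst_conv snd_conv
  proof (rule sum.mono_neutral_right)
    show "\<forall>i\<in>{..snd m + degree p} - {degree p}.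
       coeff p i * coeff2 f (fst m, snd m + degree p - i) = 0"
    proof
      fix i assume i: "i \<in> {..snd m + degree p} - {degree p}"
      show "coeff p i * coeff2 f (fst m, snd m + degree p - i) = 0"
      proof (cases "i > degree p")
        case False
        thus ?thesis using i by (cases m) (auto intro!: small simp: drl_less_def tdeg_def)
      qed (simp add: coeff_eq_0)
    qed
  qed auto
  hence "coeff2 (smult p f) (fst m, snd m + degree p) \<noteq> 0"
    using assms by (simp add: lead_def)
  moreover have "k = (fst m, snd m + degree p) \<or> drl_less k (fst m, snd m + degree p)"
    if k: "coeff2 (smult p f) k \<noteq> 0" for k
  proof -
    obtain i where i: "i \<le> snd k" "coeff p i \<noteq> 0" "coeff2 f (fst k, snd k - i) \<noteq> 0"
      using k unfolding c by (metis (no_types, lifting) atMost_iff mult_eq_0_iff sum.not_neutral_contains_not_neutral)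
    have "i \<le> degree p" using i by (simp add: le_degree)
    moreover have "(fst k, snd k - i) = m \<or> drl_less (fst k, snd k - i) m"
      using i assms by (auto simp: lead_def)
    ultimately show ?thesis using i(1)
      by (cases k; cases m) (auto simp: drl_less_def tdeg_def)
  qed
  ultimately show ?thesis by (auto simp: lead_def)
qed

text \<open>
  The largest of the leading exponents occurs in one summand only and cannot be cancelled.
  This is how \<open>K[y]\<close>-combinations of elements with leading exponents in different
  \<open>x\<close>-degrees are handled.
\<close>

lemma lead_sum_distinct:
  fixes p :: "'i \<Rightarrow> 'a::field poly poly"
  assumes "finite J" "J \<noteq> {}" "\<And>j. j \<in> J \<Longrightarrow> lead (p j) (l j)" "inj_on l J"
  shows "\<exists>j\<in>J. lead (\<Sum>j\<in>J. p j) (l j)"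
proof -
  obtain m where m: "m \<in> l ` J" "\<And>n. n \<in> l ` J \<Longrightarrow> n = m \<or> drl_less n m"
    using drl_finite_max[of "l ` J"] assms(1,2) by blast
  then obtain j where j: "j \<in> J" "m = l j" by auto
  have other: "drl_less (l k) (l j)" if "k \<in> J" "k \<noteq> j" for k
    using m(2)[of "l k"] j that assms(4) by (auto simp: inj_on_def)
  have "coeff2 (\<Sum>j\<in>J. p j) (l j) = coeff2 (p j) (l j)"
  proof -
    have "coeff2 (p k) (l j) = 0" if "k \<in> J - {j}" for k
      using other[of k] that assms(3)[of k] drl_trans drl_irrefl unfolding lead_def
      by (metis DiffE insertI1)
    thus ?thesis
      using j assms(1) by (simp add: coeff2_sum sum.remove)
  qed
  hence "coeff2 (\<Sum>j\<in>J. p j) (l j) \<noteq> 0" using assms(3) j by (simp add: lead_def)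
  moreover have "n = l j \<or> drl_less n (l j)" if n: "coeff2 (\<Sum>j\<in>J. p j) n \<noteq> 0" for n
  proof -
    obtain k where k: "k \<in> J" "coeff2 (p k) n \<noteq> 0"
      by (rule sum.not_neutral_contains_not_neutral[OF n[unfolded coeff2_sum]])
    hence "n = l k \<or> drl_less n (l k)" using assms(3)[of k] by (auto simp: lead_def)
    thus ?thesis using other[of k] k by (cases "k = j") (auto intro: drl_trans)
  qed
  ultimately have "lead (\<Sum>j\<in>J. p j) (l j)" unfolding lead_def by blast
  thus ?thesis using j by blast
qed

section \<open>Ideals with a prescribed initial ideal\<close>

definition lead_exps :: "'a::field poly poly set \<Rightarrow> (nat \<times> nat) set" where
  "lead_exps I = {m. \<exists>f\<in>I. lead f m}"

lemma ideal_mult: "is_ideal I \<Longrightarrow> f \<in> I \<Longrightarrow> r * f \<in> I"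
  by (rule ring_module.subspace_scale)

lemma ideal_smult: "is_ideal I \<Longrightarrow> f \<in> I \<Longrightarrow> smult p f \<in> I"
  using ideal_mult[of I f "[:p:]"] by simp

lemmas ideal_add = ring_module.subspace_add
lemmas ideal_diff = ring_module.subspace_diff
lemmas ideal_sum = ring_module.subspace_sum
lemmas ideal_0 = ring_module.subspace_0

lemma mem_monomial_ideal:
  fixes p :: "'a::field poly poly"
  shows "p \<in> ideal_gen (mono2 ` S) \<longleftrightarrow> (\<forall>m\<in>supp p. \<exists>s\<in>S. dvd2 s m)"
proof
  assume "p \<in> ideal_gen (mono2 ` S)"
  thus "\<forall>m\<in>supp p. \<exists>s\<in>S. dvd2 s m"
  proof (induction rule: ring_module.span_induct_alt)
    case base
    then show ?case by (auto simp: in_supp)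
  next
    case (step c x y)
    then obtain s where s: "s \<in> S" "x = mono2 s" by auto
    show ?case
    proof
      fix m assume "m \<in> supp (c * x + y)"
      hence "coeff2 (mono2 s * c) m \<noteq> 0 \<or> coeff2 y m \<noteq> 0"
        using s by (auto simp: in_supp mult.commute)
      thus "\<exists>s\<in>S. dvd2 s m"
        using step s by (auto simp: coeff2_mono2_mult in_supp split: if_splits)
    qed
  qed
next
  assume *: "\<forall>m\<in>supp p. \<exists>s\<in>S. dvd2 s m"
  have "(\<Sum>m\<in>supp p. smult [:coeff2 p m:] (mono2 m)) \<in> ideal_gen (mono2 ` S)"
  proof (rule ring_module.span_sum)
    fix m assume "m \<in> supp p"
    then obtain s where s: "s \<in> S" "dvd2 s m" using * by auto
    have "mono2 m \<in> ideal_gen (mono2 ` S)"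
      by (subst mono2_dvd2[OF s(2)]) (intro ring_module.span_scale ring_module.span_base imageI s(1))
    thus "smult [:coeff2 p m:] (mono2 m) \<in> ideal_gen (mono2 ` S)"
      by (intro ideal_smult) (auto intro: ring_module.subspace_span)
  qed
  thus "p \<in> ideal_gen (mono2 ` S)" using sum_supp[of p] by simp
qed

lemma mono2_mem_monomial_ideal:
  "(mono2 m :: 'a::field poly poly) \<in> ideal_gen (mono2 ` S) \<longleftrightarrow> (\<exists>s\<in>S. dvd2 s m)"
proof -
  have "supp (mono2 m :: 'a poly poly) = {m}" by (auto simp: in_supp coeff2_mono2 split: if_splits)
  thus ?thesis by (simp add: mem_monomial_ideal)
qed

lemma lead_exps_dvd2:
  assumes "is_ideal I" "m \<in> lead_exps I" "dvd2 m n"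
  shows "n \<in> lead_exps I"
proof -
  obtain f where f: "f \<in> I" "lead f m" using assms by (auto simp: lead_exps_def)
  have "lead (mono2 (fst n - fst m, snd n - snd m) * f) n"
    using lead_mono2_mult[OF f(2), of "(fst n - fst m, snd n - snd m)"] assms(3)
    by (cases n) (auto simp: dvd2_def)
  thus ?thesis using ideal_mult[OF assms(1) f(1)] by (auto simp: lead_exps_def)
qed

lemma init_ideal_lead_exps: "init_ideal I = ideal_gen (mono2 ` lead_exps I)"
  for I :: "'a::field poly poly set"
proof -
  have "{mono2 (init_exp f) | f. f \<in> I \<and> f \<noteq> 0} = (mono2 ` lead_exps I :: 'a poly poly set)"
  proof (intro subset_antisym subsetI)
    fix p assume "p \<in> {mono2 (init_exp f) | f. f \<in> I \<and> f \<noteq> 0}"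
    then obtain f where "f \<in> I" "f \<noteq> 0" "p = mono2 (init_exp f)" by auto
    thus "p \<in> mono2 ` lead_exps I" using lead_init_exp[of f] unfolding lead_exps_def by blast
  next
    fix p :: "'a poly poly" assume "p \<in> mono2 ` lead_exps I"
    then obtain f m where f: "f \<in> I" "lead f m" "p = mono2 m" unfolding lead_exps_def by blast
    thus "p \<in> {mono2 (init_exp f) | f. f \<in> I \<and> f \<noteq> 0}"
      using init_exp_lead[OF f(2)] lead_nonzero[OF f(2)] by blast
  qed
  thus ?thesis by (simp add: init_ideal_def)
qed

lemma mono2_mem_init_ideal:
  assumes "is_ideal I"
  shows "mono2 m \<in> init_ideal I \<longleftrightarrow> m \<in> lead_exps I"
proof
  assume "mono2 m \<in> init_ideal I"
  then obtain s where "s \<in> lead_exps I" "dvd2 s m"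
    unfolding init_ideal_lead_exps mono2_mem_monomial_ideal by blast
  thus "m \<in> lead_exps I" by (rule lead_exps_dvd2[OF assms])
next
  assume "m \<in> lead_exps I"
  thus "mono2 m \<in> init_ideal I"
    unfolding init_ideal_lead_exps mono2_mem_monomial_ideal using dvd2_refl by blast
qed

lemma monomial_ideal_eq_gen:
  assumes "monomial_ideal I0"
  shows "I0 = ideal_gen (mono2 ` {m. mono2 m \<in> I0})"
proof -
  obtain S where S: "I0 = ideal_gen (mono2 ` S)" using assms by (auto simp: monomial_ideal_def)
  have *: "mono2 m \<in> I0 \<longleftrightarrow> (\<exists>s\<in>S. dvd2 s m)" for m
    by (simp only: S mono2_mem_monomial_ideal)
  have "(\<exists>s\<in>S. dvd2 s m) \<longleftrightarrow> (\<exists>s\<in>{m. mono2 m \<in> I0}. dvd2 s m)" for m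
  proof
    show "\<exists>s\<in>{m. mono2 m \<in> I0}. dvd2 s m" if "\<exists>s\<in>S. dvd2 s m"
      using that * dvd2_refl by (intro bexI[of _ m]) auto
    show "\<exists>s\<in>S. dvd2 s m" if "\<exists>s\<in>{m. mono2 m \<in> I0}. dvd2 s m"
    proof -
      from that obtain k s where "dvd2 k m" "s \<in> S" "dvd2 s k" using * by blast
      thus ?thesis using dvd2_trans by blast
    qed
  qed
  hence "p \<in> ideal_gen (mono2 ` S) \<longleftrightarrow> p \<in> ideal_gen (mono2 ` {m. mono2 m \<in> I0})" for p
    by (simp only: mem_monomial_ideal)
  hence "ideal_gen (mono2 ` S) = ideal_gen (mono2 ` {m. mono2 m \<in> I0})"
    by (rule Set.set_eqI)
  with S show ?thesis by (rule trans)
qed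

text \<open>
  Working with sets of exponents instead of initial ideals is possible because a monomial
  ideal is determined by its monomials.
\<close>

lemma mem_V_iff:
  assumes "monomial_ideal I0"
  shows "I \<in> V I0 \<longleftrightarrow> is_ideal I \<and> lead_exps I = {m. mono2 m \<in> I0}"
proof
  assume "I \<in> V I0"
  hence "is_ideal I" "init_ideal I = I0" by (auto simp: V_def)
  thus "is_ideal I \<and> lead_exps I = {m. mono2 m \<in> I0}"
    using mono2_mem_init_ideal[of I] by blast
next
  assume I: "is_ideal I \<and> lead_exps I = {m. mono2 m \<in> I0}"
  hence "init_ideal I = ideal_gen (mono2 ` {m. mono2 m \<in> I0})"
    by (simp only: init_ideal_lead_exps)
  also have "\<dots> = I0" by (rule monomial_ideal_eq_gen[OF assms, symmetric])
  finally show "I \<in> V I0" using I by (simp add: V_def)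
qed

lemma lead_exps_monic:
  assumes "is_ideal I" "m \<in> lead_exps I"
  shows "\<exists>f\<in>I. lead f m \<and> coeff2 f m = 1"
proof -
  obtain f where f: "f \<in> I" "lead f m" using assms by (auto simp: lead_exps_def)
  hence nz: "coeff2 f m \<noteq> 0" by (simp add: lead_def)
  have "lead (smult [:inverse (coeff2 f m):] f) (fst m, snd m + degree [:inverse (coeff2 f m):])"
    by (rule lead_smult[OF f(2)]) (use nz in simp)
  hence "lead (smult [:inverse (coeff2 f m):] f) m"
    by (metis add_0_right degree_pCons_0 prod.collapse)
  moreover have "coeff2 (smult [:inverse (coeff2 f m):] f) m = 1"
    using f(2) by (simp add: lead_def)
  ultimately show ?thesis using ideal_smult[OF assms(1) f(1)] by blast
qed

lemma cancel_lead:
  fixes f g :: "'a::field poly poly"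
  assumes "lead f m" "lead g m" "coeff2 g m = 1" "coeff2 (f - smult [:coeff2 f m:] g) n \<noteq> 0"
  shows "drl_less n m"
proof -
  have "coeff2 f n - coeff2 f m * coeff2 g n \<noteq> 0" using assms(4) by simp
  hence "n \<noteq> m" "coeff2 f n \<noteq> 0 \<or> coeff2 g n \<noteq> 0" using assms(3) by auto
  thus ?thesis using assms(1,2) unfolding lead_def by blast
qed

text \<open>
  A leading term of an element of the larger ideal can be cancelled by an element of the
  smaller one; the DRL order is well-founded, so repeating this ends at zero.
\<close>

lemma ideal_eq_if_lead_exps_eq:
  assumes I: "is_ideal I" and J: "is_ideal J" and sub: "I \<subseteq> J" and eq: "lead_exps J \<subseteq> lead_exps I"
  shows "I = J"
proof -
  have *: "\<forall>f. f \<in> J \<and> lead f m \<longrightarrow> f \<in> I" for m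
  proof (induction m rule: wfp_induct_rule[OF wfp_drl])
    case (1 m)
    show ?case
    proof (intro allI impI, elim conjE)
      fix f assume f: "f \<in> J" "lead f m"
      hence "m \<in> lead_exps I" using eq by (auto simp: lead_exps_def)
      then obtain g where g: "g \<in> I" "lead g m" "coeff2 g m = 1" using lead_exps_monic[OF I] by blast
      let ?h = "f - smult [:coeff2 f m:] g"
      have "?h \<in> I"
      proof (cases "?h = 0")
        case False
        then obtain n where n: "lead ?h n" using lead_exists by blast
        hence "drl_less n m" using cancel_lead[OF f(2) g(2,3)] by (simp add: lead_def)
        moreover have "?h \<in> J" using f g sub J by (meson ideal_diff ideal_smult subsetD)
        ultimately show ?thesis using 1 n by blast
      qed (simp add: ideal_0[OF I])
      from ideal_add[OF I this ideal_smult[OF I g(1), of "[:coeff2 f m:]"]] show "f \<in> I" by simp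
    qed
  qed
  show ?thesis
  proof
    show "J \<subseteq> I"
    proof
      fix f assume "f \<in> J"
      thus "f \<in> I" using * lead_exists[of f] ideal_0[OF I] by (cases "f = 0") auto
    qed
  qed (fact sub)
qed

text \<open>
  Division by \<open>I\<close>: the remainder of a monomial, by recursion on the DRL order.
  Elements with prescribed leading monomials and no further monomials in the initial ideal
  arise as monomial minus remainder.
\<close>

lemma remainder_exists:
  assumes I: "is_ideal I"
  shows "\<exists>r. mono2 m - r \<in> I \<and> supp r \<inter> lead_exps I = {} \<and> (\<forall>n\<in>supp r. n = m \<or> drl_less n m)"
proof (induction m rule: wfp_induct_rule[OF wfp_drl])
  case (1 m)
  show ?case
  proof (cases "m \<in> lead_exps I")
    case False
    thus ?thesis using ideal_0[OF I]
      by (intro exI[of _ "mono2 m"]) (auto simp: in_supp coeff2_mono2 split: if_splits)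
  next
    case True
    then obtain h where h: "h \<in> I" "lead h m" "coeff2 h m = 1" using lead_exps_monic[OF I] by blast
    obtain R where R: "\<And>n. drl_less n m \<Longrightarrow> mono2 n - R n \<in> I \<and> supp (R n) \<inter> lead_exps I = {} \<and>
        (\<forall>k\<in>supp (R n). k = n \<or> drl_less k n)" using 1 by metis
    define S where "S = supp h - {m}"
    have S: "finite S" "\<And>n. n \<in> S \<Longrightarrow> drl_less n m"
      using h by (auto simp: S_def finite_supp lead_def in_supp)
    define r where "r = - (\<Sum>n\<in>S. smult [:coeff2 h n:] (R n))"
    define q where "q = (\<Sum>n\<in>S. smult [:coeff2 h n:] (mono2 n))"
    have "h = (\<Sum>n\<in>supp h. smult [:coeff2 h n:] (mono2 n))" by (rule sum_supp)
    also have "\<dots> = mono2 m + q"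
      unfolding q_def S_def using h
      by (subst sum.remove[of _ m]) (auto simp: finite_supp in_supp simp flip: one_pCons)
    finally have "h = mono2 m + q" .
    moreover have "(\<Sum>n\<in>S. smult [:coeff2 h n:] (mono2 n - R n)) = q + r"
      by (simp add: smult_diff_right sum_subtractf r_def q_def)
    ultimately have "mono2 m - r = h - (\<Sum>n\<in>S. smult [:coeff2 h n:] (mono2 n - R n))"
      by simp
    moreover have "(\<Sum>n\<in>S. smult [:coeff2 h n:] (mono2 n - R n)) \<in> I"
      using S R by (intro ideal_sum[OF I] ideal_smult[OF I]) auto
    ultimately have 1: "mono2 m - r \<in> I" by (simp only: ideal_diff[OF I h(1)])
    have 2: "\<exists>n\<in>S. k \<in> supp (R n)" if "k \<in> supp r" for k
    proof -
      have "(\<Sum>n\<in>S. coeff2 h n * coeff2 (R n) k) \<noteq> 0"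
        using that by (simp add: in_supp r_def coeff2_sum)
      then obtain n where "n \<in> S" "coeff2 h n * coeff2 (R n) k \<noteq> 0"
        by (rule sum.not_neutral_contains_not_neutral)
      thus ?thesis by (auto simp: in_supp)
    qed
    have "k \<notin> lead_exps I \<and> drl_less k m" if k: "k \<in> supp r" for k
    proof -
      obtain n where n: "n \<in> S" "k \<in> supp (R n)" using 2[OF k] by blast
      have "k \<notin> lead_exps I" "k = n \<or> drl_less k n" using R[OF S(2)[OF n(1)]] n(2) by blast+
      thus ?thesis using S(2)[OF n(1)] drl_trans by metis
    qed
    with 1 show ?thesis by blast
  qed
qed

lemma remainder_unique:
  assumes I: "is_ideal I"
    and "p - r \<in> I" "supp r \<inter> lead_exps I = {}" "p - s \<in> I" "supp s \<inter> lead_exps I = {}"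
  shows "r = s"
proof (rule ccontr)
  assume "r \<noteq> s"
  then obtain m where m: "lead (r - s) m" using lead_exists[of "r - s"] by auto
  have "r - s \<in> I" using ideal_diff[OF I assms(4,2)] by simp
  hence "m \<in> lead_exps I" using m by (auto simp: lead_exps_def)
  hence "coeff2 r m = 0" "coeff2 s m = 0" using assms(3,5) in_supp by blast+
  thus False using m by (simp add: lead_def)
qed

section \<open>Degree bounds with integer values\<close>

text \<open>
  A negative bound forces the zero polynomial, which is the convention for the entries of the
  parametrizing matrices. Quantifying over coefficients instead of using \<open>degree\<close>
  makes the bound stable under differences without case distinctions.
\<close>

definition dle :: "'a::zero poly \<Rightarrow> int \<Rightarrow> bool" where
  "dle p w \<longleftrightarrow> (\<forall>n. w < int n \<longrightarrow> coeff p n = 0)"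

lemma dle_0 [simp]: "dle 0 w"
  by (simp add: dle_def)

lemma dle_mono: "dle p w \<Longrightarrow> w \<le> w' \<Longrightarrow> dle p w'"
  by (auto simp: dle_def)

lemma dleD: "dle p w \<Longrightarrow> coeff p n \<noteq> 0 \<Longrightarrow> int n \<le> w"
  by (auto simp: dle_def not_less[symmetric])

lemma dle_add: "dle p w \<Longrightarrow> dle q w \<Longrightarrow> dle (p + q) w"
  by (simp add: dle_def)

lemma dle_diff: "dle p w \<Longrightarrow> dle q w \<Longrightarrow> dle (p - q) w" for p :: "'a::ab_group_add poly"
  by (simp add: dle_def)

lemma dle_minus: "dle p w \<Longrightarrow> dle (- p) w" for p :: "'a::ab_group_add poly"
  by (simp add: dle_def)

lemma dle_sum: "(\<And>i. i \<in> S \<Longrightarrow> dle (f i) w) \<Longrightarrow> dle (\<Sum>i\<in>S. f i) w"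
  by (induction S rule: infinite_finite_induct) (auto intro: dle_add)

lemma dle_mult:
  fixes p q :: "'a::comm_semiring_0 poly"
  assumes "dle p w" "dle q w'"
  shows "dle (p * q) (w + w')"
  unfolding dle_def
proof (intro allI impI, rule ccontr)
  fix n assume n: "w + w' < int n" and "coeff (p * q) n \<noteq> 0"
  hence "(\<Sum>i\<le>n. coeff p i * coeff q (n - i)) \<noteq> 0" by (simp add: coeff_mult)
  then obtain i where "i \<in> {..n}" "coeff p i * coeff q (n - i) \<noteq> 0"
    by (rule sum.not_neutral_contains_not_neutral)
  hence "i \<le> n" "coeff p i \<noteq> 0" "coeff q (n - i) \<noteq> 0" by auto
  with dleD[OF assms(1), of i] dleD[OF assms(2), of "n - i"] n show False by simp
qed

lemma dle_mult_le:
  fixes p q :: "'a::comm_semiring_0 poly"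
  assumes "dle p w" "dle q w'" "w + w' \<le> u"
  shows "dle (p * q) u"
  using dle_mono[OF dle_mult] assms by blast

lemma dle_degree: "dle p w \<longleftrightarrow> p = 0 \<or> int (degree p) \<le> w"
proof
  assume "dle p w"
  thus "p = 0 \<or> int (degree p) \<le> w" using dleD[of p w "degree p"] by auto
next
  assume "p = 0 \<or> int (degree p) \<le> w"
  thus "dle p w"
  proof
    assume "int (degree p) \<le> w"
    thus ?thesis by (auto simp: dle_def intro!: coeff_eq_0)
  qed simp
qed

section \<open>Leading exponents of syzygy vectors\<close>

locale staircase =
  fixes t :: nat and m :: "nat \<Rightarrow> nat"
  assumes m_0 [simp]: "m 0 = 0" and m_strict: "i < t \<Longrightarrow> m i < m (Suc i)"
begin

text \<open>
  The \<open>j\<close>-th generator of the staircase has degree \<open>t + v j\<close>.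
\<close>

definition v :: "nat \<Rightarrow> int" where "v i = int (m i) - int i"

definition d :: "nat \<Rightarrow> nat" where "d i = m (Suc i) - m i"

text \<open>
  With this bound on \<open>c\<close>, the leading term of \<open>c f\<^sub>i\<close> lies
  below the leading term \<open>x^(t-j) y^(m\<^bsub>j+1\<^esub>)\<close> of
  \<open>x f\<^bsub>j+1\<^esub>\<close> in the DRL order. Equality of degrees is allowed only
  for \<open>i > j\<close>, where the power of \<open>x\<close> in
  \<open>in(f\<^sub>i)\<close> is smaller.
\<close>

definition bnd :: "nat \<Rightarrow> nat \<Rightarrow> int" where
  "bnd i j = v (Suc j) - v i + (if i \<le> j then 0 else 1)"

definition bounded :: "(nat \<Rightarrow> nat \<Rightarrow> 'a::field poly) \<Rightarrow> bool" where
  "bounded C \<longleftrightarrow> (\<forall>i\<le>t. \<forall>j<t. dle (C i j) (bnd i j))"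

text \<open>
  The part of \<open>X + C\<close> that is free of \<open>x\<close>.
\<close>

definition Y :: "(nat \<Rightarrow> nat \<Rightarrow> 'a::field poly) \<Rightarrow> nat \<Rightarrow> nat \<Rightarrow> 'a poly" where
  "Y C i j = C i j + (if i = j then monom 1 (d j) else 0)"

text \<open>
  The equation \<open>h (X + C) = 0\<close>, column by column and solved for the multiple of
  \<open>x\<close>.
\<close>

definition syz :: "(nat \<Rightarrow> nat \<Rightarrow> 'a::field poly) \<Rightarrow> (nat \<Rightarrow> 'a poly poly) \<Rightarrow> bool" where
  "syz C h \<longleftrightarrow> (\<forall>j<t. pCons 0 (h (Suc j)) = (\<Sum>i\<le>t. smult (Y C i j) (h i)))"

lemma v_0 [simp]: "v 0 = 0"
  by (simp add: v_def)

lemma v_Suc: "i < t \<Longrightarrow> v (Suc i) = v i + int (d i) - 1"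
  using m_strict[of i] by (simp add: v_def d_def)

lemma d_pos: "i < t \<Longrightarrow> 0 < d i"
  using m_strict[of i] by (simp add: d_def)

lemma m_mono: "i \<le> j \<Longrightarrow> j \<le> t \<Longrightarrow> m i \<le> m j"
proof (induction j rule: dec_induct)
  case (step n)
  thus ?case using m_strict[of n] by simp
qed simp

lemma coeff2_smult: "coeff2 (smult p f) (a, b) = (\<Sum>n\<le>b. coeff p n * coeff2 f (a, b - n))"
  for f :: "'a::field poly poly"
  by (simp add: coeff2_def coeff_mult)

lemma coeff2_smult_monom:
  "coeff2 (smult (monom 1 n) f) (a, b) = (if n \<le> b then coeff2 f (a, b - n) else 0)"
  for f :: "'a::field poly poly"
  by (simp add: coeff2_def coeff_monom_mult)

lemma coeff2_pCons_0: "coeff2 (pCons 0 f) (a, b) = (if a = 0 then 0 else coeff2 f (a - 1, b))"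
  for f :: "'a::field poly poly"
  by (cases a) (simp_all add: coeff2_def)

text \<open>
  Give the monomial \<open>x^a y^b\<close> of \<open>h\<^sub>j\<close> the weight
  \<open>(a + b - v\<^sub>j, a + j)\<close>, ordered lexicographically. In relation
  \<open>j\<close> compare coefficients in the weight that is the largest one over the whole
  vector: by the degree bounds only \<open>x h\<^bsub>j+1\<^esub>\<close> and
  \<open>y^(d\<^sub>j) h\<^sub>j\<close> contribute. So a coefficient of maximal weight
  propagates unchanged to all entries of \<open>h\<close>. Within one entry, comparing weights
  is comparing monomials in the DRL order. Reaching \<open>h\<^sub>t\<close> from
  \<open>h\<^sub>0\<close> costs \<open>t\<close> factors \<open>x\<close>, hence
  \<open>t \<le> \<alpha>\<close>.
\<close>

lemma syz_lead:
  fixes h :: "nat \<Rightarrow> 'a::field poly poly"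
  assumes C: "bounded C" and h: "syz C h" and nz: "\<exists>j\<le>t. h j \<noteq> 0"
  shows "\<exists>\<alpha> \<beta> \<kappa>. \<kappa> \<noteq> 0 \<and> t \<le> \<alpha> \<and>
    (\<forall>j\<le>t. lead (h j) (\<alpha> - j, \<beta> + m j) \<and> coeff2 (h j) (\<alpha> - j, \<beta> + m j) = \<kappa>)"
proof -
  define S where "S = (SIGMA j:{..t}. supp (h j))"
  have finS: "finite S" by (auto simp: S_def finite_supp)
  have neS: "S \<noteq> {}" using nz nonzero_supp by (fastforce simp: S_def in_supp)
  (* The maximal weight: \<mu> is its first component, \<alpha> the second one, attained in
     the entry j0 at the monomial n0. *)
  define \<mu> where "\<mu> = Max ((\<lambda>(j, n). int (tdeg n) - v j) ` S)"
  define S' where "S' = {(j, n) \<in> S. int (tdeg n) - v j = \<mu>}"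
  have \<mu>: "int (tdeg n) - v j \<le> \<mu>" if "(j, n) \<in> S" for j n
    unfolding \<mu>_def using that finS by (intro Max_ge) force+
  have "\<mu> \<in> (\<lambda>(j, n). int (tdeg n) - v j) ` S"
    unfolding \<mu>_def using finS neS by (intro Max_in) auto
  hence neS': "S' \<noteq> {}" by (auto simp: S'_def)
  have finS': "finite S'" using finS by (rule rev_finite_subset) (auto simp: S'_def)
  define \<alpha> where "\<alpha> = Max ((\<lambda>(j, n). fst n + j) ` S')"
  have \<alpha>: "fst n + j \<le> \<alpha>" if "(j, n) \<in> S'" for j n
    unfolding \<alpha>_def using that finS' by (intro Max_ge) force+
  have "\<alpha> \<in> (\<lambda>(j, n). fst n + j) ` S'"
    unfolding \<alpha>_def using finS' neS' by (intro Max_in) auto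
  then obtain j0 n0 where 0: "(j0, n0) \<in> S'" "fst n0 + j0 = \<alpha>" by auto
  define \<kappa> where "\<kappa> = coeff2 (h j0) n0"
  have j0: "j0 \<le> t" "\<kappa> \<noteq> 0" using 0 by (auto simp: S'_def S_def in_supp \<kappa>_def)

  have top: "int a + int b - v i < \<mu> \<or> int a + int b - v i = \<mu> \<and> a + i \<le> \<alpha>"
    if "i \<le> t" "coeff2 (h i) (a, b) \<noteq> 0" for i a b
  proof -
    have "(i, (a, b)) \<in> S" using that by (auto simp: S_def in_supp)
    thus ?thesis using \<mu>[of i "(a, b)"] \<alpha>[of i "(a, b)"] by (auto simp: S'_def tdeg_def)
  qed

  (* Relation j in maximal weight: no entry of C contributes. *)
  have rel: "(if a = 0 then 0 else coeff2 (h (Suc j)) (a - 1, b)) =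
      (if d j \<le> b then coeff2 (h j) (a, b - d j) else 0)"
    if j: "j < t" and ab: "a + j = \<alpha>" "int a + int b = \<mu> + v (Suc j) + 1" for j a b
  proof -
    have C0: "coeff2 (smult (C i j) (h i)) (a, b) = 0" if i: "i \<le> t" for i
      unfolding coeff2_smult
    proof (rule sum.neutral, rule ballI, rule ccontr)
      fix n assume n: "n \<in> {..b}" "coeff (C i j) n * coeff2 (h i) (a, b - n) \<noteq> 0"
      hence "int n \<le> bnd i j" using C i j dleD[of "C i j" "bnd i j" n] by (auto simp: bounded_def)
      moreover have "int a + int (b - n) - v i < \<mu> \<or> int a + int (b - n) - v i = \<mu> \<and> a + i \<le> \<alpha>"
        using n by (intro top[OF i]) auto
      ultimately show False using n(1) ab by (auto simp: bnd_def of_nat_diff split: if_splits)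
    qed
    have "coeff2 (pCons 0 (h (Suc j))) (a, b) = (\<Sum>i\<le>t. coeff2 (smult (Y C i j) (h i)) (a, b))"
      using h j by (simp add: syz_def coeff2_sum)
    also have "\<dots> = (\<Sum>i\<le>t. if i = j then coeff2 (smult (monom 1 (d j)) (h j)) (a, b) else 0)"
      by (rule sum.cong) (auto simp: Y_def smult_add_left C0)
    finally show ?thesis using j by (simp add: coeff2_smult_monom coeff2_pCons_0)
  qed

  (* P j: the coefficient of maximal weight in the entry j exists and is \<kappa>. *)
  define P where "P j \<longleftrightarrow> (\<exists>a b. a + j = \<alpha> \<and> int a + int b = \<mu> + v j \<and> coeff2 (h j) (a, b) = \<kappa>)" for j
  have P0: "P j0" unfolding P_def
    using 0 by (intro exI[of _ "fst n0"] exI[of _ "snd n0"]) (auto simp: S'_def \<kappa>_def tdeg_def)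
  have down: "P j" if "P (Suc j)" "j < t" for j
  proof -
    from that obtain a b where ab: "a + Suc j = \<alpha>" "int a + int b = \<mu> + v (Suc j)"
      "coeff2 (h (Suc j)) (a, b) = \<kappa>" by (auto simp: P_def)
    have "\<kappa> = (if d j \<le> b then coeff2 (h j) (Suc a, b - d j) else 0)"
      using rel[of j "Suc a" b] ab that by simp
    hence "d j \<le> b" "coeff2 (h j) (Suc a, b - d j) = \<kappa>" using j0 by (auto split: if_splits)
    thus ?thesis unfolding P_def
      using ab v_Suc[OF that(2)] by (intro exI[of _ "Suc a"] exI[of _ "b - d j"]) auto
  qed
  have up: "P (Suc j)" if "P j" "j < t" for j
  proof -
    from that obtain a b where ab: "a + j = \<alpha>" "int a + int b = \<mu> + v j"
      "coeff2 (h j) (a, b) = \<kappa>" by (auto simp: P_def)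
    have "(if a = 0 then 0 else coeff2 (h (Suc j)) (a - 1, b + d j)) = \<kappa>"
      using rel[of j a "b + d j"] ab v_Suc[OF that(2)] that by simp
    hence "a > 0" "coeff2 (h (Suc j)) (a - 1, b + d j) = \<kappa>" using j0 by (auto split: if_splits)
    thus ?thesis unfolding P_def
      using ab v_Suc[OF that(2)] by (intro exI[of _ "a - 1"] exI[of _ "b + d j"]) auto
  qed
  have "P 0" if "P k" "k \<le> t" for k
    using that
  proof (induction k)
    case (Suc k)
    thus ?case using down[of k] by simp
  qed
  hence "P 0" using P0 j0(1) by blast
  have P: "P j" if "j \<le> t" for j
    using that \<open>P 0\<close> by (induction j) (auto intro: up)
  obtain \<beta> where \<beta>: "int \<alpha> + int \<beta> = \<mu>" using \<open>P 0\<close> by (auto simp: P_def)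
  have "lead (h j) (\<alpha> - j, \<beta> + m j) \<and> coeff2 (h j) (\<alpha> - j, \<beta> + m j) = \<kappa>" if j: "j \<le> t" for j
  proof -
    obtain a b where ab: "a + j = \<alpha>" "int a + int b = \<mu> + v j" "coeff2 (h j) (a, b) = \<kappa>"
      using P[OF j] by (auto simp: P_def)
    have eq: "a = \<alpha> - j" "b = \<beta> + m j" using ab \<beta> by (auto simp: v_def)
    have "lead (h j) (a, b)"
      unfolding lead_def
    proof (intro conjI allI impI)
      fix n assume "coeff2 (h j) n \<noteq> 0"
      hence "int (fst n) + int (snd n) - v j < \<mu> \<or> int (fst n) + int (snd n) - v j = \<mu> \<and> fst n + j \<le> \<alpha>"
        using top[OF j, of "fst n" "snd n"] by simp
      thus "n = (a, b) \<or> drl_less n (a, b)"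
        using ab(1,2) by (cases n) (auto simp: drl_less_def tdeg_def)
    qed (use ab j0 in simp)
    thus ?thesis using ab(3) eq by simp
  qed
  moreover have "t \<le> \<alpha>" using P[of t] by (auto simp: P_def)
  ultimately show ?thesis using j0 by blast
qed

section \<open>Maximal minors\<close>

text \<open>
  The entries of \<open>X + C\<close>.
\<close>

definition relation_matrix :: "(nat \<Rightarrow> nat \<Rightarrow> 'a::field poly) \<Rightarrow> nat \<Rightarrow> nat \<Rightarrow> 'a poly poly" where
  "relation_matrix C i j = [:Y C i j:] - (if i = Suc j then monom 1 1 else 0)"

text \<open>
  The minor without row \<open>k\<close>. The usual sign \<open>(-1)^k\<close> is corrected by
  \<open>(-1)^t\<close>, which makes entry \<open>0\<close> monic in \<open>x\<close>.
\<close>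

definition signed_minor :: "(nat \<Rightarrow> nat \<Rightarrow> 'a::field poly) \<Rightarrow> nat \<Rightarrow> 'a poly poly" where
  "signed_minor C k = (-1) ^ (t + k) * det (mat t t (\<lambda>(a, b). relation_matrix C (if a < k then a else Suc a) b))"

text \<open>
  Repeat column \<open>l\<close> in front of the matrix and expand the vanishing determinant
  along the new column.
\<close>

lemma minor_relation:
  fixes C :: "nat \<Rightarrow> nat \<Rightarrow> 'a::field poly"
  assumes "l < t"
  shows "(\<Sum>i\<le>t. signed_minor C i * relation_matrix C i l) = 0"
proof -
  define N where "N = mat (Suc t) (Suc t) (\<lambda>(a, b). if b = 0 then relation_matrix C a l else relation_matrix C a (b - 1))"
  have N: "N \<in> carrier_mat (Suc t) (Suc t)" by (simp add: N_def)
  have "det N = 0"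
  proof (rule det_identical_columns[OF N, of 0 "Suc l"])
    show "col N 0 = col N (Suc l)" by (rule eq_vecI) (use assms in \<open>simp_all add: N_def\<close>)
  qed (use assms in simp_all)
  have cof: "cofactor N i 0 = (-1) ^ t * signed_minor C i" if "i \<le> t" for i
  proof -
    have "mat_delete N i 0 = mat t t (\<lambda>(a, b). relation_matrix C (if a < i then a else Suc a) b)"
      unfolding mat_delete_def N_def by (rule eq_matI) (use that in auto)
    hence "cofactor N i 0 = (-1) ^ i * det (mat t t (\<lambda>(a, b). relation_matrix C (if a < i then a else Suc a) b))"
      by (simp add: cofactor_def)
    also have "(-1 :: 'a poly poly) ^ i = (-1) ^ t * (-1) ^ (t + i)"
      by (cases "even t"; cases "even i") simp_all
    finally show ?thesis by (simp only: signed_minor_def mult.assoc)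
  qed
  have "0 = (\<Sum>i<Suc t. N $$ (i, 0) * cofactor N i 0)"
    using laplace_expansion_column[OF N, of 0] \<open>det N = 0\<close> by simp
  also have "\<dots> = (\<Sum>i<Suc t. (-1) ^ t * (signed_minor C i * relation_matrix C i l))"
  proof (rule sum.cong)
    fix i assume "i \<in> {..<Suc t}"
    hence "i \<le> t" "N $$ (i, 0) = relation_matrix C i l" by (simp_all add: N_def)
    thus "N $$ (i, 0) * cofactor N i 0 = (-1) ^ t * (signed_minor C i * relation_matrix C i l)"
      by (simp only: cof mult.commute[of "relation_matrix C i l"] mult.assoc)
  qed simp
  also have "\<dots> = (-1) ^ t * (\<Sum>i\<le>t. signed_minor C i * relation_matrix C i l)"
    by (simp only: sum_distrib_left lessThan_Suc_atMost)
  finally show ?thesis by simp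
qed

lemma sum_relation_matrix:
  assumes "l < t"
  shows "(\<Sum>i\<le>t. h i * relation_matrix C i l) = (\<Sum>i\<le>t. smult (Y C i l) (h i)) - pCons 0 (h (Suc l))"
proof -
  have "(\<Sum>i\<le>t. h i * relation_matrix C i l) =
      (\<Sum>i\<le>t. smult (Y C i l) (h i) - (if i = Suc l then pCons 0 (h i) else 0))"
    by (rule sum.cong) (auto simp: relation_matrix_def algebra_simps monom_Suc)
  also have "\<dots> = (\<Sum>i\<le>t. smult (Y C i l) (h i)) - pCons 0 (h (Suc l))"
    using assms by (simp add: sum_subtractf)
  finally show ?thesis .
qed

lemma syz_iff: "syz C h \<longleftrightarrow> (\<forall>l<t. (\<Sum>i\<le>t. h i * relation_matrix C i l) = 0)"
proof -
  have "(\<Sum>i\<le>t. h i * relation_matrix C i l) = 0 \<longleftrightarrow> pCons 0 (h (Suc l)) = (\<Sum>i\<le>t. smult (Y C i l) (h i))"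
    if "l < t" for l
    unfolding sum_relation_matrix[OF that] right_minus_eq by (rule eq_commute)
  thus ?thesis unfolding syz_def by blast
qed

lemma syz_minors: "syz C (signed_minor C)"
  unfolding syz_iff using minor_relation by blast

text \<open>
  Below its first row, \<open>X + C\<close> is \<open>-x\<close> times the identity plus a
  matrix over \<open>K[y]\<close>, so the sign \<open>(-1)^t\<close> makes the minor a
  characteristic polynomial.
\<close>

lemma minor_0: "signed_minor C 0 = char_poly (mat t t (\<lambda>(a, b). Y C (Suc a) b))"
proof -
  let ?A = "mat t t (\<lambda>(a, b). Y C (Suc a) b)"
  have "mat t t (\<lambda>(a, b). relation_matrix C (if a < 0 then a else Suc a) b) = (-1) \<cdot>\<^sub>m char_poly_matrix ?A"
    by (rule eq_matI) (auto simp: char_poly_matrix_def relation_matrix_def monom_Suc)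
  hence "signed_minor C 0 = (-1) ^ t * ((-1) ^ t * det (char_poly_matrix ?A))"
    by (simp add: signed_minor_def det_smult char_poly_matrix_def)
  also have "\<dots> = char_poly ?A" by (simp add: char_poly_def minus_one_power_iff)
  finally show ?thesis .
qed

lemma degree_minor_0: "degree (signed_minor C 0) = t" "coeff (signed_minor C 0) t = 1"
  using degree_monic_char_poly[of "mat t t (\<lambda>(a, b). Y C (Suc a) b)" t] by (simp_all add: minor_0)

text \<open>
  The common shift in \<open>syz_lead\<close> vanishes, as entry \<open>0\<close> is monic of
  degree \<open>t\<close> in \<open>x\<close>.
\<close>

lemma minor_lead:
  assumes C: "bounded C" and k: "k \<le> t"
  shows "lead (signed_minor C k) (t - k, m k)" "coeff2 (signed_minor C k) (t - k, m k) = 1"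
proof -
  have "signed_minor C 0 \<noteq> 0" using degree_minor_0(2)[of C] by auto
  then obtain \<alpha> \<beta> \<kappa> where l: "\<kappa> \<noteq> 0" "t \<le> \<alpha>"
    "\<And>j. j \<le> t \<Longrightarrow> lead (signed_minor C j) (\<alpha> - j, \<beta> + m j) \<and> coeff2 (signed_minor C j) (\<alpha> - j, \<beta> + m j) = \<kappa>"
    using syz_lead[OF C syz_minors] by blast
  have c0: "coeff2 (signed_minor C 0) (\<alpha>, \<beta>) = \<kappa>" using l(3)[of 0] by simp
  hence "coeff (signed_minor C 0) \<alpha> \<noteq> 0" using l(1) by (auto simp: coeff2_def)
  hence "\<alpha> \<le> t" using degree_minor_0(1)[of C] le_degree by metis
  hence "\<alpha> = t" using l(2) by simp
  moreover from this have "\<beta> = 0" "\<kappa> = 1" using c0 l(1) degree_minor_0(2)[of C]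
    by (auto simp: coeff2_def split: if_splits)
  ultimately show "lead (signed_minor C k) (t - k, m k)" "coeff2 (signed_minor C k) (t - k, m k) = 1"
    using l(3)[OF k] by simp_all
qed

lemma syz_diff: "syz C g \<Longrightarrow> syz C h \<Longrightarrow> syz C (\<lambda>i. g i - h i)"
  by (simp add: syz_iff left_diff_distrib sum_subtractf)

text \<open>
  Otherwise the difference would be a nonzero solution, and its entry \<open>0\<close> would
  have \<open>x\<close>-degree at least \<open>t\<close> by \<open>syz_lead\<close>; but the
  leading coefficients in \<open>x\<close> cancel.
\<close>

lemma syz_eq_minor:
  assumes C: "bounded C" and h: "syz C h" and h0: "degree (h 0) \<le> t" "coeff (h 0) t = 1"
    and k: "k \<le> t"
  shows "h k = signed_minor C k"
proof (rule ccontr)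
  assume "h k \<noteq> signed_minor C k"
  hence "\<exists>j\<le>t. h j - signed_minor C j \<noteq> 0" using k by auto
  from syz_lead[OF C syz_diff[OF h syz_minors] this] obtain \<alpha> \<beta> \<kappa> where "t \<le> \<alpha>" "\<kappa> \<noteq> 0" and
    "\<And>j. j \<le> t \<Longrightarrow> coeff2 (h j - signed_minor C j) (\<alpha> - j, \<beta> + m j) = \<kappa>" by blast
  from this(1,2) this(3)[of 0] have l: "t \<le> \<alpha>" "coeff2 (h 0 - signed_minor C 0) (\<alpha>, \<beta>) \<noteq> 0" by simp_all
  have "coeff (h 0 - signed_minor C 0) \<alpha> = 0"
    using h0 degree_minor_0[of C] l(1) by (cases "\<alpha> = t") (auto simp: coeff_eq_0)
  thus False using l(2) by (simp add: coeff2_def)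
qed

text \<open>
  If \<open>h\<^sub>k\<close> has the largest \<open>x\<close>-degree \<open>s \<ge> t\<close>
  among the entries other than \<open>h\<^sub>0\<close>, then \<open>x h\<^sub>k\<close> has
  \<open>x\<close>-degree \<open>s + 1\<close>, but its relation only involves
  \<open>x\<close>-degrees up to \<open>s\<close>.
\<close>

lemma syz_degree:
  assumes h: "syz C h" and h0: "degree (h 0) \<le> t" "0 < t" and k: "0 < k" "k \<le> t"
  shows "degree (h k) < t"
proof (rule ccontr)
  define s where "s = Max ((\<lambda>k. degree (h k)) ` {0<..t})"
  assume "\<not> degree (h k) < t"
  hence "t \<le> degree (h k)" by simp
  also have "degree (h k) \<le> s" unfolding s_def using k by (intro Max_ge) auto
  finally have "t \<le> s" .
  have "s \<in> (\<lambda>k. degree (h k)) ` {0<..t}" unfolding s_def using k by (intro Max_in) auto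
  then obtain j where j: "j < t" "degree (h (Suc j)) = s"
  proof -
    from \<open>s \<in> _\<close> obtain k where "0 < k" "k \<le> t" "degree (h k) = s" by auto
    thus thesis using that[of "k - 1"] by simp
  qed
  have le: "degree (h i) \<le> s" if "i \<le> t" for i
  proof (cases "i = 0")
    case False
    thus ?thesis unfolding s_def using that by (intro Max_ge) auto
  qed (use h0 \<open>t \<le> s\<close> in simp)
  have "degree (pCons 0 (h (Suc j))) \<le> s"
  proof -
    have "pCons 0 (h (Suc j)) = (\<Sum>i\<le>t. smult (Y C i j) (h i))" using h j by (simp add: syz_def)
    also have "degree \<dots> \<le> s"
      using le by (intro degree_sum_le) (auto intro: order.trans[OF degree_smult_le])
    finally show ?thesis .
  qed
  moreover have "h (Suc j) \<noteq> 0" using j \<open>t \<le> s\<close> h0(2) by auto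
  ultimately show False using j by simp
qed

section \<open>Normal forms of relation matrices under base change\<close>

text \<open>
  The bounds that define \<open>A_space\<close>, see \<open>A_space_iff\<close> below.
\<close>

definition normal :: "(nat \<Rightarrow> nat \<Rightarrow> 'a::field poly) \<Rightarrow> bool" where
  "normal C \<longleftrightarrow> (\<forall>i\<le>t. \<forall>j<t. dle (C i j) (bnd i j) \<and> dle (C i j) (int (d (min i j)) - 1))"

text \<open>
  The base changes \<open>f\<^sub>j + \<Sum>\<^sub>k B\<^sub>k\<^sub>j f\<^sub>k\<close> for
  which all added terms lie below \<open>in(f\<^sub>j)\<close>. Row \<open>0\<close> vanishes
  so that \<open>f\<^sub>0\<close>, the only entry of \<open>x\<close>-degree
  \<open>t\<close>, is not added to the others.
\<close>

definition cobounded :: "(nat \<Rightarrow> nat \<Rightarrow> 'a::field poly) \<Rightarrow> bool" where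
  "cobounded B \<longleftrightarrow> (\<forall>i\<le>t. \<forall>j\<le>t. dle (B i j) (v j - v i - (if i < j then 1 else 0))) \<and>
     (\<forall>i. B i i = 0) \<and> (\<forall>j. B 0 j = 0)"

text \<open>
  The equation \<open>(1 + B) (D + C') = (D + C) (1 + B')\<close> in expanded form, where
  \<open>D\<close> has the powers \<open>y^(d\<^sub>j)\<close> on its diagonal and
  \<open>B'\<close> is \<open>B\<close> without row and column \<open>0\<close>; it says that
  base change by \<open>B\<close> turns the relation matrix \<open>C\<close> into
  \<open>C'\<close> (see \<open>syz_base_change\<close> and \<open>conjugates_matrix\<close>).
\<close>

definition conjugates ::
  "(nat \<Rightarrow> nat \<Rightarrow> 'a::field poly) \<Rightarrow> (nat \<Rightarrow> nat \<Rightarrow> 'a poly) \<Rightarrow> (nat \<Rightarrow> nat \<Rightarrow> 'a poly) \<Rightarrow> bool" where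
  "conjugates B C C' \<longleftrightarrow> (\<forall>i\<le>t. \<forall>j<t.
     C' i j - C i j = (if i < t then monom 1 (d i) * B (Suc i) (Suc j) else 0)
       - monom 1 (d j) * B i j
       + (\<Sum>k<t. C i k * B (Suc k) (Suc j)) - (\<Sum>k\<le>t. B i k * C' k j))"

text \<open>
  Given \<open>C\<close>, the unknowns \<open>B\<close> and \<open>C'\<close> are coded by one
  matrix \<open>Z\<close>. Above the diagonal,
  \<open>Z\<^sub>i\<^sub>j = C'\<^sub>i\<^sub>j - y^(d\<^sub>i) B\<^bsub>i+1,j+1\<^esub>\<close>;
  below it,
  \<open>Z\<^sub>i\<^sub>j = C'\<^sub>i\<^sub>j + y^(d\<^sub>j) B\<^sub>i\<^sub>j\<close>; on
  it, \<open>Z\<^sub>i\<^sub>j = C'\<^sub>i\<^sub>j\<close>. Since \<open>C'\<close> is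
  normal, \<open>C'\<close> and \<open>B\<close> are recovered as remainder and quotient of
  the division by the power of \<open>y\<close>.
\<close>

definition Bpart :: "(nat \<Rightarrow> nat \<Rightarrow> 'a::field poly) \<Rightarrow> nat \<Rightarrow> nat \<Rightarrow> 'a poly" where
  "Bpart Z k l =
     (if k = 0 \<or> k = l then 0
      else if k < l then - poly_shift (d (k - 1)) (Z (k - 1) (l - 1))
      else poly_shift (d l) (Z k l))"

definition Cpart :: "(nat \<Rightarrow> nat \<Rightarrow> 'a::field poly) \<Rightarrow> nat \<Rightarrow> nat \<Rightarrow> 'a poly" where
  "Cpart Z i j = poly_cutoff (d (min i j)) (Z i j)"

text \<open>
  The conjugation equation solved for \<open>Z\<close>: its solutions are the fixed points of
  \<open>step C\<close>.
\<close>

definition step :: "(nat \<Rightarrow> nat \<Rightarrow> 'a::field poly) \<Rightarrow> (nat \<Rightarrow> nat \<Rightarrow> 'a poly) \<Rightarrow> nat \<Rightarrow> nat \<Rightarrow> 'a poly" where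
  "step C Z i j = C i j
     + (if j < i \<and> i < t then monom 1 (d i) * Bpart Z (Suc i) (Suc j) else 0)
     - (if i < j then monom 1 (d j) * Bpart Z i j else 0)
     + (\<Sum>k<t. C i k * Bpart Z (Suc k) (Suc j)) - (\<Sum>k\<le>t. Bpart Z i k * Cpart Z k j)"

text \<open>
  The order in which the coefficients of \<open>Z\<close> are determined. The coefficient of
  \<open>y^n\<close> in the entry \<open>(i, j)\<close> has the defect
  \<open>v\<^bsub>j+1\<^esub> - v\<^sub>i + 1 - n\<close>, which decides first. Among
  coefficients of the same defect, the diagonals \<open>i - j\<close> are run through in
  increasing order; a diagonal above the main one is run through downwards, the others
  upwards.
\<close>

definition stage :: "nat \<Rightarrow> nat \<Rightarrow> nat" where
  "stage i j = (i + t - j) * (t + 1) + (if i < j then i else t - i)"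

text \<open>
  Defect and stage in one number; the factor of the defect exceeds every stage.
\<close>

definition rank :: "nat \<Rightarrow> nat \<Rightarrow> nat \<Rightarrow> nat" where
  "rank i j n = nat (v (Suc j) - v i + 1 - int n) * (2 * (t + 1) * (t + 1)) + stage i j"

definition agree :: "nat \<Rightarrow> (nat \<Rightarrow> nat \<Rightarrow> 'a::field poly) \<Rightarrow> (nat \<Rightarrow> nat \<Rightarrow> 'a poly) \<Rightarrow> bool" where
  "agree r Z Z' \<longleftrightarrow> (\<forall>i\<le>t. \<forall>j<t. \<forall>n. rank i j n < r \<longrightarrow> coeff (Z i j) n = coeff (Z' i j) n)"

lemma stage_less: "i \<le> t \<Longrightarrow> stage i j < 2 * (t + 1) * (t + 1)"
proof -
  assume "i \<le> t"
  hence "(i + t - j) * (t + 1) \<le> (2 * t) * (t + 1)" by (intro mult_right_mono) auto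
  moreover have "(if i < j then i else t - i) < t + 1" using \<open>i \<le> t\<close> by auto
  ultimately show ?thesis unfolding stage_def by (simp add: algebra_simps)
qed

lemma stage_diag:
  assumes "i \<le> t" "i + t - j < i' + t - j'"
  shows "stage i j < stage i' j'"
proof -
  have "(if i < j then i else t - i) < t + 1" using assms by auto
  moreover have "(i + t - j + 1) * (t + 1) \<le> (i' + t - j') * (t + 1)"
    using assms by (intro mult_right_mono) auto
  ultimately show ?thesis unfolding stage_def by (simp add: algebra_simps)
qed

lemma dle_shift: "dle p w \<Longrightarrow> dle (poly_shift n p) (w - int n)"
  by (simp add: dle_def coeff_poly_shift)

lemma dle_shift_diff: "dle (p - q) w \<Longrightarrow> dle (poly_shift n p - poly_shift n q) (w - int n)"
  for p :: "'a::field poly"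
  by (simp add: dle_def coeff_poly_shift)

lemma dle_cutoff: "dle p w \<Longrightarrow> dle (poly_cutoff n p) w"
  by (simp add: dle_def coeff_poly_cutoff)

lemma dle_cutoff_less: "dle (poly_cutoff n p) (int n - 1)"
  by (simp add: dle_def coeff_poly_cutoff)

lemma dle_cutoff_diff: "dle (p - q) w \<Longrightarrow> dle (poly_cutoff n p - poly_cutoff n q) w"
  for p :: "'a::field poly"
  by (simp add: dle_def coeff_poly_cutoff)

lemma cutoff_shift: "poly_cutoff n p + monom 1 n * poly_shift n p = p" for p :: "'a::field poly"
  by (rule poly_eqI) (simp add: coeff_poly_cutoff coeff_poly_shift coeff_monom_mult)

lemma dle_monom_mult: "dle p w \<Longrightarrow> dle (monom 1 n * p) (w + int n)" for p :: "'a::field poly"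
  by (auto simp: dle_def coeff_monom_mult)

lemma Bpart_bound:
  assumes Z: "bounded Z" and kl: "k \<le> t" "l \<le> t"
  shows "dle (Bpart Z k l) (v l - v k - (if k < l then 1 else 0))"
proof (cases "k = 0 \<or> k = l")
  case False
  show ?thesis
  proof (cases "k < l")
    case True
    define k' l' where "k' = k - 1" and "l' = l - 1"
    have k': "k = Suc k'" "l = Suc l'" "k' < l'" "l' < t" using True False kl by (auto simp: k'_def l'_def)
    have "dle (Z k' l') (bnd k' l')" using Z k' by (simp add: bounded_def)
    from dle_minus[OF dle_shift[OF this, of "d k'"]]
    show ?thesis using k' v_Suc[of k'] by (simp add: Bpart_def bnd_def algebra_simps)
  next
    case l: False
    have "dle (Z k l) (bnd k l)" using Z kl l False by (simp add: bounded_def)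
    from dle_shift[OF this, of "d l"]
    show ?thesis using kl l False v_Suc[of l] by (simp add: Bpart_def bnd_def algebra_simps)
  qed
qed (auto simp: Bpart_def)

lemma Cpart_bound: "bounded Z \<Longrightarrow> i \<le> t \<Longrightarrow> j < t \<Longrightarrow> dle (Cpart Z i j) (bnd i j)"
  by (simp add: Cpart_def bounded_def dle_cutoff)

lemma Cpart_normal: "bounded Z \<Longrightarrow> normal (Cpart Z)"
  unfolding normal_def using Cpart_bound dle_cutoff_less by (auto simp: Cpart_def)

lemma Bpart_cobounded: "bounded Z \<Longrightarrow> cobounded (Bpart Z)"
  unfolding cobounded_def
  by (intro conjI allI impI Bpart_bound) (auto simp: Bpart_def)

text \<open>
  On the diagonal there is no quotient, since the degree bound there already is
  \<open>d\<^sub>j - 1\<close>.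
\<close>

lemma Z_parts:
  assumes Z: "bounded Z" and ij: "i \<le> t" "j < t"
  shows "Z i j = Cpart Z i j + (if i < j then - monom 1 (d i) * Bpart Z (Suc i) (Suc j)
     else if j < i then monom 1 (d j) * Bpart Z i j else 0)"
proof (cases "i = j")
  case True
  have "dle (Z i j) (int (d j) - 1)"
  proof (rule dle_mono)
    show "dle (Z i j) (bnd i j)" using Z ij by (simp add: bounded_def)
  qed (use ij True v_Suc[of j] in \<open>simp add: bnd_def\<close>)
  hence "Cpart Z i j = Z i j" using True
    by (intro poly_eqI) (auto simp: Cpart_def coeff_poly_cutoff dle_def)
  thus ?thesis using True by simp
next
  case False
  thus ?thesis using cutoff_shift[of "d (min i j)" "Z i j"]
    by (auto simp: Cpart_def Bpart_def min_def)
qed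

lemma conjugates_iff_step:
  assumes Z: "bounded Z"
  shows "conjugates (Bpart Z) C (Cpart Z) \<longleftrightarrow> (\<forall>i\<le>t. \<forall>j<t. Z i j = step C Z i j)"
proof -
  have "Cpart Z i j - C i j = (if i < t then monom 1 (d i) * Bpart Z (Suc i) (Suc j) else 0)
       - monom 1 (d j) * Bpart Z i j
       + (\<Sum>k<t. C i k * Bpart Z (Suc k) (Suc j)) - (\<Sum>k\<le>t. Bpart Z i k * Cpart Z k j) \<longleftrightarrow>
     Z i j = step C Z i j" if ij: "i \<le> t" "j < t" for i j
  proof -
    have 0: "Bpart Z k k = 0" for k by (simp add: Bpart_def)
    have "a - c = x - y + s - r \<longleftrightarrow> z = c + x' - y' + s - r"
      if "z - x' + y' = a - x + y" for a c x y s r z x' y' :: "'a poly"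
    proof -
      have "z = a - x + y + x' - y'" using that by (simp add: algebra_simps)
      hence "(a - c) - (x - y + s - r) = z - (c + x' - y' + s - r)" by simp
      thus ?thesis by (metis eq_iff_diff_eq_0)
    qed
    note eq = this
    show ?thesis
      unfolding step_def
    proof (rule eq)
      show "Z i j - (if j < i \<and> i < t then monom 1 (d i) * Bpart Z (Suc i) (Suc j) else 0)
          + (if i < j then monom 1 (d j) * Bpart Z i j else 0)
        = Cpart Z i j - (if i < t then monom 1 (d i) * Bpart Z (Suc i) (Suc j) else 0)
          + monom 1 (d j) * Bpart Z i j"
        using ij 0 by (subst Z_parts[OF Z ij]) auto
    qed
  qed
  thus ?thesis unfolding conjugates_def by blast
qed

lemma step_bounded:
  assumes C: "bounded C" and Z: "bounded Z"
  shows "bounded (step C Z)"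
  unfolding bounded_def
proof (intro allI impI)
  fix i j assume ij: "i \<le> t" "j < t"
  note B = Bpart_bound[OF Z] and Cp = Cpart_bound[OF Z]
  have Cb: "dle (C i k) (bnd i k)" if "k < t" for k using C ij that by (simp add: bounded_def)
  have 1: "dle (monom 1 (d i) * Bpart Z (Suc i) (Suc j)) (bnd i j)" if "j < i" "i < t"
    by (rule dle_mono[OF dle_monom_mult[OF B]]) (use ij that v_Suc[of i] in \<open>simp_all add: bnd_def\<close>)
  have 2: "dle (monom 1 (d j) * Bpart Z i j) (bnd i j)" if "i < j"
    by (rule dle_mono[OF dle_monom_mult[OF B]]) (use ij that v_Suc[of j] in \<open>simp_all add: bnd_def\<close>)
  have 3: "dle (C i k * Bpart Z (Suc k) (Suc j)) (bnd i j)" if "k < t" for k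
    by (rule dle_mult_le[OF Cb[OF that] B]) (use ij that in \<open>auto simp: bnd_def\<close>)
  have 4: "dle (Bpart Z i k * Cpart Z k j) (bnd i j)" if "k \<le> t" for k
  proof (cases "k = i")
    case False
    show ?thesis
      by (rule dle_mult_le[OF B Cp]) (use ij that False in \<open>auto simp: bnd_def\<close>)
  qed (simp add: Bpart_def)
  show "dle (step C Z i j) (bnd i j)"
    unfolding step_def
    by (intro dle_add dle_diff dle_sum Cb ij)
      (use 1 2 3 4 in \<open>auto split: if_splits\<close>)
qed

text \<open>
  Translates ranks into degrees, as needed for estimating products: agreement below the rank
  of a coefficient of defect \<open>e\<close>, means agreement in all defects below
  \<open>e\<close>, and in defect \<open>e\<close> in the entries of earlier stage.
\<close>

lemma agree_dle:
  assumes Z: "bounded Z" "bounded Z'" and ag: "agree (rank i j n) Z Z'" and ij: "i \<le> t" "j < t"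
    and e: "int e = v (Suc j) - v i + 1 - int n" and kl: "k \<le> t" "l < t"
  shows "dle (Z k l - Z' k l) (v (Suc l) - v k + 1 - int e - (if stage k l < stage i j then 1 else 0))"
  unfolding dle_def
proof (intro allI impI)
  fix n' assume n': "v (Suc l) - v k + 1 - int e - (if stage k l < stage i j then 1 else 0) < int n'"
  show "coeff (Z k l - Z' k l) n' = 0"
  proof (cases "int n' \<le> v (Suc l) - v k + 1")
    case True
    then obtain e' where e': "int e' = v (Suc l) - v k + 1 - int n'" by (metis diff_ge_0_iff_ge nonneg_int_cases)
    define L where "L = 2 * (t + 1) * (t + 1)"
    have "e' < e \<or> e' = e \<and> stage k l < stage i j" using n' e' by (auto split: if_splits)
    hence "e' * L + stage k l < e * L + stage i j"
    proof
      assume "e' < e"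
      hence "(e' + 1) * L \<le> e * L" by (intro mult_right_mono) auto
      moreover have "stage k l < L" unfolding L_def using kl(1) by (rule stage_less)
      ultimately show ?thesis by simp
    qed simp
    hence "rank k l n' < rank i j n"
      unfolding rank_def L_def[symmetric] by (simp flip: e e')
    thus ?thesis using ag kl by (simp add: agree_def)
  next
    case False
    hence "bnd k l < int n'" by (auto simp: bnd_def)
    hence "coeff (Z k l) n' = 0" "coeff (Z' k l) n' = 0" using Z kl by (auto simp: bounded_def dle_def)
    thus ?thesis by simp
  qed
qed

text \<open>
  The right-hand side of the fixed point equation for a coefficient depends only on
  coefficients of smaller rank. Defects add up in products, and a factor
  \<open>C\<^sub>i\<^sub>k\<close>, \<open>C'\<^sub>i\<^sub>k\<close> with
  \<open>i \<le> k\<close> or \<open>B\<^sub>i\<^sub>k\<close> with \<open>i < k\<close> has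
  positive defect, so the other factor enters with smaller defect only. A factor of defect
  \<open>0\<close> lies below the diagonal, and then the other one belongs to an earlier
  diagonal. The terms with a power of \<open>y\<close> refer to a neighbour on the same
  diagonal, which comes earlier in the chosen direction.
\<close>

lemma step_contracts:
  assumes C: "bounded C" and Z: "bounded Z" "bounded Z'" and ag: "agree r Z Z'"
  shows "agree (Suc r) (step C Z) (step C Z')"
  unfolding agree_def
proof (intro allI impI)
  fix i j n assume ij: "i \<le> t" "j < t" and r: "rank i j n < Suc r"
  show "coeff (step C Z i j) n = coeff (step C Z' i j) n"
  proof (cases "int n \<le> v (Suc j) - v i + 1")
    case False
    hence "bnd i j < int n" by (auto simp: bnd_def)
    thus ?thesis using step_bounded[OF C Z(1)] step_bounded[OF C Z(2)] ij
      by (auto simp: bounded_def dle_def)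
  next
    case True
    then obtain e where e: "int e = v (Suc j) - v i + 1 - int n"
      by (metis diff_ge_0_iff_ge nonneg_int_cases)
    have ag': "agree (rank i j n) Z Z'" using ag r by (auto simp: agree_def)
    (* One further degree of agreement is gained in entries of earlier stage; gainB is the
       gain for B, read off at the entry of Z that codes the entry (k, l) of B. *)
    define gain where "gain k l = (if stage k l < stage i j then 1 else 0 :: int)" for k l
    have dZ: "dle (Z k l - Z' k l) (v (Suc l) - v k + 1 - int e - gain k l)"
      if "k \<le> t" "l < t" for k l
      unfolding gain_def by (rule agree_dle[OF Z ag' ij e that])
    have dC: "dle (Cpart Z k l - Cpart Z' k l) (v (Suc l) - v k + 1 - int e - gain k l)"
      if "k \<le> t" "l < t" for k l
      unfolding Cpart_def using dZ[OF that] by (rule dle_cutoff_diff)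
    define gainB where "gainB k l = (if k < l then gain (k - 1) (l - 1) else gain k l)" for k l
    have dB: "dle (Bpart Z k l - Bpart Z' k l) (v l - v k - int e - gainB k l)"
      if kl: "k \<le> t" "l \<le> t" for k l
    proof (cases "k = 0 \<or> k = l")
      case False
      show ?thesis
      proof (cases "k < l")
        case True
        define k' l' where "k' = k - 1" and "l' = l - 1"
        have k': "k = Suc k'" "l = Suc l'" "k' < l'" "l' < t"
          using True False kl by (auto simp: k'_def l'_def)
        have "dle (Z k' l' - Z' k' l') (v (Suc l') - v k' + 1 - int e - gain k' l')"
          using dZ[of k' l'] k' by simp
        from dle_minus[OF dle_shift_diff[OF this, of "d k'"]]
        have "dle (Bpart Z k l - Bpart Z' k l)
            (v (Suc l') - v k' + 1 - int e - gain k' l' - int (d k'))"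
          using k' by (simp add: Bpart_def)
        thus ?thesis by (rule dle_mono) (use k' v_Suc[of k'] in \<open>simp add: gainB_def\<close>)
      next
        case l: False
        have "l < t" using l False kl by auto
        from dle_shift_diff[OF dZ[OF kl(1) this], of "d l"]
        show ?thesis using l False v_Suc[of l] \<open>l < t\<close>
          by (simp add: Bpart_def gainB_def algebra_simps)
      qed
    qed (auto simp: Bpart_def)
    have gB: "gainB k l = 1" if "k \<le> t" "0 < k" "k \<noteq> l" "l \<le> t" "k + t - l < i + t - j" for k l
    proof (cases "k < l")
      case True
      have "stage (k - 1) (l - 1) < stage i j" by (rule stage_diag) (use that True in auto)
      thus ?thesis using True by (simp add: gainB_def gain_def)
    next
      case False
      have "stage k l < stage i j" by (rule stage_diag) (use that in auto)
      thus ?thesis using False by (simp add: gainB_def gain_def)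
    qed
    have gain_nn: "0 \<le> gain k l" "0 \<le> gainB k l" for k l by (auto simp: gain_def gainB_def)
    define w where "w = v (Suc j) - v i - int e"
    have Cb: "dle (C i k) (bnd i k)" if "k < t" for k using C ij that by (simp add: bounded_def)

    have 1: "dle (monom 1 (d i) * Bpart Z (Suc i) (Suc j) - monom 1 (d i) * Bpart Z' (Suc i) (Suc j)) w"
      if "j < i" "i < t"
    proof -
      have "stage (Suc i) (Suc j) < stage i j" using that by (simp add: stage_def)
      hence "gainB (Suc i) (Suc j) = 1" using that by (simp add: gainB_def gain_def)
      thus ?thesis unfolding right_diff_distrib[symmetric]
        using that v_Suc[of i]
        by (intro dle_mono[OF dle_monom_mult[OF dB]]) (simp_all add: w_def)
    qed
    have 2: "dle (monom 1 (d j) * Bpart Z i j - monom 1 (d j) * Bpart Z' i j) w" if "i < j"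
    proof (cases "i = 0")
      case False
      hence "stage (i - 1) (j - 1) < stage i j" using that by (auto simp: stage_def)
      hence "gainB i j = 1" using that by (simp add: gainB_def gain_def)
      thus ?thesis unfolding right_diff_distrib[symmetric]
        using that ij v_Suc[of j]
        by (intro dle_mono[OF dle_monom_mult[OF dB]]) (simp_all add: w_def)
    qed (simp add: Bpart_def)
    have 3: "dle (C i k * Bpart Z (Suc k) (Suc j) - C i k * Bpart Z' (Suc k) (Suc j)) w"
      if k: "k < t" for k
    proof (cases "k = j")
      case False
      have "bnd i k + (v (Suc j) - v (Suc k) - int e - gainB (Suc k) (Suc j)) \<le> w"
      proof (cases "i \<le> k")
        case True
        thus ?thesis using gain_nn by (simp add: bnd_def w_def)
      next
        case i: False
        hence "gainB (Suc k) (Suc j) = 1" using k ij False by (intro gB) auto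
        thus ?thesis using i by (simp add: bnd_def w_def)
      qed
      thus ?thesis unfolding right_diff_distrib[symmetric]
        using k ij by (intro dle_mult_le[OF Cb dB]) auto
    qed (simp add: Bpart_def)
    have 4: "dle (Bpart Z i k * Cpart Z k j - Bpart Z' i k * Cpart Z' k j) w" if k: "k \<le> t" for k
    proof (cases "k = i \<or> i = 0")
      case False
      have "v k - v i - int e - gainB i k + bnd k j \<le> w"
      proof (cases "k \<le> j")
        case True
        thus ?thesis using gain_nn by (simp add: bnd_def w_def)
      next
        case kj: False
        hence "gainB i k = 1" using k ij False by (intro gB) auto
        thus ?thesis using kj by (simp add: bnd_def w_def)
      qed
      hence a: "dle ((Bpart Z i k - Bpart Z' i k) * Cpart Z k j) w"
        using k ij by (intro dle_mult_le[OF dB Cpart_bound[OF Z(1)]])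
      have "v k - v i - (if i < k then 1 else 0) + (v (Suc j) - v k + 1 - int e - gain k j) \<le> w"
      proof (cases "i < k")
        case True
        thus ?thesis using gain_nn by (simp add: w_def)
      next
        case ik: False
        have "stage k j < stage i j" using k ij ik False by (intro stage_diag) auto
        thus ?thesis using ik by (simp add: w_def gain_def)
      qed
      hence b: "dle (Bpart Z' i k * (Cpart Z k j - Cpart Z' k j)) w"
        using k ij by (intro dle_mult_le[OF Bpart_bound[OF Z(2)] dC])
      show ?thesis using dle_add[OF a b] by (simp add: algebra_simps)
    qed (auto simp: Bpart_def)
    have "step C Z i j - step C Z' i j =
       (if j < i \<and> i < t then monom 1 (d i) * Bpart Z (Suc i) (Suc j) - monom 1 (d i) * Bpart Z' (Suc i) (Suc j) else 0)
       - (if i < j then monom 1 (d j) * Bpart Z i j - monom 1 (d j) * Bpart Z' i j else 0)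
       + (\<Sum>k<t. C i k * Bpart Z (Suc k) (Suc j) - C i k * Bpart Z' (Suc k) (Suc j))
       - (\<Sum>k\<le>t. Bpart Z i k * Cpart Z k j - Bpart Z' i k * Cpart Z' k j)"
      by (simp add: step_def sum_subtractf)
    moreover have "dle \<dots> w"
    proof (intro dle_diff[OF dle_add[OF dle_diff]] dle_sum)
      show "dle (if j < i \<and> i < t then monom 1 (d i) * Bpart Z (Suc i) (Suc j)
          - monom 1 (d i) * Bpart Z' (Suc i) (Suc j) else 0) w" using 1 by simp
      show "dle (if i < j then monom 1 (d j) * Bpart Z i j - monom 1 (d j) * Bpart Z' i j else 0) w"
        using 2 by simp
    qed (use 3 4 in auto)
    ultimately have "dle (step C Z i j - step C Z' i j) w" by simp
    moreover have "w < int n" using e by (simp add: w_def)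
    ultimately show ?thesis by (simp add: dle_def)
  qed
qed

lemma agree_all_eq:
  assumes "\<And>r. agree r Z Z'" "i \<le> t" "j < t"
  shows "Z i j = Z' i j"
  using assms by (intro poly_eqI) (auto simp: agree_def)

lemma normal_bounded: "normal C \<Longrightarrow> bounded C"
  by (simp add: normal_def bounded_def)

text \<open>
  Iterating \<open>step C\<close> makes consecutive iterates agree in higher and higher rank,
  and ranks are bounded.
\<close>

lemma conjugate_normal_exists:
  assumes C: "bounded C"
  shows "\<exists>B C'. normal C' \<and> cobounded B \<and> conjugates B C C'"
proof -
  define Z where "Z k = (step C ^^ k) (\<lambda>_ _. 0)" for k
  have bZ: "bounded (Z k)" for k
    by (induction k) (auto simp: Z_def step_bounded[OF C], simp add: bounded_def)
  have ag: "agree k (Z k) (Z (Suc k))" for k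
  proof (induction k)
    case (Suc k)
    show ?case using step_contracts[OF C bZ bZ Suc] by (simp add: Z_def)
  qed (simp add: agree_def)
  define R where "R = Suc (Max ((\<lambda>(i, j). rank i j 0) ` ({..t} \<times> {..<t})))"
  have R: "rank i j n < R" if "i \<le> t" "j < t" for i j n
  proof -
    have "rank i j n \<le> rank i j 0"
      unfolding rank_def by (intro add_right_mono mult_right_mono nat_mono) auto
    also have "\<dots> \<le> Max ((\<lambda>(i, j). rank i j 0) ` ({..t} \<times> {..<t}))"
      using that by (intro Max_ge) auto
    finally show ?thesis by (simp add: R_def)
  qed
  have "Z R i j = step C (Z R) i j" if "i \<le> t" "j < t" for i j
    using ag[of R] R[OF that] that by (intro poly_eqI) (simp add: agree_def Z_def)
  hence "conjugates (Bpart (Z R)) C (Cpart (Z R))"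
    using conjugates_iff_step[OF bZ] by blast
  thus ?thesis using Cpart_normal[OF bZ] Bpart_cobounded[OF bZ] by blast
qed

text \<open>
  Two solutions code fixed points of \<open>step C\<close>, and these agree in every rank by
  induction.
\<close>

lemma conjugate_normal_unique:
  assumes C: "bounded C"
    and 1: "normal C1" "cobounded B1" "conjugates B1 C C1"
    and 2: "normal C2" "cobounded B2" "conjugates B2 C C2"
    and ij: "i \<le> t" "j < t"
  shows "C1 i j = C2 i j"
proof -
  define enc :: "(nat \<Rightarrow> nat \<Rightarrow> 'a poly) \<Rightarrow> (nat \<Rightarrow> nat \<Rightarrow> 'a poly) \<Rightarrow> nat \<Rightarrow> nat \<Rightarrow> 'a poly"
    where "enc B C' i j = C' i j + (if i < j then - monom 1 (d i) * B (Suc i) (Suc j)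
     else if j < i then monom 1 (d j) * B i j else 0)" for B C' i j
  have enc: "bounded (enc B C') \<and> (\<forall>i\<le>t. \<forall>j<t. enc B C' i j = step C (enc B C') i j \<and> Cpart (enc B C') i j = C' i j)"
    if h: "normal C'" "cobounded B" "conjugates B C C'" for B C'
  proof -
    let ?Z = "enc B C'"
    have Bb: "dle (B k l) (v l - v k - (if k < l then 1 else 0))" if "k \<le> t" "l \<le> t" for k l
      using h(2) that by (simp add: cobounded_def)
    have Cb: "dle (C' k l) (bnd k l)" if "k \<le> t" "l < t" for k l
      using h(1) that by (simp add: normal_def)
    have Cc: "coeff (C' k l) n = 0" if "k \<le> t" "l < t" "d (min k l) \<le> n" for k l n
      using h(1) that by (auto simp: normal_def dle_def)
    have bZ: "bounded ?Z"
      unfolding bounded_def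
    proof (intro allI impI)
      fix k l assume kl: "k \<le> t" "l < t"
      have 1: "dle (monom 1 (d k) * B (Suc k) (Suc l)) (bnd k l)" if "k < l"
        by (rule dle_mono[OF dle_monom_mult[OF Bb]]) (use kl that v_Suc[of k] in \<open>simp_all add: bnd_def\<close>)
      have 2: "dle (monom 1 (d l) * B k l) (bnd k l)" if "l < k"
        by (rule dle_mono[OF dle_monom_mult[OF Bb]]) (use kl that v_Suc[of l] in \<open>simp_all add: bnd_def\<close>)
      show "dle (?Z k l) (bnd k l)"
        unfolding enc_def
        by (rule dle_add[OF Cb[OF kl]]) (use dle_minus[OF 1] 2 in simp)
    qed
    have Cp: "Cpart ?Z k l = C' k l" if kl: "k \<le> t" "l < t" for k l
      by (rule poly_eqI) (use Cc[OF kl] in \<open>auto simp: Cpart_def enc_def coeff_poly_cutoff coeff_monom_mult min_def\<close>)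
    have Bp: "Bpart ?Z k l = B k l" if kl: "k \<le> t" "l \<le> t" for k l
    proof (cases "k = 0 \<or> k = l")
      case True
      thus ?thesis using h(2) by (auto simp: Bpart_def cobounded_def)
    next
      case False
      show ?thesis
      proof (cases "k < l")
        case True
        define k' l' where "k' = k - 1" and "l' = l - 1"
        have k': "k = Suc k'" "l = Suc l'" "k' < l'" "l' < t"
          using True False kl by (auto simp: k'_def l'_def)
        have "coeff (C' k' l') (n + d k') = 0" for n using Cc[of k' l' "n + d k'"] k' by simp
        thus ?thesis using k' 
          by (intro poly_eqI) (simp add: Bpart_def enc_def coeff_poly_shift coeff_monom_mult)
      next
        case l: False
        have "coeff (C' k l) (n + d l) = 0" for n using Cc[of k l "n + d l"] l False kl by simp
        thus ?thesis using l False
          by (intro poly_eqI) (simp add: Bpart_def enc_def coeff_poly_shift coeff_monom_mult)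
      qed
    qed
    have "conjugates (Bpart ?Z) C (Cpart ?Z)"
      using h(3) unfolding conjugates_def by (simp add: Cp Bp)
    thus ?thesis using bZ Cp conjugates_iff_step[OF bZ] by blast
  qed
  let ?Z1 = "enc B1 C1" and ?Z2 = "enc B2 C2"
  note e1 = enc[OF 1] and e2 = enc[OF 2]
  have "agree r ?Z1 ?Z2" for r
  proof (induction r)
    case (Suc r)
    have "agree (Suc r) (step C ?Z1) (step C ?Z2)"
      using step_contracts[OF C _ _ Suc] e1 e2 by blast
    thus ?case using e1 e2 by (simp add: agree_def)
  qed (simp add: agree_def)
  hence "?Z1 i j = ?Z2 i j" using agree_all_eq ij by blast
  hence "Cpart ?Z1 i j = Cpart ?Z2 i j" by (simp add: Cpart_def)
  thus ?thesis using e1 e2 ij by simp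
qed

section \<open>Ideals of maximal minors\<close>

text \<open>
  The exponents of the monomial ideal generated by all \<open>x^(t-j) y^(m\<^sub>j)\<close>;
  for \<open>a \<ge> t\<close> the truncated difference \<open>t - a\<close> is
  \<open>0\<close>, and \<open>m 0 = 0\<close> puts the whole column into the set.
\<close>

definition stair :: "(nat \<times> nat) set" where "stair = {n. m (t - fst n) \<le> snd n}"

lemma mem_stair_iff: "n \<in> stair \<longleftrightarrow> (\<exists>j\<le>t. dvd2 (t - j, m j) n)"
proof
  assume "n \<in> stair"
  thus "\<exists>j\<le>t. dvd2 (t - j, m j) n"
    by (intro exI[of _ "t - fst n"]) (auto simp: stair_def dvd2_def)
next
  assume "\<exists>j\<le>t. dvd2 (t - j, m j) n"
  then obtain j where j: "j \<le> t" "t - j \<le> fst n" "m j \<le> snd n" by (auto simp: dvd2_def)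
  have "m (t - fst n) \<le> m j" using j by (intro m_mono) auto
  thus "n \<in> stair" using j by (simp add: stair_def)
qed

definition monic_leads :: "(nat \<Rightarrow> 'a::field poly poly) \<Rightarrow> bool" where
  "monic_leads f \<longleftrightarrow> (\<forall>j\<le>t. lead (f j) (t - j, m j) \<and> coeff2 (f j) (t - j, m j) = 1)"

text \<open>
  By the relations, the \<open>K[y]\<close>-span of
  \<open>f\<^sub>t, \<dots>, f\<^sub>0, x f\<^sub>0, x^2 f\<^sub>0, \<dots>\<close> is closed
  under multiplication by \<open>x\<close>, so it is the whole ideal. Each
  \<open>x\<close>-degree occurs once among the leading monomials of these elements, so there
  is no cancellation in \<open>K[y]\<close>-combinations.
\<close>

lemma lead_exps_syz_ideal:
  fixes f :: "nat \<Rightarrow> 'a::field poly poly"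
  assumes f: "syz C f" "monic_leads f"
  shows "lead_exps (ideal_gen (f ` {..t})) = stair"
proof
  (* e a has leading exponent (a, m (t - a)), and T is the K[y]-span of all e a. *)
  define e where "e a = (if a \<le> t then f (t - a) else mono2 (a - t, 0) * f 0)" for a
  define T where "T = {h. \<exists>N c. h = (\<Sum>a<N. smult (c a) (e a))}"
  have e_lead: "lead (e a) (a, m (t - a))" for a
  proof (cases "a \<le> t")
    case True
    have "lead (f (t - a)) (t - (t - a), m (t - a))" using f(2) by (simp add: monic_leads_def)
    thus ?thesis using True by (simp add: e_def)
  next
    case False
    have "lead (f 0) (t - 0, m 0)" using f(2) by (simp only: monic_leads_def)
    from lead_mono2_mult[OF this, of "(a - t, 0)"] show ?thesis using False by (simp add: e_def)
  qed
  have T_I: "(\<Sum>a<N. smult (c a) (e a)) \<in> T" for N c by (auto simp: T_def)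
  have T_add: "g + h \<in> T" if gh: "g \<in> T" "h \<in> T" for g h
  proof -
    from gh obtain N c N' c' where g: "g = (\<Sum>a<N. smult (c a) (e a))"
      and h: "h = (\<Sum>a<N'. smult (c' a) (e a))" by (auto simp: T_def)
    define N'' where "N'' = max N N'"
    have "g = (\<Sum>a<N''. smult (if a < N then c a else 0) (e a))"
      unfolding g N''_def by (rule sum.mono_neutral_cong_left) auto
    moreover have "h = (\<Sum>a<N''. smult (if a < N' then c' a else 0) (e a))"
      unfolding h N''_def by (rule sum.mono_neutral_cong_left) auto
    ultimately have "g + h = (\<Sum>a<N''. smult ((if a < N then c a else 0) + (if a < N' then c' a else 0)) (e a))"
      by (simp add: smult_add_left sum.distrib)
    thus ?thesis by (simp only: T_I)
  qed
  have T_0: "0 \<in> T" unfolding T_def by (intro CollectI exI[of _ 0]) simp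
  have T_smult: "smult p h \<in> T" if hT: "h \<in> T" for p h
  proof -
    from hT obtain N c where h: "h = (\<Sum>a<N. smult (c a) (e a))" by (auto simp: T_def)
    have "smult p h = (\<Sum>a<N. smult (p * c a) (e a))" by (simp add: h smult_sum2)
    thus ?thesis by (simp only: T_I)
  qed
  have T_sum: "(\<Sum>i\<in>S. g i) \<in> T" if "\<And>i. i \<in> S \<Longrightarrow> g i \<in> T" for S :: "nat set" and g
    using that by (induction S rule: infinite_finite_induct) (auto intro: T_add T_0)
  have T_e: "e a \<in> T" for a
  proof -
    have "e a = (\<Sum>k<Suc a. smult (if k = a then 1 else 0) (e k))"
      by (simp add: if_distrib[of "\<lambda>p. smult p _"] cong: if_cong)
    thus ?thesis using T_I[of "\<lambda>k. if k = a then 1 else 0" "Suc a"] by simp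
  qed
  have T_f: "f j \<in> T" if "j \<le> t" for j using T_e[of "t - j"] that by (simp add: e_def)
  have T_xe: "pCons 0 (e a) \<in> T" for a
  proof (cases "a < t")
    case True
    then obtain j where j: "t - a = Suc j" "j < t" by (metis Suc_diff_Suc diff_less_Suc less_Suc_eq_le Suc_le_lessD diff_le_self)
    have "pCons 0 (e a) = (\<Sum>i\<le>t. smult (Y C i j) (f i))"
      using True j f(1) by (simp add: e_def syz_def)
    thus ?thesis by (simp only:) (intro T_sum T_smult T_f, simp)
  next
    case False
    have "pCons 0 (e a) = mono2 (1, 0) * e a" by (simp add: mono2_def monom_Suc)
    also have "\<dots> = e (Suc a)"
      using False by (cases "a = t") (auto simp: e_def mono2_mult Suc_diff_le simp flip: mult.assoc)
    finally show ?thesis using T_e by simp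
  qed
  have T_x: "pCons 0 h \<in> T" if hT: "h \<in> T" for h
  proof -
    from hT obtain N c where h: "h = (\<Sum>a<N. smult (c a) (e a))" by (auto simp: T_def)
    have "pCons 0 h = (\<Sum>a<N. smult (c a) (pCons 0 (e a)))"
      unfolding h
    proof (induction N)
      case (Suc N)
      have "pCons 0 (p + q) = pCons 0 p + pCons 0 q" for p q :: "'a poly poly" by simp
      thus ?case using Suc by (simp add: smult_pCons del: add_pCons)
    qed simp
    thus ?thesis by (simp only:) (intro T_sum T_smult T_xe)
  qed
  have T_mult: "r * h \<in> T" if "h \<in> T" for r h
    using that by (induction r) (auto simp: mult_pCons_left T_0 intro!: T_add T_smult T_x)
  have "is_ideal T"
    by (rule ring_module.subspaceI) (auto intro: T_0 T_add T_mult)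
  hence sub: "ideal_gen (f ` {..t}) \<subseteq> T"
    by (intro ring_module.span_minimal) (auto intro: T_f)
  show "lead_exps (ideal_gen (f ` {..t})) \<subseteq> stair"
  proof
    fix n assume "n \<in> lead_exps (ideal_gen (f ` {..t}))"
    then obtain h where h: "h \<in> T" "lead h n" using sub by (auto simp: lead_exps_def)
    then obtain N c where c: "h = (\<Sum>a<N. smult (c a) (e a))" by (auto simp: T_def)
    define J where "J = {a. a < N \<and> c a \<noteq> 0}"
    have hJ: "h = (\<Sum>a\<in>J. smult (c a) (e a))"
      unfolding c by (rule sum.mono_neutral_right) (auto simp: J_def)
    have "J \<noteq> {}" using lead_nonzero[OF h(2)] hJ by auto
    have "\<exists>a\<in>J. lead (\<Sum>a\<in>J. smult (c a) (e a)) (a, m (t - a) + degree (c a))"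
    proof (rule lead_sum_distinct)
      show "lead (smult (c a) (e a)) (a, m (t - a) + degree (c a))" if "a \<in> J" for a
        using lead_smult[OF e_lead[of a], of "c a"] that by (simp add: J_def)
    qed (use \<open>J \<noteq> {}\<close> in \<open>auto simp: J_def inj_on_def\<close>)
    then obtain a where "lead h (a, m (t - a) + degree (c a))" using hJ by metis
    hence "n = (a, m (t - a) + degree (c a))" using h(2) lead_unique by blast
    thus "n \<in> stair" by (simp add: stair_def)
  qed
  show "stair \<subseteq> lead_exps (ideal_gen (f ` {..t}))"
  proof
    fix n assume "n \<in> stair"
    then obtain j where j: "j \<le> t" "dvd2 (t - j, m j) n" by (auto simp: mem_stair_iff)
    have "f j \<in> ideal_gen (f ` {..t})" using j by (intro ring_module.span_base) auto
    hence "(t - j, m j) \<in> lead_exps (ideal_gen (f ` {..t}))"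
      using f(2) j by (auto simp: lead_exps_def monic_leads_def)
    thus "n \<in> lead_exps (ideal_gen (f ` {..t}))"
      by (rule lead_exps_dvd2[OF ring_module.subspace_span _ j(2)])
  qed
qed

lemma monic_leads_minors: "bounded C \<Longrightarrow> monic_leads (signed_minor C)"
  unfolding monic_leads_def using minor_lead by blast

lemma lead_exps_minors: "bounded C \<Longrightarrow> lead_exps (ideal_gen (signed_minor C ` {..t})) = stair"
  using lead_exps_syz_ideal[OF syz_minors monic_leads_minors] .

text \<open>
  Division by \<open>f\<close> that uses only multipliers from \<open>K[y]\<close>: a leading
  monomial of \<open>x\<close>-degree \<open>t - j\<close> is cancelled by a power of
  \<open>y\<close> times \<open>f\<^sub>j\<close>, which does not raise the
  \<open>x\<close>-degree above \<open>t\<close>.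
\<close>

lemma standard_representation_lead:
  fixes f :: "nat \<Rightarrow> 'a::field poly poly"
  assumes I: "is_ideal I" "lead_exps I \<subseteq> stair"
    and f: "monic_leads f" "\<And>j. j \<le> t \<Longrightarrow> f j \<in> I" "\<And>j. j \<le> t \<Longrightarrow> degree (f j) \<le> t"
  shows "\<forall>h. h \<in> I \<and> degree h \<le> t \<and> lead h M \<longrightarrow>
    (\<exists>b. h = (\<Sum>j\<le>t. smult (b j) (f j)) \<and>
      (\<forall>j\<le>t. \<forall>n. coeff (b j) n \<noteq> 0 \<longrightarrow> (t - j, m j + n) = M \<or> drl_less (t - j, m j + n) M))"
proof (induction M rule: wfp_induct_rule[OF wfp_drl])
  case (1 M)
  note IH = "1"
  show ?case
  proof (intro allI impI, elim conjE)
    fix h assume h: "h \<in> I" "degree h \<le> t" "lead h M"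
    obtain a b0 where M: "M = (a, b0)" by (cases M)
    have "M \<in> stair" using I h by (auto simp: lead_exps_def)
    have "coeff h a \<noteq> 0" using h(3) by (auto simp: lead_def M coeff2_def)
    hence "a \<le> t" using h(2) le_degree order.trans by blast
    define j0 k where "j0 = t - a" and "k = b0 - m (t - a)"
    have jk: "j0 \<le> t" "t - j0 = a" "b0 = m j0 + k"
      using \<open>a \<le> t\<close> \<open>M \<in> stair\<close> by (auto simp: j0_def k_def stair_def M)
    define g where "g = smult (monom 1 k) (f j0)"
    have f0: "lead (f j0) (a, m j0)" "coeff2 (f j0) (a, m j0) = 1"
      using f(1) jk by (auto simp: monic_leads_def)
    have g_lead: "lead g M"
      using lead_smult[OF f0(1), of "monom 1 k"] jk by (simp add: g_def M degree_monom_eq)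
    have g1: "coeff2 g M = 1" using f0 jk by (simp add: g_def M coeff2_smult_monom)
    define h' where "h' = h - smult [:coeff2 h M:] g"
    have h'I: "h' \<in> I" unfolding h'_def g_def
      by (intro ideal_diff[OF I(1)] ideal_smult[OF I(1)] h(1) f(2) jk(1))
    have h'd: "degree h' \<le> t" unfolding h'_def g_def
      using f(3)[OF jk(1)]
      by (intro degree_diff_le h(2)) (auto intro!: order.trans[OF degree_smult_le])
    have "\<exists>b'. h' = (\<Sum>j\<le>t. smult (b' j) (f j)) \<and>
      (\<forall>j\<le>t. \<forall>n. coeff (b' j) n \<noteq> 0 \<longrightarrow> (t - j, m j + n) = M \<or> drl_less (t - j, m j + n) M)"
    proof (cases "h' = 0")
      case True
      thus ?thesis by (intro exI[of _ "\<lambda>_. 0"]) simp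
    next
      case False
      then obtain M' where M': "lead h' M'" using lead_exists by blast
      hence less: "drl_less M' M"
        using cancel_lead[OF h(3) g_lead g1] by (simp add: lead_def h'_def)
      obtain b' where b': "h' = (\<Sum>j\<le>t. smult (b' j) (f j))"
        "\<forall>j\<le>t. \<forall>n. coeff (b' j) n \<noteq> 0 \<longrightarrow> (t - j, m j + n) = M' \<or> drl_less (t - j, m j + n) M'"
        using IH[OF less] h'I h'd M' by blast
      have "(t - j, m j + n) = M \<or> drl_less (t - j, m j + n) M"
        if "j \<le> t" "coeff (b' j) n \<noteq> 0" for j n
        using b'(2) that less drl_trans[OF _ less] by blast
      thus ?thesis using b'(1) by blast
    qed
    then obtain b' where b': "h' = (\<Sum>j\<le>t. smult (b' j) (f j))"
      "\<And>j n. j \<le> t \<Longrightarrow> coeff (b' j) n \<noteq> 0 \<Longrightarrow> (t - j, m j + n) = M \<or> drl_less (t - j, m j + n) M"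
      by blast
    define b where "b j = b' j + (if j = j0 then monom (coeff2 h M) k else 0)" for j
    have "(\<Sum>j\<le>t. smult (b j) (f j)) =
        h' + (\<Sum>j\<le>t. if j = j0 then smult (monom (coeff2 h M) k) (f j0) else 0)"
      unfolding b'(1) b_def sum.distrib[symmetric]
      by (rule sum.cong) (auto simp: smult_add_left)
    also have "\<dots> = h' + smult [:coeff2 h M:] g"
      using jk(1) by (simp add: g_def smult_monom)
    also have "\<dots> = h" by (simp add: h'_def)
    finally have "h = (\<Sum>j\<le>t. smult (b j) (f j))" ..
    moreover have "(t - j, m j + n) = M \<or> drl_less (t - j, m j + n) M"
      if "j \<le> t" "coeff (b j) n \<noteq> 0" for j n
    proof (cases "coeff (b' j) n = 0")
      case True
      hence "j = j0" "n = k" using that(2) by (auto simp: b_def split: if_splits)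
      thus ?thesis using jk by (simp add: M)
    qed (use b'(2) that in blast)
    ultimately show "\<exists>b. h = (\<Sum>j\<le>t. smult (b j) (f j)) \<and>
      (\<forall>j\<le>t. \<forall>n. coeff (b j) n \<noteq> 0 \<longrightarrow> (t - j, m j + n) = M \<or> drl_less (t - j, m j + n) M)"
      by blast
  qed
qed

text \<open>
  The form in which division is used: a strict bound \<open>M\<close> on the monomials of
  \<open>h\<close> carries over to the terms of the representation.
\<close>

lemma standard_representation:
  fixes f :: "nat \<Rightarrow> 'a::field poly poly"
  assumes I: "is_ideal I" "lead_exps I \<subseteq> stair"
    and f: "monic_leads f" "\<And>j. j \<le> t \<Longrightarrow> f j \<in> I" "\<And>j. j \<le> t \<Longrightarrow> degree (f j) \<le> t"
    and h: "h \<in> I" "degree h \<le> t" "\<And>n. coeff2 h n \<noteq> 0 \<Longrightarrow> drl_less n M"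
  shows "\<exists>b. h = (\<Sum>j\<le>t. smult (b j) (f j)) \<and>
      (\<forall>j\<le>t. \<forall>n. coeff (b j) n \<noteq> 0 \<longrightarrow> drl_less (t - j, m j + n) M)"
proof (cases "h = 0")
  case True
  thus ?thesis by (intro exI[of _ "\<lambda>_. 0"]) simp
next
  case False
  then obtain M' where M': "lead h M'" using lead_exists by blast
  have less: "drl_less M' M" using h(3) M' by (simp add: lead_def)
  obtain b where b: "h = (\<Sum>j\<le>t. smult (b j) (f j))"
    "\<forall>j\<le>t. \<forall>n. coeff (b j) n \<noteq> 0 \<longrightarrow> (t - j, m j + n) = M' \<or> drl_less (t - j, m j + n) M'"
    using standard_representation_lead[OF I f, of M'] h M' by blast
  have "drl_less (t - j, m j + n) M" if "j \<le> t" "coeff (b j) n \<noteq> 0" for j n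
    using b(2) that less drl_trans[OF _ less] by blast
  thus ?thesis using b(1) by blast
qed

lemma monic_leads_independent:
  fixes f :: "nat \<Rightarrow> 'a::field poly poly"
  assumes f: "monic_leads f" and 0: "(\<Sum>j\<le>t. smult (b j) (f j)) = 0" and k: "k \<le> t"
  shows "b k = 0"
proof (rule ccontr)
  assume bk: "b k \<noteq> 0"
  define J where "J = {j. j \<le> t \<and> b j \<noteq> 0}"
  have "(\<Sum>j\<in>J. smult (b j) (f j)) = (\<Sum>j\<le>t. smult (b j) (f j))"
    by (rule sum.mono_neutral_left) (auto simp: J_def)
  hence sum0: "(\<Sum>j\<in>J. smult (b j) (f j)) = 0" using 0 by simp
  have "\<exists>j\<in>J. lead (\<Sum>j\<in>J. smult (b j) (f j)) (t - j, m j + degree (b j))"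
  proof (rule lead_sum_distinct)
    show "lead (smult (b j) (f j)) (t - j, m j + degree (b j))" if "j \<in> J" for j
      using lead_smult[of "f j" "(t - j, m j)" "b j"] f that by (simp add: J_def monic_leads_def)
    show "inj_on (\<lambda>j. (t - j, m j + degree (b j))) J"
      by (rule inj_onI) (auto simp: J_def)
  qed (use bk k in \<open>auto simp: J_def\<close>)
  thus False using sum0 lead_nonzero by metis
qed

section \<open>Every ideal is an ideal of minors in exactly one way\<close>

definition base_change :: "(nat \<Rightarrow> nat \<Rightarrow> 'a::field poly) \<Rightarrow> (nat \<Rightarrow> 'a poly poly) \<Rightarrow> nat \<Rightarrow> 'a poly poly" where
  "base_change B f j = f j + (\<Sum>k\<le>t. smult (B k j) (f k))"

lemma sum_Y: "j < t \<Longrightarrow> (\<Sum>k\<le>t. c k * Y C k j) = (\<Sum>k\<le>t. c k * C k j) + c j * monom 1 (d j)"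
proof -
  assume j: "j < t"
  have "(\<Sum>k\<le>t. c k * Y C k j) = (\<Sum>k\<le>t. c k * C k j + (if k = j then c j * monom 1 (d j) else 0))"
    by (rule sum.cong) (auto simp: Y_def algebra_simps)
  thus ?thesis using j by (simp add: sum.distrib)
qed

lemma sum_Y': "(\<Sum>k<t. Y C i k * c k) = (\<Sum>k<t. C i k * c k) + (if i < t then monom 1 (d i) * c i else 0)"
proof -
  have "(\<Sum>k<t. Y C i k * c k) = (\<Sum>k<t. C i k * c k + (if k = i then monom 1 (d i) * c i else 0))"
    by (rule sum.cong) (auto simp: Y_def algebra_simps)
  thus ?thesis by (simp add: sum.distrib)
qed

lemma conjugates_matrix:
  "conjugates B C C' \<longleftrightarrow> (\<forall>i\<le>t. \<forall>j<t.
     Y C i j + (\<Sum>k<t. Y C i k * B (Suc k) (Suc j)) = Y C' i j + (\<Sum>k\<le>t. B i k * Y C' k j))"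
proof -
  have "C' i j - C i j = (if i < t then monom 1 (d i) * B (Suc i) (Suc j) else 0)
       - monom 1 (d j) * B i j
       + (\<Sum>k<t. C i k * B (Suc k) (Suc j)) - (\<Sum>k\<le>t. B i k * C' k j) \<longleftrightarrow>
     Y C i j + (\<Sum>k<t. Y C i k * B (Suc k) (Suc j)) = Y C' i j + (\<Sum>k\<le>t. B i k * Y C' k j)"
    if "j < t" for i j
  proof -
    have eq: "a' - a = x - y + s - r \<longleftrightarrow> (a + z) + (s + x) = (a' + z) + (r + y)"
      for a a' x y s r z :: "'a poly"
    proof -
      have "(a' - a) - (x - y + s - r) = (a' + z) + (r + y) - ((a + z) + (s + x))" by simp
      thus ?thesis by (metis eq_iff_diff_eq_0)
    qed
    show ?thesis
      unfolding sum_Y[OF that] sum_Y' mult.commute[of _ "monom 1 (d j)"] Y_def[of _ i j] by (rule eq)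
  qed
  thus ?thesis unfolding conjugates_def by simp
qed

lemma pCons_sum: "pCons 0 (\<Sum>i\<in>S. f i) = (\<Sum>i\<in>S. pCons 0 (f i))" for f :: "'b \<Rightarrow> 'a::comm_monoid_add poly"
proof (induction S rule: infinite_finite_induct)
  case (insert x S)
  have "pCons 0 (p + q) = pCons 0 p + pCons 0 q" for p q :: "'a poly" by simp
  thus ?case using insert by (simp del: add_pCons)
qed simp_all

text \<open>
  Substituting the relations of \<open>f\<close>, the difference of both sides of relation
  \<open>j\<close> for the new vector becomes a combination of the \<open>f\<^sub>i\<close>
  whose coefficients are the differences of the two sides of the conjugation equation.
\<close>

lemma syz_base_change:
  assumes f: "syz C f" and B0: "\<forall>j. B 0 j = 0"
  shows "syz C' (base_change B f) \<longleftrightarrow> (\<forall>j<t. (\<Sum>i\<le>t. smult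
     (Y C i j + (\<Sum>k<t. Y C i k * B (Suc k) (Suc j)) - (Y C' i j + (\<Sum>k\<le>t. B i k * Y C' k j))) (f i)) = 0)"
proof -
  have "pCons 0 (base_change B f (Suc j)) - (\<Sum>i\<le>t. smult (Y C' i j) (base_change B f i)) =
      (\<Sum>i\<le>t. smult (Y C i j + (\<Sum>k<t. Y C i k * B (Suc k) (Suc j)) -
         (Y C' i j + (\<Sum>k\<le>t. B i k * Y C' k j))) (f i))" if j: "j < t" for j
  proof -
    have "pCons 0 (\<Sum>k\<le>t. smult (B k (Suc j)) (f k)) = (\<Sum>k\<le>t. smult (B k (Suc j)) (pCons 0 (f k)))"
      by (simp add: pCons_sum)
    also have "\<dots> = (\<Sum>k<t. smult (B (Suc k) (Suc j)) (pCons 0 (f (Suc k))))"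
      unfolding lessThan_Suc_atMost[symmetric] by (subst sum.lessThan_Suc_shift) (simp add: B0)
    also have "\<dots> = (\<Sum>k<t. \<Sum>i\<le>t. smult (B (Suc k) (Suc j) * Y C i k) (f i))"
      using f by (intro sum.cong) (simp_all add: syz_def smult_sum2)
    also have "\<dots> = (\<Sum>i\<le>t. smult (\<Sum>k<t. Y C i k * B (Suc k) (Suc j)) (f i))"
      by (subst sum.swap) (simp add: smult_sum mult.commute)
    finally have 1: "pCons 0 (\<Sum>k\<le>t. smult (B k (Suc j)) (f k)) = \<dots>" .
    have "(\<Sum>i\<le>t. smult (Y C' i j) (\<Sum>k\<le>t. smult (B k i) (f k))) =
        (\<Sum>i\<le>t. \<Sum>k\<le>t. smult (Y C' i j * B k i) (f k))"
      by (simp add: smult_sum2)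
    also have "\<dots> = (\<Sum>i\<le>t. smult (\<Sum>k\<le>t. B i k * Y C' k j) (f i))"
      by (subst sum.swap) (simp add: smult_sum mult.commute)
    finally have 2: "(\<Sum>i\<le>t. smult (Y C' i j) (\<Sum>k\<le>t. smult (B k i) (f k))) = \<dots>" .
    have 3: "pCons 0 (base_change B f (Suc j)) =
        (\<Sum>i\<le>t. smult (Y C i j) (f i)) + (\<Sum>i\<le>t. smult (\<Sum>k<t. Y C i k * B (Suc k) (Suc j)) (f i))"
    proof -
      have "pCons 0 (p + q) = pCons 0 p + pCons 0 q" for p q :: "'a poly poly" by simp
      thus ?thesis using f j 1 by (simp add: base_change_def syz_def del: add_pCons)
    qed
    have 4: "(\<Sum>i\<le>t. smult (Y C' i j) (base_change B f i)) =
        (\<Sum>i\<le>t. smult (Y C' i j) (f i)) + (\<Sum>i\<le>t. smult (\<Sum>k\<le>t. B i k * Y C' k j) (f i))"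
      unfolding base_change_def smult_add_right sum.distrib 2 ..
    show ?thesis unfolding 3 4
      by (simp only: smult_diff_left smult_add_left sum.distrib sum_subtractf)
  qed
  note eq = this
  have "pCons 0 (base_change B f (Suc j)) = (\<Sum>i\<le>t. smult (Y C' i j) (base_change B f i)) \<longleftrightarrow>
     (\<Sum>i\<le>t. smult (Y C i j + (\<Sum>k<t. Y C i k * B (Suc k) (Suc j)) -
         (Y C' i j + (\<Sum>k\<le>t. B i k * Y C' k j))) (f i)) = 0" if "j < t" for j
    by (subst eq[OF that, symmetric]) simp
  thus ?thesis unfolding syz_def by blast
qed

lemma degree_smult_bound: "degree (smult p f) \<le> n" if "degree f \<le> n" for f :: "'a::field poly poly"
  using that degree_smult_le order.trans by blast

text \<open>
  Monomial minus remainder, for the generators of the initial ideal. Monomials outside the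
  initial ideal have \<open>x\<close>-degree less than \<open>t\<close>, which gives the
  statements on \<open>degree\<close>.
\<close>

lemma reduced_vector:
  assumes I: "is_ideal I" "lead_exps I = stair"
  shows "\<exists>f. monic_leads f \<and> (\<forall>j\<le>t. f j \<in> I) \<and> degree (f 0) \<le> t \<and> coeff (f 0) t = 1 \<and>
     (\<forall>j. 0 < j \<and> j \<le> t \<longrightarrow> degree (f j) < t)"
proof -
  obtain r where r: "\<And>n. mono2 n - r n \<in> I \<and> supp (r n) \<inter> stair = {} \<and> (\<forall>k\<in>supp (r n). k = n \<or> drl_less k n)"
    using remainder_exists[OF I(1)] unfolding I(2) by metis
  define f where "f j = mono2 (t - j, m j) - r (t - j, m j)" for j
  have corner: "(t - j, m j) \<in> stair" if "j \<le> t" for j using that by (simp add: stair_def)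
  have notE: "n \<notin> stair" if "coeff2 (r k) n \<noteq> 0" for n k using r[of k] that by (auto simp: in_supp)
  have less: "drl_less n k" if "coeff2 (r k) n \<noteq> 0" "k \<in> stair" for n k
    using r[of k] notE[OF that(1)] that by (auto simp: in_supp)
  have small: "coeff (r k) a = 0" if "t \<le> a" for k a
  proof (rule poly_eqI)
    fix b
    have "(a, b) \<in> stair" using that by (simp add: stair_def)
    hence "coeff2 (r k) (a, b) = 0" using notE by blast
    thus "coeff (coeff (r k) a) b = coeff 0 b" by (simp add: coeff2_def)
  qed
  have "monic_leads f"
    unfolding monic_leads_def
  proof (intro allI impI conjI)
    fix j assume j: "j \<le> t"
    have z: "coeff2 (r (t - j, m j)) (t - j, m j) = 0" using notE corner[OF j] by blast
    thus "coeff2 (f j) (t - j, m j) = 1" by (simp add: f_def coeff2_mono2)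
    show "lead (f j) (t - j, m j)"
      unfolding lead_def
    proof (intro conjI allI impI)
      fix n assume "coeff2 (f j) n \<noteq> 0"
      hence "n = (t - j, m j) \<or> coeff2 (r (t - j, m j)) n \<noteq> 0"
        by (auto simp: f_def coeff2_mono2 split: if_splits)
      thus "n = (t - j, m j) \<or> drl_less n (t - j, m j)" using less[OF _ corner[OF j]] by blast
    qed (simp add: f_def coeff2_mono2 z)
  qed
  moreover have "f j \<in> I" for j using r by (simp add: f_def)
  moreover have "degree (f 0) \<le> t"
    by (rule degree_le) (use small in \<open>simp add: f_def mono2_def\<close>)
  moreover have "coeff (f 0) t = 1" using small[of t] by (simp add: f_def mono2_def)
  moreover have "degree (f j) < t" if "0 < j" "j \<le> t" for j
  proof -
    have "degree (f j) \<le> t - 1"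
      by (rule degree_le) (use small that in \<open>simp add: f_def mono2_def\<close>)
    thus ?thesis using that by simp
  qed
  ultimately show ?thesis by blast
qed

lemma cancel_monic_lead:
  fixes f g :: "'a::field poly poly"
  assumes "lead f n" "coeff2 f n = 1" "lead g n" "coeff2 g n = 1" "coeff2 (f - g) k \<noteq> 0"
  shows "drl_less k n"
proof (rule cancel_lead[OF assms(1,3,4)])
  show "coeff2 (f - smult [:coeff2 f n:] g) k \<noteq> 0" using assms(2,5) by simp
qed

text \<open>
  Translates a comparison of leading monomials into a degree bound for the coefficient of
  \<open>f\<^sub>i\<close>. In equal degrees the comparison is decided by
  \<open>t - i < t - j\<close>, that is, \<open>j < i\<close>.
\<close>

lemma coeff_bound_from_drl:
  assumes "\<And>n. coeff b n \<noteq> 0 \<Longrightarrow> drl_less (t - i, m i + n) (t - j, M)" "i \<le> t" "j \<le> t"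
  shows "dle b (int (t - j) + int M - int (t - i) - int (m i) - (if j < i then 0 else 1))"
  unfolding dle_def
proof (intro allI impI, rule ccontr)
  fix n assume "int (t - j) + int M - int (t - i) - int (m i) - (if j < i then 0 else 1) < int n"
    and "coeff b n \<noteq> 0"
  thus False using assms(1)[of n] assms(2,3) by (auto simp: drl_less_def tdeg_def split: if_splits)
qed

text \<open>
  Division of \<open>x f\<^bsub>j+1\<^esub> - y^(d\<^sub>j) f\<^sub>j\<close>, in which the
  leading terms cancel, produces a bounded matrix \<open>C\<close>. The base change to its
  normal form \<open>C'\<close> turns \<open>f\<close> into the vector of minors of
  \<open>X + C'\<close>. So the ideal of minors is contained in \<open>I\<close>, and it has
  the same leading exponents.
\<close>

lemma minors_surjective:
  fixes I :: "'a::field poly poly set"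
  assumes I: "is_ideal I" "lead_exps I = stair"
  shows "\<exists>C. normal C \<and> I = ideal_gen (signed_minor C ` {..t})"
proof -
  obtain f where f: "monic_leads f" "\<And>j. j \<le> t \<Longrightarrow> f j \<in> I" "degree (f 0) \<le> t" "coeff (f 0) t = 1"
     "\<And>j. 0 < j \<Longrightarrow> j \<le> t \<Longrightarrow> degree (f j) < t"
    using reduced_vector[OF I] by blast
  have fd: "degree (f j) \<le> t" if "j \<le> t" for j
    using f(3) f(5)[of j] that by (cases "j = 0") auto
  have "\<exists>c. pCons 0 (f (Suc j)) - smult (monom 1 (d j)) (f j) = (\<Sum>i\<le>t. smult (c i) (f i)) \<and>
      (\<forall>i\<le>t. \<forall>n. coeff (c i) n \<noteq> 0 \<longrightarrow> drl_less (t - i, m i + n) (t - j, m (Suc j)))"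
    if j: "j < t" for j
  proof (rule standard_representation[OF I(1) _ f(1,2) fd])
    have x: "pCons 0 (f (Suc j)) = mono2 (1, 0) * f (Suc j)" by (simp add: mono2_def monom_Suc)
    have lf: "lead (f (Suc j)) (t - Suc j, m (Suc j))" "coeff2 (f (Suc j)) (t - Suc j, m (Suc j)) = 1"
      "lead (f j) (t - j, m j)" "coeff2 (f j) (t - j, m j) = 1"
      using f(1) j by (simp_all add: monic_leads_def)
    have mj: "m j + d j = m (Suc j)" "Suc (t - Suc j) = t - j" using m_strict[OF j] j by (simp_all add: d_def)
    have 1: "lead (pCons 0 (f (Suc j))) (t - j, m (Suc j))" "coeff2 (pCons 0 (f (Suc j))) (t - j, m (Suc j)) = 1"
    proof -
      show "lead (pCons 0 (f (Suc j))) (t - j, m (Suc j))"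
        using lead_mono2_mult[OF lf(1), of "(1, 0)"] mj unfolding x by simp
      show "coeff2 (pCons 0 (f (Suc j))) (t - j, m (Suc j)) = 1"
        using lf(2) j by (simp add: coeff2_pCons_0)
    qed
    have 2: "lead (smult (monom 1 (d j)) (f j)) (t - j, m (Suc j))"
      "coeff2 (smult (monom 1 (d j)) (f j)) (t - j, m (Suc j)) = 1"
    proof -
      show "lead (smult (monom 1 (d j)) (f j)) (t - j, m (Suc j))"
        using lead_smult[OF lf(3), of "monom 1 (d j)"] by (simp add: degree_monom_eq mj(1))
      have "m (Suc j) - d j = m j" "d j \<le> m (Suc j)" using mj(1) by linarith+
      thus "coeff2 (smult (monom 1 (d j)) (f j)) (t - j, m (Suc j)) = 1"
        using lf(4) by (simp add: coeff2_smult_monom)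
    qed
    show "drl_less n (t - j, m (Suc j))"
      if "coeff2 (pCons 0 (f (Suc j)) - smult (monom 1 (d j)) (f j)) n \<noteq> 0" for n
      using that by (rule cancel_monic_lead[OF 1 2])
    show "pCons 0 (f (Suc j)) - smult (monom 1 (d j)) (f j) \<in> I"
      unfolding x using j by (intro ideal_diff[OF I(1)] ideal_smult[OF I(1)] ideal_mult[OF I(1)] f(2)) auto
    show "degree (pCons 0 (f (Suc j)) - smult (monom 1 (d j)) (f j)) \<le> t"
      using f(5)[of "Suc j"] j fd[of j]
      by (intro degree_diff_le degree_smult_bound) (auto intro: order.trans[OF degree_pCons_le])
  qed (use I in simp)
  hence "\<forall>j. j < t \<longrightarrow> (\<exists>c. pCons 0 (f (Suc j)) - smult (monom 1 (d j)) (f j) = (\<Sum>i\<le>t. smult (c i) (f i)) \<and>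
      (\<forall>i\<le>t. \<forall>n. coeff (c i) n \<noteq> 0 \<longrightarrow> drl_less (t - i, m i + n) (t - j, m (Suc j))))"
    by (intro allI impI)
  from this[unfolded choice_iff'] obtain c where
    "\<forall>j. j < t \<longrightarrow> pCons 0 (f (Suc j)) - smult (monom 1 (d j)) (f j) = (\<Sum>i\<le>t. smult (c j i) (f i)) \<and>
      (\<forall>i\<le>t. \<forall>n. coeff (c j i) n \<noteq> 0 \<longrightarrow> drl_less (t - i, m i + n) (t - j, m (Suc j)))" ..
  note c = this[rule_format, THEN conjunct1] this[rule_format, THEN conjunct2, rule_format]
  define C where "C i j = c j i" for i j
  have "bounded C"
    unfolding bounded_def C_def
  proof (intro allI impI)
    fix i j assume ij: "i \<le> t" "j < t"
    have "dle (c j i) (int (t - j) + int (m (Suc j)) - int (t - i) - int (m i) - (if j < i then 0 else 1))"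
      using c(2)[OF ij(2,1)] ij by (intro coeff_bound_from_drl) auto
    thus "dle (c j i) (bnd i j)" by (rule dle_mono) (use ij in \<open>auto simp: bnd_def v_def\<close>)
  qed
  have "syz C f"
    unfolding syz_def
  proof (intro allI impI)
    fix j assume j: "j < t"
    have "(\<Sum>i\<le>t. smult (Y C i j) (f i)) =
        (\<Sum>i\<le>t. smult (c j i) (f i) + (if i = j then smult (monom 1 (d j)) (f j) else 0))"
      by (rule sum.cong) (auto simp: Y_def C_def smult_add_left)
    also have "\<dots> = (\<Sum>i\<le>t. smult (c j i) (f i)) + smult (monom 1 (d j)) (f j)"
      using j by (simp add: sum.distrib)
    also have "\<dots> = pCons 0 (f (Suc j))" by (simp flip: c(1)[OF j])
    finally show "pCons 0 (f (Suc j)) = (\<Sum>i\<le>t. smult (Y C i j) (f i))" ..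
  qed
  obtain B C' where BC: "normal C'" "cobounded B" "conjugates B C C'"
    using conjugate_normal_exists[OF \<open>bounded C\<close>] by blast
  have B0: "\<forall>j. B 0 j = 0" using BC(2) by (simp add: cobounded_def)
  have "syz C' (base_change B f)"
    using BC(3) unfolding syz_base_change[where B = B, OF \<open>syz C f\<close> B0] conjugates_matrix by simp
  moreover have "degree (base_change B f 0) \<le> t"
    unfolding base_change_def using f(3) fd
    by (intro degree_add_le degree_sum_le degree_smult_bound) auto
  moreover have "coeff (base_change B f 0) t = 1"
  proof -
    have "coeff (smult (B k 0) (f k)) t = 0" if "k \<le> t" for k
    proof (cases "k = 0")
      case False
      thus ?thesis using coeff_eq_0[OF f(5)[of k]] that by simp
    qed (use B0 in simp)
    hence "coeff (\<Sum>k\<le>t. smult (B k 0) (f k)) t = 0"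
      unfolding coeff_sum by (intro sum.neutral) blast
    thus ?thesis using f(4) by (simp only: base_change_def coeff_add add_0_right)
  qed
  ultimately have eq: "base_change B f k = signed_minor C' k" if "k \<le> t" for k
    using that by (rule syz_eq_minor[OF normal_bounded[OF BC(1)]])
  have "ideal_gen (signed_minor C' ` {..t}) = I"
  proof (rule ideal_eq_if_lead_exps_eq[OF ring_module.subspace_span I(1)])
    have "signed_minor C' k \<in> I" if "k \<le> t" for k
      unfolding eq[OF that, symmetric] base_change_def using f(2) that
      by (intro ideal_add[OF I(1)] ideal_sum[OF I(1)] ideal_smult[OF I(1)]) auto
    thus "ideal_gen (signed_minor C' ` {..t}) \<subseteq> I"
      by (intro ring_module.span_minimal I(1)) auto
    show "lead_exps I \<subseteq> lead_exps (ideal_gen (signed_minor C' ` {..t}))"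
      using I(2) lead_exps_minors[OF normal_bounded[OF BC(1)]] by simp
  qed
  thus ?thesis using BC(1) by blast
qed

text \<open>
  The minors of both matrices are bases of the elements of \<open>x\<close>-degree at most
  \<open>t\<close> in the same ideal with the same leading terms. Dividing their differences
  gives a base change \<open>B\<close> between them, and since the \<open>f\<^sub>i\<close>
  are independent over \<open>K[y]\<close>, \<open>B\<close> conjugates \<open>C\<close> to
  \<open>C'\<close>. Zero conjugates \<open>C\<close> to itself, so uniqueness of normal forms
  applies.
\<close>

lemma minors_injective:
  fixes C C' :: "nat \<Rightarrow> nat \<Rightarrow> 'a::field poly"
  assumes C: "normal C" "normal C'"
    and eq: "ideal_gen (signed_minor C ` {..t}) = ideal_gen (signed_minor C' ` {..t})"
    and ij: "i \<le> t" "j < t"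
  shows "C i j = C' i j"
proof -
  define I where "I = ideal_gen (signed_minor C ` {..t})"
  define f f' where "f = signed_minor C" and "f' = signed_minor C'"
  note Cb = C[THEN normal_bounded]
  have I: "is_ideal I" "lead_exps I = stair"
    using lead_exps_minors[OF Cb(1)] by (auto simp: I_def intro: ring_module.subspace_span)
  have fI: "f k \<in> I" if "k \<le> t" for k using that unfolding I_def f_def by (intro ring_module.span_base) auto
  have f'I: "f' k \<in> I" if "k \<le> t" for k
    using that unfolding I_def f'_def eq by (intro ring_module.span_base) auto
  have ml: "monic_leads f" "monic_leads f'" using monic_leads_minors Cb by (auto simp: f_def f'_def)
  have sy: "syz C f" "syz C' f'" by (auto simp: f_def f'_def syz_minors)
  have d0: "degree (f 0) = t" "degree (f' 0) = t" "coeff (f 0) t = 1" "coeff (f' 0) t = 1"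
    using degree_minor_0 by (auto simp: f_def f'_def)
  have dk: "degree (f k) < t" "degree (f' k) < t" if "0 < k" "k \<le> t" for k
    using syz_degree[OF sy(1) _ _ that] syz_degree[OF sy(2) _ _ that] d0(1,2) that by simp_all
  have dk': "degree (f k) \<le> t" "degree (f' k) \<le> t" if "k \<le> t" for k
    using dk[of k] d0 that by (cases "k = 0"; simp)+
  have "\<exists>b. f' k - f k = (\<Sum>i\<le>t. smult (b i) (f i)) \<and>
      (\<forall>i\<le>t. \<forall>n. coeff (b i) n \<noteq> 0 \<longrightarrow> drl_less (t - i, m i + n) (t - k, m k))"
    if k: "k \<le> t" for k
  proof (rule standard_representation[OF I(1) _ ml(1) fI dk'(1)])
    have l: "lead (f k) (t - k, m k)" "coeff2 (f k) (t - k, m k) = 1"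
      "lead (f' k) (t - k, m k)" "coeff2 (f' k) (t - k, m k) = 1"
      using ml k by (simp_all add: monic_leads_def)
    show "drl_less n (t - k, m k)" if "coeff2 (f' k - f k) n \<noteq> 0" for n
      using that by (rule cancel_monic_lead[OF l(3,4) l(1,2)])
    show "f' k - f k \<in> I" using fI f'I k by (intro ideal_diff[OF I(1)])
    show "degree (f' k - f k) \<le> t" using dk' k by (intro degree_diff_le)
  qed (use I in simp)
  hence "\<forall>k. k \<le> t \<longrightarrow> (\<exists>b. f' k - f k = (\<Sum>i\<le>t. smult (b i) (f i)) \<and>
      (\<forall>i\<le>t. \<forall>n. coeff (b i) n \<noteq> 0 \<longrightarrow> drl_less (t - i, m i + n) (t - k, m k)))"
    by (intro allI impI)
  from this[unfolded choice_iff'] obtain b where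
    "\<forall>k. k \<le> t \<longrightarrow> f' k - f k = (\<Sum>i\<le>t. smult (b k i) (f i)) \<and>
      (\<forall>i\<le>t. \<forall>n. coeff (b k i) n \<noteq> 0 \<longrightarrow> drl_less (t - i, m i + n) (t - k, m k))" ..
  note b = this[rule_format, THEN conjunct1] this[rule_format, THEN conjunct2, rule_format]
  have bb: "dle (b k i) (v k - v i - (if i < k then 1 else 0))" "b k k = 0" if "k \<le> t" "i \<le> t" for k i
  proof -
    have *: "dle (b k i) (int (t - k) + int (m k) - int (t - i) - int (m i) - (if k < i then 0 else 1))"
      if "i \<le> t" for i
      using b(2)[OF \<open>k \<le> t\<close> that] that \<open>k \<le> t\<close> by (intro coeff_bound_from_drl) auto
    show "dle (b k i) (v k - v i - (if i < k then 1 else 0))"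
      by (rule dle_mono[OF *]) (use that in \<open>auto simp: v_def\<close>)
    show "b k k = 0" using *[OF that(1)] by (intro poly_eqI) (simp add: dle_def)
  qed
  have b0: "b k 0 = 0" if k: "k \<le> t" for k
  proof (cases "k = 0")
    case False
    have "coeff (smult (b k i) (f i)) t = (if i = 0 then b k 0 else 0)" if "i \<le> t" for i
      using coeff_eq_0[OF dk(1)[of i]] d0(3) that by (cases "i = 0") simp_all
    hence "(\<Sum>i\<le>t. coeff (smult (b k i) (f i)) t) = (\<Sum>i\<le>t. if i = 0 then b k 0 else 0)"
      by (intro sum.cong) auto
    hence "coeff (f' k - f k) t = b k 0" unfolding b(1)[OF k] coeff_sum by simp
    moreover have "coeff (f' k - f k) t = 0"
      using coeff_eq_0[OF dk(1)[of k]] coeff_eq_0[OF dk(2)[of k]] False k by simp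
    ultimately show ?thesis by simp
  qed (use bb(2)[OF k k] in simp)
  define B where "B i k = (if i \<le> t \<and> k \<le> t then b k i else 0)" for i k
  have B: "cobounded B" using bb b0 by (auto simp: cobounded_def B_def)
  have B0: "\<forall>k. B 0 k = 0" using b0 by (simp add: B_def)
  have f'B: "f' k = base_change B f k" if "k \<le> t" for k
    using b(1)[OF that] that by (simp add: base_change_def B_def algebra_simps)
  have "syz C' (base_change B f)"
    using sy(2) f'B by (simp add: syz_def)
  note 0 = this[unfolded syz_base_change[where B = B, OF sy(1) B0], rule_format]
  have "conjugates B C C'"
    unfolding conjugates_matrix
  proof (intro allI impI)
    fix i j assume "i \<le> t" "j < t"
    from monic_leads_independent[OF ml(1) 0[OF this(2)] this(1)]
    show "Y C i j + (\<Sum>k<t. Y C i k * B (Suc k) (Suc j)) = Y C' i j + (\<Sum>k\<le>t. B i k * Y C' k j)"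
      by (simp only: right_minus_eq)
  qed
  moreover have "cobounded (\<lambda>_ _. 0 :: 'a poly)" "conjugates (\<lambda>_ _. 0) C C"
    by (auto simp: cobounded_def conjugates_def)
  ultimately show ?thesis
    using conjugate_normal_unique[OF Cb(1) C(1) _ _ C(2) B _ ij] by blast
qed

end

section \<open>The staircase of a lex-segment ideal\<close>

lemma monomial_ideal_is_ideal: "monomial_ideal I0 \<Longrightarrow> is_ideal I0"
  unfolding monomial_ideal_def using ring_module.subspace_span by blast

lemma monomial_ideal_supp:
  assumes "monomial_ideal I0" "p \<in> I0" "coeff2 p n \<noteq> 0"
  shows "mono2 n \<in> I0"
proof -
  obtain S where S: "I0 = ideal_gen (mono2 ` S)" using assms(1) by (auto simp: monomial_ideal_def)
  have "\<forall>n\<in>supp p. \<exists>s\<in>S. dvd2 s n"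
    using assms(2) by (simp only: S mem_monomial_ideal)
  hence "\<exists>s\<in>S. dvd2 s n" by (rule bspec) (simp add: in_supp assms(3))
  thus ?thesis unfolding S mono2_mem_monomial_ideal .
qed

lemma ideal_mono2_dvd2: "is_ideal I0 \<Longrightarrow> mono2 k \<in> I0 \<Longrightarrow> dvd2 k n \<Longrightarrow> mono2 n \<in> I0"
  by (subst mono2_dvd2) (auto intro: ideal_mult)

text \<open>
  Infinitely many monomials are linearly dependent modulo \<open>I0\<close>; a monomial ideal
  that contains a nontrivial combination of them contains one of them.
\<close>

lemma finite_dim_monomial:
  fixes I0 :: "'a::field poly poly set" and g :: "nat \<Rightarrow> nat \<times> nat"
  assumes I0: "monomial_ideal I0" and fin: "finite_dim_quotient I0" and g: "inj g"
  shows "\<exists>k. mono2 (g k) \<in> I0"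
proof (rule ccontr)
  assume neg: "\<nexists>k. mono2 (g k) \<in> I0"
  note id = monomial_ideal_is_ideal[OF I0]
  obtain B where B: "finite B" "\<And>f. \<exists>h\<in>K_space.span B. f - h \<in> I0"
    using fin by (auto simp: finite_dim_quotient_def)
  have "\<forall>k. \<exists>h. h \<in> K_space.span B \<and> mono2 (g k) - h \<in> I0" using B(2) by blast
  from choice[OF this] obtain h where h: "\<And>k. h k \<in> K_space.span B" "\<And>k. mono2 (g k) - h k \<in> I0"
    by blast
  have inj: "inj h"
  proof (rule injI, rule ccontr)
    fix k l assume kl: "h k = h l" "k \<noteq> l"
    have "mono2 (g k) - mono2 (g l) \<in> I0"
      using ideal_diff[OF id h(2)[of k] h(2)[of l]] kl(1) by simp
    moreover have "coeff2 (mono2 (g k) - mono2 (g l) :: 'a poly poly) (g k) \<noteq> 0"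
      using kl(2) g by (auto simp: coeff2_mono2 inj_eq)
    ultimately show False using monomial_ideal_supp[OF I0] neg by blast
  qed
  define S where "S = h ` {..card B}"
  have inj': "inj_on h {..card B}" using inj by (rule inj_on_subset) simp
  have "card S = card B + 1" unfolding S_def using inj' by (simp add: card_image)
  moreover have "S \<subseteq> K_space.span B" using h(1) by (auto simp: S_def)
  ultimately have dep: "K_space.dependent S"
    using K_space.independent_span_bound[OF B(1), of S] by auto
  have "finite S" by (simp add: S_def)
  from dep[unfolded K_space.dependent_finite[OF this]] obtain u
    where u: "\<exists>v\<in>S. u v \<noteq> 0" "(\<Sum>v\<in>S. smult [:u v:] v) = 0" by (elim exE conjE)
  have "(\<Sum>k\<le>card B. smult [:u (h k):] (h k)) = 0"
    using u(2) unfolding S_def sum.reindex[OF inj'] by (simp add: comp_def)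
  hence "(\<Sum>k\<le>card B. smult [:u (h k):] (mono2 (g k))) =
      (\<Sum>k\<le>card B. smult [:u (h k):] (mono2 (g k) - h k))"
    by (simp add: smult_diff_right sum_subtractf)
  also have "\<dots> \<in> I0" using h(2) by (intro ideal_sum[OF id] ideal_smult[OF id])
  finally have p: "(\<Sum>k\<le>card B. smult [:u (h k):] (mono2 (g k))) \<in> I0" .
  obtain k0 where k0: "k0 \<le> card B" "u (h k0) \<noteq> 0" using u(1) by (auto simp: S_def)
  have "coeff2 (\<Sum>k\<le>card B. smult [:u (h k):] (mono2 (g k))) (g k0) =
      (\<Sum>k\<le>card B. if k = k0 then u (h k0) else 0)"
    unfolding coeff2_sum by (rule sum.cong) (auto simp: coeff2_mono2 inj_eq[OF g])
  hence "coeff2 (\<Sum>k\<le>card B. smult [:u (h k):] (mono2 (g k))) (g k0) \<noteq> 0" using k0 by simp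
  thus False using monomial_ideal_supp[OF I0 p] neg by blast
qed

locale lex_segment =
  fixes I0 :: "'a::field poly poly set"
  assumes lex: "lex_segment_ideal I0" and fin: "finite_dim_quotient I0"
begin

lemma mon: "monomial_ideal I0"
  using lex by (simp add: lex_segment_ideal_def)

lemmas up = ideal_mono2_dvd2[OF monomial_ideal_is_ideal[OF mon]]

lemma x_power: "mono2 (t_of I0, 0) \<in> I0"
proof -
  have "\<exists>j. mono2 (j, 0) \<in> I0"
    using finite_dim_monomial[OF mon fin, of "\<lambda>j. (j, 0)"] by (simp add: inj_def)
  thus ?thesis unfolding t_of_def by (rule LeastI_ex)
qed

lemma y_power: "\<exists>b. mono2 (a, b) \<in> I0"
  by (rule finite_dim_monomial[OF mon fin]) (simp add: inj_def)

lemma m_of_mem: "0 < i \<Longrightarrow> mono2 (t_of I0 - i, m_of I0 i) \<in> I0"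
  using LeastI_ex[OF y_power[of "t_of I0 - i"]] by (simp add: m_of_def)

lemma m_of_le: "0 < i \<Longrightarrow> mono2 (t_of I0 - i, b) \<in> I0 \<Longrightarrow> m_of I0 i \<le> b"
  by (simp add: m_of_def Least_le)

text \<open>
  The lex-segment property, applied to generator number \<open>i + 1\<close> and the monomial
  next to it with one more \<open>x\<close> and one less \<open>y\<close>, gives
  \<open>m\<^sub>i \<le> m\<^bsub>i+1\<^esub> - 1\<close>. The exponent of \<open>y\<close> in
  the generator is positive by minimality of \<open>t\<close>.
\<close>

sublocale staircase "t_of I0" "m_of I0"
proof
  show "m_of I0 0 = 0" by (simp add: m_of_def)
next
  fix i assume i: "i < t_of I0"
  define M where "M = m_of I0 (Suc i)"
  have M: "mono2 (t_of I0 - Suc i, M) \<in> I0" unfolding M_def by (rule m_of_mem) simp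
  have "M \<noteq> 0"
  proof
    assume "M = 0"
    with M have "t_of I0 \<le> t_of I0 - Suc i" unfolding t_of_def by (intro Least_le) simp
    thus False using i by simp
  qed
  have "tdeg (t_of I0 - i, M - 1) = tdeg (t_of I0 - Suc i, M)"
    using i \<open>M \<noteq> 0\<close> by (simp add: tdeg_def)
  moreover have "lex_less (t_of I0 - Suc i, M) (t_of I0 - i, M - 1)"
    using i by (auto simp: lex_less_def)
  ultimately have "mono2 (t_of I0 - i, M - 1) \<in> I0"
    using lex M unfolding lex_segment_ideal_def by blast
  hence "m_of I0 i \<le> M - 1"
    by (cases "i = 0") (use m_of_le in \<open>auto simp: m_of_def[of _ 0]\<close>)
  thus "m_of I0 i < m_of I0 (Suc i)" using \<open>M \<noteq> 0\<close> by (simp add: M_def)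
qed

lemma stair_eq: "stair = {n. mono2 n \<in> I0}"
proof (rule Set.set_eqI)
  fix n :: "nat \<times> nat"
  obtain a b where n: "n = (a, b)" by (cases n)
  show "n \<in> stair \<longleftrightarrow> n \<in> {n. mono2 n \<in> I0}"
  proof (cases "t_of I0 \<le> a")
    case True
    thus ?thesis using up[OF x_power, of n] by (simp add: n stair_def dvd2_def)
  next
    case False
    define i where "i = t_of I0 - a"
    have i: "0 < i" "t_of I0 - i = a" using False by (auto simp: i_def)
    have "m_of I0 i \<le> b \<longleftrightarrow> mono2 (a, b) \<in> I0"
      using m_of_le[OF i(1), of b] up[OF m_of_mem[OF i(1)], of "(a, b)"] i(2) by (auto simp: dvd2_def)
    thus ?thesis by (simp add: n stair_def i_def)
  qed
qed

lemma mem_V: "I \<in> V I0 \<longleftrightarrow> is_ideal I \<and> lead_exps I = stair"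
  unfolding mem_V_iff[OF mon] stair_eq ..

section \<open>The matrices of the parametrization\<close>

abbreviation entries :: "'a poly mat \<Rightarrow> nat \<Rightarrow> nat \<Rightarrow> 'a poly" where
  "entries A i j \<equiv> A $$ (i, j)"

text \<open>
  In indices that start at \<open>0\<close>, the number \<open>u\<close> is
  \<open>bnd i j\<close> below the diagonal and \<open>bnd i j + 1\<close> elsewhere, so the
  strict bounds on and above the diagonal become \<open>bnd i j\<close>, too.
\<close>

lemma A_space_iff: "A \<in> A_space I0 \<longleftrightarrow> A \<in> carrier_mat (t_of I0 + 1) (t_of I0) \<and> normal (entries A)"
proof -
  have *: "A $$ (i, j) = 0 \<or> int (degree (A $$ (i, j))) \<le> deg_bound I0 (i + 1) (j + 1) \<longleftrightarrow>
      dle (A $$ (i, j)) (bnd i j) \<and> dle (A $$ (i, j)) (int (d (min i j)) - 1)"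
    if "i \<le> t_of I0" "j < t_of I0" for i j
  proof -
    have "int (d k) = d_of I0 (k + 1)" if "k < t_of I0" for k
      using m_strict[OF that] by (simp add: d_def d_of_def)
    hence "deg_bound I0 (i + 1) (j + 1) = min (bnd i j) (int (d (min i j)) - 1)"
      using that by (auto simp: deg_bound_def bnd_def u_of_def v_def min_def)
    thus ?thesis unfolding dle_degree by auto
  qed
  have "(\<forall>i\<in>{1..t_of I0 + 1}. \<forall>j\<in>{1..t_of I0}. Q (i - 1) (j - 1)) \<longleftrightarrow>
      (\<forall>i\<le>t_of I0. \<forall>j<t_of I0. Q i j)" (is "?L = ?R") for Q
  proof
    assume L: ?L
    show ?R
    proof (intro allI impI)
      fix i j assume "i \<le> t_of I0" "j < t_of I0"
      hence "i + 1 \<in> {1..t_of I0 + 1}" "j + 1 \<in> {1..t_of I0}" by auto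
      thus "Q i j" using L by fastforce
    qed
  next
    assume ?R
    thus ?L by auto
  qed
  from this[of "\<lambda>i j. A $$ (i, j) = 0 \<or> int (degree (A $$ (i, j))) \<le> deg_bound I0 (i + 1) (j + 1)"]
  have "(\<forall>i\<in>{1..t_of I0 + 1}. \<forall>j\<in>{1..t_of I0}. A $$ (i - 1, j - 1) = 0 \<or>
      int (degree (A $$ (i - 1, j - 1))) \<le> deg_bound I0 i j) \<longleftrightarrow> normal (entries A)"
    using * by (simp add: normal_def)
  thus ?thesis unfolding A_space_def by blast
qed

lemma pick_skip:
  assumes "k \<le> n" "a < n"
  shows "pick ({..n} - {k}) a = (if a < k then a else Suc a)"
proof -
  define i where "i = (if a < k then a else Suc a)"
  have "{x \<in> {..n} - {k}. x < i} = (if a < k then {..<a} else {..<Suc a} - {k})"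
    using assms by (auto simp: i_def)
  hence "card {x \<in> {..n} - {k}. x < i} = a" by (auto simp: card_Diff_singleton_if)
  moreover have "i \<in> {..n} - {k}" using assms by (auto simp: i_def)
  ultimately show ?thesis using pick_card_in_set[of i "{..n} - {k}"] by (simp add: i_def)
qed

lemma pick_lessThan: "a < n \<Longrightarrow> pick {..<n} a = a"
proof -
  assume a: "a < n"
  have "{x \<in> {..<n}. x < a} = {..<a}" using a by auto
  thus ?thesis using pick_card_in_set[of a "{..<n}"] a by simp
qed

text \<open>
  A set of \<open>t\<close> rows out of \<open>t + 1\<close> omits one row, so the minors are
  those in \<open>signed_minor\<close> up to sign.
\<close>

lemma psi_eq:
  assumes A: "A \<in> carrier_mat (t_of I0 + 1) (t_of I0)"
  shows "psi I0 A = ideal_gen (signed_minor (entries A) ` {..t_of I0})"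
proof -
  let ?t = "t_of I0"
  define M where "M = X_mat I0 + map_mat (\<lambda>p. [:p:]) A"
  have M: "M \<in> carrier_mat (?t + 1) ?t" using A by (simp add: M_def X_mat_def)
  have entry: "M $$ (i, j) = relation_matrix (entries A) i j" if "i \<le> ?t" "j < ?t" for i j
  proof -
    have "nat (d_of I0 (j + 1)) = d j" by (simp add: d_of_def d_def)
    thus ?thesis using that A
      by (auto simp: M_def X_mat_def relation_matrix_def Y_def mono2_def monom_0 one_pCons simp flip: one_pCons)
  qed
  have minor: "det (submatrix M ({..?t} - {k}) {..<?t}) = (-1) ^ (?t + k) * signed_minor (entries A) k"
    if k: "k \<le> ?t" for k
  proof -
    have "{i. i < dim_row M \<and> i \<in> {..?t} - {k}} = {..?t} - {k}" "{j. j < dim_col M \<and> j \<in> {..<?t}} = {..<?t}"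
      using M by auto
    moreover have "card ({..?t} - {k}) = ?t" using k by simp
    ultimately have "submatrix M ({..?t} - {k}) {..<?t} =
        mat ?t ?t (\<lambda>(a, b). M $$ (pick ({..?t} - {k}) a, pick {..<?t} b))"
      by (simp only: submatrix_def card_lessThan)
    also have "\<dots> = mat ?t ?t (\<lambda>(a, b). relation_matrix (entries A) (if a < k then a else Suc a) b)"
      by (rule eq_matI) (use k in \<open>auto simp: pick_skip pick_lessThan entry\<close>)
    finally show ?thesis by (simp add: signed_minor_def flip: mult.assoc power_add)
  qed
  define U where "U = {det (submatrix M P Q) | P Q. P \<subseteq> {..<dim_row M} \<and> Q \<subseteq> {..<dim_col M} \<and>
      card P = ?t \<and> card Q = ?t}"
  have U: "U = (\<lambda>k. (-1) ^ (?t + k) * signed_minor (entries A) k) ` {..?t}"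
  proof (intro subset_antisym subsetI)
    fix p assume "p \<in> U"
    then obtain P Q where PQ: "p = det (submatrix M P Q)" "P \<subseteq> {..?t}" "Q \<subseteq> {..<?t}"
      "card P = ?t" "card Q = ?t" using M by (auto simp: U_def lessThan_Suc_atMost)
    have "Q = {..<?t}" using PQ by (intro card_subset_eq) auto
    have "card ({..?t} - P) = 1" using PQ by (subst card_Diff_subset) (auto intro: finite_subset)
    then obtain k where "{..?t} - P = {k}" by (auto simp: card_1_singleton_iff)
    hence "k \<le> ?t" "P = {..?t} - {k}" using PQ(2) by auto
    thus "p \<in> (\<lambda>k. (-1) ^ (?t + k) * signed_minor (entries A) k) ` {..?t}"
      using minor PQ(1) \<open>Q = _\<close> by auto
  next
    fix p assume "p \<in> (\<lambda>k. (-1) ^ (?t + k) * signed_minor (entries A) k) ` {..?t}"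
    then obtain k where k: "k \<le> ?t" "p = det (submatrix M ({..?t} - {k}) {..<?t})"
      using minor by auto
    moreover have "card ({..?t} - {k}) = ?t" using k(1) by simp
    ultimately show "p \<in> U" unfolding U_def using M
      by (intro CollectI exI[of _ "{..?t} - {k}"] exI[of _ "{..<?t}"]) auto
  qed
  have "ideal_gen U = ideal_gen (signed_minor (entries A) ` {..?t})"
  proof (intro subset_antisym ring_module.span_minimal ring_module.subspace_span)
    show "U \<subseteq> ideal_gen (signed_minor (entries A) ` {..?t})"
    proof
      fix p assume "p \<in> U"
      then obtain k where k: "k \<le> ?t" "p = (-1) ^ (?t + k) * signed_minor (entries A) k" unfolding U by blast
      show "p \<in> ideal_gen (signed_minor (entries A) ` {..?t})"
        unfolding k(2) using k(1) by (intro ring_module.span_scale ring_module.span_base) auto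
    qed
    show "signed_minor (entries A) ` {..?t} \<subseteq> ideal_gen U"
    proof
      fix p assume "p \<in> signed_minor (entries A) ` {..?t}"
      then obtain k where k: "k \<le> ?t" "p = signed_minor (entries A) k" by auto
      have "(-1) ^ (?t + k) * ((-1) ^ (?t + k) * signed_minor (entries A) k) \<in> ideal_gen U"
        unfolding U using k(1) by (intro ring_module.span_scale ring_module.span_base) auto
      thus "p \<in> ideal_gen U" using k(2) by (simp flip: mult.assoc power_add)
    qed
  qed
  thus ?thesis by (simp add: psi_def minors_ideal_def U_def M_def)
qed

lemma psi_in_V:
  assumes "A \<in> A_space I0"
  shows "psi I0 A \<in> V I0"
proof -
  have "A \<in> carrier_mat (t_of I0 + 1) (t_of I0)" "normal (entries A)" using assms A_space_iff by blast+
  thus ?thesis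
    unfolding mem_V psi_eq[OF \<open>A \<in> carrier_mat _ _\<close>]
    using lead_exps_minors[OF normal_bounded] ring_module.subspace_span by blast
qed

lemma psi_bij: "bij_betw (psi I0) (A_space I0) (V I0)"
proof (rule bij_betw_imageI)
  show "inj_on (psi I0) (A_space I0)"
  proof (rule inj_onI)
    fix A A' assume AA: "A \<in> A_space I0" "A' \<in> A_space I0" "psi I0 A = psi I0 A'"
    hence c: "A \<in> carrier_mat (t_of I0 + 1) (t_of I0)" "A' \<in> carrier_mat (t_of I0 + 1) (t_of I0)"
      and n: "normal (entries A)" "normal (entries A')" using A_space_iff by blast+
    have eq: "ideal_gen (signed_minor (entries A) ` {..t_of I0}) = ideal_gen (signed_minor (entries A') ` {..t_of I0})"
      using AA(3) psi_eq[OF c(1)] psi_eq[OF c(2)] by simp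
    have "A $$ (i, j) = A' $$ (i, j)" if "i \<le> t_of I0" "j < t_of I0" for i j
      using minors_injective[OF n eq that] .
    thus "A = A'" using c by (intro eq_matI) auto
  qed
  show "psi I0 ` A_space I0 = V I0"
  proof (intro subset_antisym subsetI)
    fix I assume "I \<in> psi I0 ` A_space I0"
    thus "I \<in> V I0" using psi_in_V by blast
  next
    fix I assume "I \<in> V I0"
    hence "is_ideal I" "lead_exps I = stair" using mem_V by blast+
    from minors_surjective[OF this] obtain C where C: "normal C" "I = ideal_gen (signed_minor C ` {..t_of I0})" by blast
    define A where "A = mat (t_of I0 + 1) (t_of I0) (\<lambda>(i, j). C i j)"
    have A: "A \<in> carrier_mat (t_of I0 + 1) (t_of I0)" by (simp add: A_def)
    have AC: "A $$ (i, j) = C i j" if "i \<le> t_of I0" "j < t_of I0" for i j using that by (simp add: A_def)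
    have "normal (entries A)" using C(1) AC by (simp add: normal_def)
    hence "A \<in> A_space I0" using A A_space_iff by blast
    moreover have "signed_minor (entries A) k = signed_minor C k" for k
    proof -
      have "mat (t_of I0) (t_of I0) (\<lambda>(a, b). relation_matrix (entries A) (if a < k then a else Suc a) b) =
          mat (t_of I0) (t_of I0) (\<lambda>(a, b). relation_matrix C (if a < k then a else Suc a) b)"
        by (rule eq_matI) (auto simp: relation_matrix_def Y_def AC)
      thus ?thesis by (simp only: signed_minor_def)
    qed
    hence "psi I0 A = I" using psi_eq[OF A] C(2) by (simp add: image_def)
    ultimately show "I \<in> psi I0 ` A_space I0" by blast
  qed
qed

end

section \<open>Reduced Groebner bases\<close>

lemma min_gen_below:
  assumes "mono2 n \<in> I0"
  shows "\<exists>k\<in>min_gen_exps I0. dvd2 k n"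
proof -
  define P where "P k \<longleftrightarrow> mono2 k \<in> I0 \<and> dvd2 k n" for k
  have "P n" using assms by (simp add: P_def)
  then obtain k where k: "P k" "\<And>k'. P k' \<Longrightarrow> tdeg k \<le> tdeg k'"
    using ex_has_least_nat[of P n tdeg] by blast
  have "mono2 k' \<notin> I0" if "k' \<noteq> k \<and> fst k' \<le> fst k \<and> snd k' \<le> snd k" for k'
  proof
    assume "mono2 k' \<in> I0"
    hence "P k'" using that k(1) dvd2_trans[of k' k n] by (simp add: P_def dvd2_def)
    hence "tdeg k \<le> tdeg k'" by (rule k(2))
    thus False using that by (cases k; cases k') (auto simp: tdeg_def)
  qed
  hence "k \<in> min_gen_exps I0" using k(1) by (simp add: min_gen_exps_def P_def)
  thus ?thesis using k(1) by (auto simp: P_def)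
qed

lemma min_gen_minimal:
  "k \<in> min_gen_exps I0 \<Longrightarrow> mono2 n \<in> I0 \<Longrightarrow> dvd2 n k \<Longrightarrow> n = k"
  unfolding min_gen_exps_def dvd2_def by blast

lemma min_gen_mem: "k \<in> min_gen_exps I0 \<Longrightarrow> mono2 k \<in> I0"
  by (simp add: min_gen_exps_def)

lemma mono2_mem_init_exps:
  fixes G :: "'a::field poly poly set"
  shows "(mono2 n :: 'a poly poly) \<in> ideal_gen ((\<lambda>g. mono2 (init_exp g)) ` G) \<longleftrightarrow> (\<exists>g\<in>G. dvd2 (init_exp g) n)"
proof -
  have "(\<lambda>g. mono2 (init_exp g) :: 'a poly poly) ` G = mono2 ` (init_exp ` G)" by (simp add: image_image)
  thus ?thesis by (simp only: mono2_mem_monomial_ideal) blast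
qed

text \<open>
  In a reduced Groebner basis \<open>G\<close> the leading exponents are the minimal
  generators, and no other monomial of \<open>g \<in> G\<close> lies in the initial ideal: it
  would be divisible by a leading monomial, by reducedness that of \<open>g\<close> itself,
  which is larger. So \<open>g\<close> is monomial minus remainder.
\<close>

lemma reduced_gb_eq:
  fixes I0 :: "'a::field poly poly set"
  assumes I0: "monomial_ideal I0" and I: "I \<in> V I0" and finM: "finite (min_gen_exps I0)"
    and r0: "\<forall>k\<in>min_gen_exps I0. mono2 k - r k \<in> I \<and> (\<forall>n. coeff2 (r k) n \<noteq> 0 \<longrightarrow> mono2 n \<notin> I0)"
  shows "reduced_gb I = (\<lambda>k. mono2 k - r k) ` min_gen_exps I0"
    and "\<forall>k\<in>min_gen_exps I0. init_exp (mono2 k - r k) = k"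
proof -
  have r: "\<And>k. k \<in> min_gen_exps I0 \<Longrightarrow> mono2 k - r k \<in> I"
      "\<And>k n. k \<in> min_gen_exps I0 \<Longrightarrow> coeff2 (r k) n \<noteq> 0 \<Longrightarrow> mono2 n \<notin> I0"
    using r0 by blast+
  define M where "M = min_gen_exps I0"
  define red where "red k = mono2 k - r k" for k
  have id: "is_ideal I" and le: "lead_exps I = {n. mono2 n \<in> I0}" and init: "init_ideal I = I0"
    using I mem_V_iff[OF I0] by (auto simp: V_def)
  have rk: "coeff2 (r k) k = 0" if "k \<in> M" for k
    using r(2)[of k k] min_gen_mem[of k I0] that unfolding M_def by blast
  have rsupp: "supp (r k) \<inter> lead_exps I = {}" if "k \<in> M" for k
    using r(2)[of k] that by (auto simp: le in_supp M_def)
  have lead_red: "lead (red k) k" if k: "k \<in> M" for k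
  proof -
    have "red k \<noteq> 0"
    proof
      assume "red k = 0"
      hence "coeff2 (red k) k = 0" by simp
      thus False using rk[OF k] by (simp add: red_def coeff2_mono2)
    qed
    then obtain n where n: "lead (red k) n" using lead_exists by blast
    hence "n \<in> lead_exps I" using r(1)[of k] k by (auto simp: lead_exps_def red_def M_def)
    hence "coeff2 (r k) n = 0" using rsupp[OF k] in_supp by blast
    moreover have "coeff2 (red k) n \<noteq> 0" using n by (simp add: lead_def)
    ultimately have "n = k" by (auto simp: red_def coeff2_mono2 split: if_splits)
    thus ?thesis using n by simp
  qed
  have init_red: "init_exp (red k) = k" if "k \<in> M" for k using lead_red[OF that] by (rule init_exp_lead)
  thus "\<forall>k\<in>min_gen_exps I0. init_exp (mono2 k - r k) = k" by (simp add: M_def red_def)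
  have below: "\<exists>k\<in>M. dvd2 k n" if "mono2 n \<in> I0" for n using min_gen_below[OF that] by (simp add: M_def)
  have red_supp: "n = k \<or> mono2 n \<notin> I0" if "k \<in> M" "coeff2 (red k) n \<noteq> 0" for k n
  proof (cases "n = k")
    case False
    hence "coeff2 (r k) n \<noteq> 0" using that(2) by (simp add: red_def coeff2_mono2)
    thus ?thesis using r(2) that(1) by (simp add: M_def)
  qed simp
  have gb: "is_reduced_gb I (red ` M)"
    unfolding is_reduced_gb_def
  proof (intro conjI ballI)
    show "finite (red ` M)" using finM by (simp add: M_def)
    show "red ` M \<subseteq> I" using r(1) by (auto simp: red_def M_def)
    show "0 \<notin> red ` M" using lead_nonzero[OF lead_red] by auto
    have eqM: "(\<lambda>g. mono2 (init_exp g) :: 'a poly poly) ` red ` M = mono2 ` M"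
      unfolding image_image by (rule image_cong) (simp_all add: init_red)
    have "(\<exists>s\<in>M. dvd2 s n) \<longleftrightarrow> (\<exists>s\<in>{n. mono2 n \<in> I0}. dvd2 s n)" for n
    proof
      assume "\<exists>s\<in>M. dvd2 s n"
      then obtain s where "s \<in> M" "dvd2 s n" ..
      moreover have "mono2 s \<in> I0" using \<open>s \<in> M\<close> min_gen_mem by (simp add: M_def)
      ultimately show "\<exists>s\<in>{n. mono2 n \<in> I0}. dvd2 s n" by auto
    next
      assume "\<exists>s\<in>{n. mono2 n \<in> I0}. dvd2 s n"
      then obtain s where s: "mono2 s \<in> I0" "dvd2 s n" by auto
      obtain k where "k \<in> M" "dvd2 k s" using below[OF s(1)] ..
      thus "\<exists>s\<in>M. dvd2 s n" using dvd2_trans[OF _ s(2)] by blast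
    qed
    hence "p \<in> ideal_gen (mono2 ` M) \<longleftrightarrow> p \<in> ideal_gen (mono2 ` {n. mono2 n \<in> I0})" for p :: "'a poly poly"
      by (simp only: mem_monomial_ideal)
    hence "ideal_gen (mono2 ` M :: 'a poly poly set) = ideal_gen (mono2 ` {n. mono2 n \<in> I0})"
      by (rule Set.set_eqI)
    also have "\<dots> = I0" by (rule monomial_ideal_eq_gen[OF I0, symmetric])
    finally show "ideal_gen ((\<lambda>g. mono2 (init_exp g)) ` red ` M) = init_ideal I"
      by (simp only: eqM init)
  next
    fix g assume "g \<in> red ` M"
    then obtain k where k: "k \<in> M" "g = red k" by auto
    show "coeff2 g (init_exp g) = 1" using k rk[OF k(1)] by (simp add: init_red) (simp add: red_def coeff2_mono2)
    fix n assume "n \<in> supp g"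
    hence n: "n = k \<or> mono2 n \<notin> I0" using red_supp[OF k(1)] k(2) by (simp add: in_supp)
    show "(mono2 n :: 'a poly poly) \<notin> ideal_gen ((\<lambda>h. mono2 (init_exp h)) ` (red ` M - {g}))"
    proof
      assume "(mono2 n :: 'a poly poly) \<in> ideal_gen ((\<lambda>h. mono2 (init_exp h)) ` (red ` M - {g}))"
      then obtain h where "h \<in> red ` M - {g}" "dvd2 (init_exp h) n" unfolding mono2_mem_init_exps ..
      then obtain k' where k': "k' \<in> M" "red k' \<noteq> red k" "dvd2 k' n" using k(2) init_red by auto
      have "mono2 k' \<in> I0" using k'(1) min_gen_mem by (simp add: M_def)
      hence "mono2 n \<in> I0" using ideal_mono2_dvd2[OF monomial_ideal_is_ideal[OF I0]] k'(3) by blast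
      hence "n = k" using n by blast
      hence "k' = k" using min_gen_minimal[of k I0 k'] k(1) k'(3) \<open>mono2 k' \<in> I0\<close> by (simp add: M_def)
      thus False using k'(2) by simp
    qed
  qed
  have uniq: "G = red ` M" if G: "is_reduced_gb I G" for G
  proof -
    have GI: "G \<subseteq> I" and G0: "0 \<notin> G" and Gin: "ideal_gen ((\<lambda>g. mono2 (init_exp g)) ` G) = I0"
      and G1: "\<And>g. g \<in> G \<Longrightarrow> coeff2 g (init_exp g) = 1"
      and Gred: "\<And>g n h. g \<in> G \<Longrightarrow> coeff2 g n \<noteq> 0 \<Longrightarrow> h \<in> G \<Longrightarrow> dvd2 (init_exp h) n \<Longrightarrow> h = g"
      using G unfolding is_reduced_gb_def mono2_mem_init_exps init in_supp[symmetric] by blast+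
    have lead: "lead g (init_exp g)" if "g \<in> G" for g
      using G0 that by (intro lead_init_exp) auto
    have div: "mono2 n \<in> I0 \<longleftrightarrow> (\<exists>h\<in>G. dvd2 (init_exp h) n)" for n
      using mono2_mem_init_exps[of n G] Gin by simp
    have inM: "init_exp g \<in> M" if g: "g \<in> G" for g
      unfolding M_def min_gen_exps_def
    proof (intro CollectI conjI allI impI)
      show "mono2 (init_exp g) \<in> I0" unfolding div using g dvd2_refl by blast
      fix n assume n: "n \<noteq> init_exp g \<and> fst n \<le> fst (init_exp g) \<and> snd n \<le> snd (init_exp g)"
      hence dn: "dvd2 n (init_exp g)" by (simp add: dvd2_def)
      show "mono2 n \<notin> I0"
      proof
        assume "mono2 n \<in> I0"
        then obtain h where h: "h \<in> G" "dvd2 (init_exp h) n" using div by blast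
        have "h = g" using Gred[OF g _ h(1) dvd2_trans[OF h(2) dn]] G1[OF g] by simp
        thus False using h(2) n by (auto simp: dvd2_def prod_eq_iff)
      qed
    qed
    have eq: "g = red (init_exp g)" if g: "g \<in> G" for g
    proof -
      let ?k = "init_exp g"
      have "coeff2 (mono2 ?k - g) n \<noteq> 0 \<Longrightarrow> mono2 n \<notin> I0" for n
      proof
        assume c: "coeff2 (mono2 ?k - g) n \<noteq> 0" and "mono2 n \<in> I0"
        have nk: "n \<noteq> ?k" using c G1[OF g] by (auto simp: coeff2_mono2)
        hence gn: "coeff2 g n \<noteq> 0" using c by (simp add: coeff2_mono2)
        obtain h where h: "h \<in> G" "dvd2 (init_exp h) n" using \<open>mono2 n \<in> I0\<close> div by blast
        have "h = g" using Gred[OF g gn h] .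
        hence "drl_less ?k n" using drl_dvd2[OF h(2)] nk by auto
        moreover have "drl_less n ?k" using lead[OF g] gn nk by (auto simp: lead_def)
        ultimately show False using drl_trans drl_irrefl by blast
      qed
      hence "supp (mono2 ?k - g) \<inter> lead_exps I = {}" by (auto simp: le in_supp)
      moreover have "mono2 ?k - (mono2 ?k - g) \<in> I" using GI g by auto
      moreover have "mono2 ?k - r ?k \<in> I" using r(1) inM[OF g] by (simp add: M_def)
      ultimately have "mono2 ?k - g = r ?k" using rsupp[OF inM[OF g]]
        by (intro remainder_unique[OF id])
      thus ?thesis by (auto simp: red_def algebra_simps)
    qed
    show ?thesis
    proof (intro subset_antisym subsetI)
      fix g assume "g \<in> G"
      thus "g \<in> red ` M" using eq inM by blast
    next
      fix g assume "g \<in> red ` M"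
      then obtain k where k: "k \<in> M" "g = red k" by auto
      have "mono2 k \<in> I0" using k(1) min_gen_mem by (simp add: M_def)
      then obtain h where h: "h \<in> G" "dvd2 (init_exp h) k" using div by blast
      have "mono2 (init_exp h) \<in> I0" using inM[OF h(1)] min_gen_mem by (simp add: M_def)
      hence "init_exp h = k" using min_gen_minimal k(1) h(2) by (simp add: M_def)
      thus "g \<in> G" using eq[OF h(1)] k(2) h(1) by simp
    qed
  qed
  show "reduced_gb I = (\<lambda>k. mono2 k - r k) ` min_gen_exps I0"
    unfolding reduced_gb_def red_def[symmetric] M_def[symmetric]
    using gb uniq by (rule the_equality)
qed

text \<open>
  The basis element with leading monomial \<open>x^a y^b\<close> is that monomial minus its
  remainder.
\<close>

lemma V_coord_eq:
  fixes I0 :: "'a::field poly poly set"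
  assumes "monomial_ideal I0" "I \<in> V I0" "finite (min_gen_exps I0)"
    and "\<forall>k\<in>min_gen_exps I0. mono2 k - r k \<in> I \<and> (\<forall>n. coeff2 (r k) n \<noteq> 0 \<longrightarrow> mono2 n \<notin> I0)"
    and k: "k \<in> min_gen_exps I0" and n: "n \<noteq> k"
  shows "V_coord k n I = - coeff2 (r k) n"
proof -
  note gb = reduced_gb_eq[OF assms(1-4)]
  have "(THE g. g \<in> reduced_gb I \<and> init_exp g = k) = mono2 k - r k"
  proof (rule the_equality)
    show "mono2 k - r k \<in> reduced_gb I \<and> init_exp (mono2 k - r k) = k"
      using k gb(2) unfolding gb(1) by blast
    fix g assume g: "g \<in> reduced_gb I \<and> init_exp g = k"
    then obtain k' where k': "k' \<in> min_gen_exps I0" "g = mono2 k' - r k'" unfolding gb(1) by blast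
    thus "g = mono2 k - r k" using g gb(2) by auto
  qed
  thus ?thesis using n by (simp add: V_coord_def coeff2_mono2)
qed

section \<open>Polynomial dependence on the matrix entries\<close>

lemma poly_functions_sum:
  "(\<And>i. i \<in> S \<Longrightarrow> f i \<in> poly_functions C) \<Longrightarrow> (\<lambda>p. \<Sum>i\<in>S. f i p) \<in> poly_functions C"
  by (induction S rule: infinite_finite_induct) (auto intro: poly_functions.intros)

lemma poly_functions_uminus: "f \<in> poly_functions C \<Longrightarrow> (\<lambda>p. - f p) \<in> poly_functions C"
  using poly_functions.mult[OF poly_functions.const[of "-1"]] by fastforce

definition poly_family :: "('p \<Rightarrow> 'a::field) set \<Rightarrow> ('p \<Rightarrow> 'a poly poly) \<Rightarrow> bool" where
  "poly_family C F \<longleftrightarrow> (\<forall>n. (\<lambda>p. coeff2 (F p) n) \<in> poly_functions C)"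

lemma poly_family_const: "poly_family C (\<lambda>_. f)"
  by (simp add: poly_family_def poly_functions.const)

lemma poly_family_add: "poly_family C F \<Longrightarrow> poly_family C G \<Longrightarrow> poly_family C (\<lambda>p. F p + G p)"
  by (simp add: poly_family_def poly_functions.add)

lemma poly_family_sum:
  "(\<And>i. i \<in> S \<Longrightarrow> poly_family C (F i)) \<Longrightarrow> poly_family C (\<lambda>p. \<Sum>i\<in>S. F i p)"
  by (simp add: poly_family_def coeff2_sum poly_functions_sum)

lemma coeff2_mult:
  "coeff2 (f * g) (a, b) = (\<Sum>i\<le>a. \<Sum>j\<le>b. coeff2 f (i, j) * coeff2 g (a - i, b - j))"
  for f g :: "'a::field poly poly"
  by (simp add: coeff2_def coeff_mult coeff_sum)

lemma poly_family_mult: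
  assumes "poly_family C F" "poly_family C G"
  shows "poly_family C (\<lambda>p. F p * G p)"
  unfolding poly_family_def
proof
  fix n :: "nat \<times> nat"
  show "(\<lambda>p. coeff2 (F p * G p) n) \<in> poly_functions C"
    using assms unfolding poly_family_def
    by (cases n) (simp only: coeff2_mult, intro poly_functions_sum poly_functions.mult, simp_all)
qed

lemma poly_family_prod:
  "(\<And>i. i \<in> S \<Longrightarrow> poly_family C (F i)) \<Longrightarrow> poly_family C (\<lambda>p. \<Prod>i\<in>S. F i p)"
  by (induction S rule: infinite_finite_induct) (auto intro: poly_family_mult poly_family_const)

lemma poly_family_det:
  assumes "\<And>i j. i < n \<Longrightarrow> j < n \<Longrightarrow> poly_family C (F i j)"
  shows "poly_family C (\<lambda>p. det (mat n n (\<lambda>(i, j). F i j p)))"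
proof -
  have "det (mat n n (\<lambda>(i, j). F i j p)) =
      (\<Sum>\<pi> | \<pi> permutes {0..<n}. signof \<pi> * (\<Prod>i = 0..<n. F i (\<pi> i) p))" for p
    unfolding det_def'[OF mat_carrier]
    by (intro sum.cong refl arg_cong2[where f = "(*)"] prod.cong) (auto dest: permutes_in_image)
  moreover have "poly_family C (\<lambda>p. \<Sum>\<pi> | \<pi> permutes {0..<n}. signof \<pi> * (\<Prod>i = 0..<n. F i (\<pi> i) p))"
    by (intro poly_family_sum poly_family_mult poly_family_const poly_family_prod assms)
       (auto dest: permutes_in_image)
  ultimately show ?thesis by simp
qed

context lex_segment
begin

lemma finite_min_gen: "finite (min_gen_exps I0)"
proof (rule finite_subset)
  show "min_gen_exps I0 \<subseteq> (\<lambda>j. (t_of I0 - j, m_of I0 j)) ` {..t_of I0}"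
  proof
    fix k assume k: "k \<in> min_gen_exps I0"
    hence "k \<in> stair" using min_gen_mem by (simp add: stair_eq)
    then obtain j where j: "j \<le> t_of I0" "dvd2 (t_of I0 - j, m_of I0 j) k" unfolding mem_stair_iff by blast
    have "(t_of I0 - j, m_of I0 j) \<in> stair" unfolding mem_stair_iff using j(1) dvd2_refl by blast
    hence "mono2 (t_of I0 - j, m_of I0 j) \<in> I0" by (simp add: stair_eq)
    hence "(t_of I0 - j, m_of I0 j) = k" using min_gen_minimal k j(2) by blast
    thus "k \<in> (\<lambda>j. (t_of I0 - j, m_of I0 j)) ` {..t_of I0}" using j(1) by blast
  qed
qed simp

lemma poly_family_minor:
  assumes "k \<le> t_of I0"
  shows "poly_family (A_coords I0) (\<lambda>A. signed_minor (entries A) k)"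
proof -
  have entry: "poly_family (A_coords I0) (\<lambda>A. [:A $$ (i, j):])" if "i \<le> t_of I0" "j < t_of I0" for i j
    unfolding poly_family_def
  proof
    fix n :: "nat \<times> nat"
    have "coeff2 [:A $$ (i, j):] n = (if fst n = 0 then coeff (A $$ (i, j)) (snd n) else 0)" for A :: "'a poly mat"
      by (cases "fst n") (auto simp: coeff2_def)
    moreover have "(\<lambda>A. coeff (A $$ (i, j)) (snd n)) \<in> A_coords I0"
      unfolding A_coords_def using that by (intro CollectI exI[of _ i] exI[of _ j] exI[of _ "snd n"]) simp
    ultimately show "(\<lambda>A. coeff2 [:A $$ (i, j):] n) \<in> poly_functions (A_coords I0)"
      by (cases "fst n = 0") (auto intro: poly_functions.intros)
  qed
  have "poly_family (A_coords I0) (\<lambda>A. relation_matrix (entries A) i j)" if "i \<le> t_of I0" "j < t_of I0" for i j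
  proof -
    have "relation_matrix (entries A) i j = [:A $$ (i, j):] +
        ([:if i = j then monom 1 (d j) else 0:] - (if i = Suc j then monom 1 1 else 0))" for A
      by (simp add: relation_matrix_def Y_def)
    thus ?thesis by (simp only:) (intro poly_family_add entry poly_family_const that)
  qed
  thus ?thesis unfolding signed_minor_def using assms
    by (intro poly_family_mult poly_family_const poly_family_det) auto
qed

text \<open>
  If \<open>h\<close> is a monic element of the ideal with leading exponent \<open>n\<close>,
  the remainder of \<open>x^a y^b\<close> with \<open>(a, b) = n\<close> is minus the sum of
  the remainders of the other monomials of \<open>h\<close>, weighted with the coefficients of
  \<open>h\<close>. Monomial multiples of the minors are such elements for all matrices at
  once, with coefficients polynomial in the matrix.
\<close>

lemma remainder_poly_functions:
  "\<exists>P. (\<forall>k. P k \<in> poly_functions (A_coords I0)) \<and>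
     (\<forall>A\<in>A_space I0. \<exists>r. mono2 n - r \<in> psi I0 A \<and> (\<forall>k. coeff2 r k \<noteq> 0 \<longrightarrow> k \<notin> stair) \<and> (\<forall>k. coeff2 r k = P k A))"
proof (induction n rule: wfp_induct_rule[OF wfp_drl])
  case (1 n)
  show ?case
  proof (cases "n \<in> stair")
    case False
    define P :: "nat \<times> nat \<Rightarrow> 'a poly mat \<Rightarrow> 'a" where "P k = (\<lambda>_. if k = n then 1 else 0)" for k
    have "P k \<in> poly_functions (A_coords I0)" for k unfolding P_def by (rule poly_functions.const)
    moreover have "mono2 n - mono2 n \<in> psi I0 A \<and> (\<forall>k. coeff2 (mono2 n :: 'a poly poly) k \<noteq> 0 \<longrightarrow> k \<notin> stair) \<and>
        (\<forall>k. coeff2 (mono2 n) k = P k A)" if "A \<in> A_space I0" for A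
      using ideal_0[of "psi I0 A"] psi_in_V[OF that] mem_V False by (auto simp: coeff2_mono2 P_def)
    ultimately show ?thesis by blast
  next
    case True
    then obtain j where j: "j \<le> t_of I0" "dvd2 (t_of I0 - j, m_of I0 j) n" unfolding mem_stair_iff by blast
    define q where "q = (fst n - (t_of I0 - j), snd n - m_of I0 j)"
    define h where "h A = mono2 q * signed_minor (entries A) j" for A
    have hF: "poly_family (A_coords I0) h"
      unfolding h_def by (intro poly_family_mult poly_family_const poly_family_minor j(1))
    define S where "S = {k. drl_less k n}"
    have finS: "finite S" unfolding S_def by (rule finite_drl)
    have "\<forall>k. k \<in> S \<longrightarrow> (\<exists>P. (\<forall>l. P l \<in> poly_functions (A_coords I0)) \<and>
       (\<forall>A\<in>A_space I0. \<exists>r. mono2 k - r \<in> psi I0 A \<and> (\<forall>l. coeff2 r l \<noteq> 0 \<longrightarrow> l \<notin> stair) \<and> (\<forall>l. coeff2 r l = P l A)))"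
      using 1 by (simp add: S_def)
    from this[unfolded choice_iff'] obtain Q where Q: "\<forall>k. k \<in> S \<longrightarrow> (\<forall>l. Q k l \<in> poly_functions (A_coords I0)) \<and>
       (\<forall>A\<in>A_space I0. \<exists>r. mono2 k - r \<in> psi I0 A \<and> (\<forall>l. coeff2 r l \<noteq> 0 \<longrightarrow> l \<notin> stair) \<and> (\<forall>l. coeff2 r l = Q k l A))" ..
    note Q1 = Q[rule_format, THEN conjunct1, rule_format]
    note Q2 = Q[rule_format, THEN conjunct2, rule_format]
    define P where "P l = (\<lambda>A. - (\<Sum>k\<in>S. coeff2 (h A) k * Q k l A))" for l
    have "P l \<in> poly_functions (A_coords I0)" for l
      unfolding P_def using hF unfolding poly_family_def
      by (intro poly_functions_uminus poly_functions_sum poly_functions.mult Q1) auto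
    moreover have "\<exists>r. mono2 n - r \<in> psi I0 A \<and> (\<forall>k. coeff2 r k \<noteq> 0 \<longrightarrow> k \<notin> stair) \<and> (\<forall>k. coeff2 r k = P k A)"
      if A: "A \<in> A_space I0" for A
    proof -
      have A': "A \<in> carrier_mat (t_of I0 + 1) (t_of I0)" "normal (entries A)" using A A_space_iff by blast+
      have id: "is_ideal (psi I0 A)" using psi_in_V[OF A] mem_V by blast
      note ml = monic_leads_minors[OF normal_bounded[OF A'(2)], unfolded monic_leads_def, rule_format, OF j(1)]
      have nq: "n = (t_of I0 - j + fst q, m_of I0 j + snd q)"
        using j(2) by (cases n) (auto simp: q_def dvd2_def)
      have "lead (h A) n"
        using lead_mono2_mult[OF conjunct1[OF ml], of q] unfolding h_def nq by simp
      moreover have "coeff2 (h A) n = 1"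
        using conjunct2[OF ml] unfolding h_def coeff2_mono2_mult nq by (simp add: dvd2_def)
      ultimately have hn: "lead (h A) n" "coeff2 (h A) n = 1" .
      have hI: "h A \<in> psi I0 A"
        unfolding h_def psi_eq[OF A'(1)] using j(1)
        by (intro ring_module.span_scale ring_module.span_base) auto
      have "\<forall>k. k \<in> S \<longrightarrow> (\<exists>r. mono2 k - r \<in> psi I0 A \<and> (\<forall>l. coeff2 r l \<noteq> 0 \<longrightarrow> l \<notin> stair) \<and> (\<forall>l. coeff2 r l = Q k l A))"
        using Q2[OF _ A] by blast
      from this[unfolded choice_iff'] obtain R where R: "\<forall>k. k \<in> S \<longrightarrow> mono2 k - R k \<in> psi I0 A \<and>
          (\<forall>l. coeff2 (R k) l \<noteq> 0 \<longrightarrow> l \<notin> stair) \<and> (\<forall>l. coeff2 (R k) l = Q k l A)" ..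
      have R1: "mono2 k - R k \<in> psi I0 A" and R2: "coeff2 (R k) l \<noteq> 0 \<Longrightarrow> l \<notin> stair"
        and R3: "coeff2 (R k) l = Q k l A" if "k \<in> S" for k l
        using R[rule_format, OF that] by blast+
      define r where "r = - (\<Sum>k\<in>S. smult [:coeff2 (h A) k:] (R k))"
      have h_exp: "h A = mono2 n + (\<Sum>k\<in>S. smult [:coeff2 (h A) k:] (mono2 k))"
      proof (rule poly2_eqI)
        fix l
        have "coeff2 (\<Sum>k\<in>S. smult [:coeff2 (h A) k:] (mono2 k)) l =
            (\<Sum>k\<in>S. if l = k then coeff2 (h A) k else 0)"
          unfolding coeff2_sum by (rule sum.cong) (simp_all add: coeff2_mono2)
        also have "\<dots> = (if l \<in> S then coeff2 (h A) l else 0)" using finS by simp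
        finally show "coeff2 (h A) l = coeff2 (mono2 n + (\<Sum>k\<in>S. smult [:coeff2 (h A) k:] (mono2 k))) l"
          using hn by (auto simp: coeff2_mono2 S_def lead_def)
      qed
      have "mono2 n - r = (mono2 n + (\<Sum>k\<in>S. smult [:coeff2 (h A) k:] (mono2 k))) -
          (\<Sum>k\<in>S. smult [:coeff2 (h A) k:] (mono2 k - R k))"
        by (simp add: r_def smult_diff_right sum_subtractf)
      also have "\<dots> = h A - (\<Sum>k\<in>S. smult [:coeff2 (h A) k:] (mono2 k - R k))"
        by (simp only: h_exp[symmetric])
      also have "\<dots> \<in> psi I0 A"
        using R1 by (intro ideal_diff[OF id hI] ideal_sum[OF id] ideal_smult[OF id])
      finally have "mono2 n - r \<in> psi I0 A" .
      moreover have "l \<notin> stair" if "coeff2 r l \<noteq> 0" for l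
      proof -
        have "(\<Sum>k\<in>S. coeff2 (h A) k * coeff2 (R k) l) \<noteq> 0"
          using that by (simp add: r_def coeff2_sum)
        then obtain k where "k \<in> S" "coeff2 (h A) k * coeff2 (R k) l \<noteq> 0"
          by (rule sum.not_neutral_contains_not_neutral)
        thus ?thesis using R2[of k l] by simp
      qed
      moreover have "coeff2 r l = P l A" for l
        by (simp add: r_def P_def coeff2_sum R3)
      ultimately show ?thesis by blast
    qed
    ultimately show ?thesis by blast
  qed
qed

lemma psi_regular: "regular_map I0 (psi I0)"
  unfolding regular_map_def
proof (intro ballI allI impI)
  fix m0 n assume m0: "m0 \<in> min_gen_exps I0" and n: "n \<noteq> m0"
  from choice[OF allI[OF remainder_poly_functions]] obtain P where
    P: "\<forall>k. (\<forall>l. P k l \<in> poly_functions (A_coords I0)) \<and>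
     (\<forall>A\<in>A_space I0. \<exists>r. mono2 k - r \<in> psi I0 A \<and> (\<forall>l. coeff2 r l \<noteq> 0 \<longrightarrow> l \<notin> stair) \<and> (\<forall>l. coeff2 r l = P k l A))" ..
  have "V_coord m0 n (psi I0 A) = - P m0 n A" if A: "A \<in> A_space I0" for A
  proof -
    have "\<forall>k. \<exists>r. mono2 k - r \<in> psi I0 A \<and> (\<forall>l. coeff2 r l \<noteq> 0 \<longrightarrow> l \<notin> stair) \<and> (\<forall>l. coeff2 r l = P k l A)"
      by (rule allI, rule bspec[OF conjunct2[OF spec[OF P]] A])
    from choice[OF this] obtain r where r: "\<forall>k. mono2 k - r k \<in> psi I0 A \<and>
        (\<forall>l. coeff2 (r k) l \<noteq> 0 \<longrightarrow> l \<notin> stair) \<and> (\<forall>l. coeff2 (r k) l = P k l A)" ..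
    note r1 = r[THEN spec, THEN conjunct1] and r2 = r[THEN spec, THEN conjunct2, THEN conjunct1, rule_format]
      and r3 = r[THEN spec, THEN conjunct2, THEN conjunct2, rule_format]
    have "V_coord m0 n (psi I0 A) = - coeff2 (r m0) n"
    proof (rule V_coord_eq[OF mon psi_in_V[OF A] finite_min_gen _ m0 n])
      show "\<forall>k\<in>min_gen_exps I0. mono2 k - r k \<in> psi I0 A \<and> (\<forall>l. coeff2 (r k) l \<noteq> 0 \<longrightarrow> mono2 l \<notin> I0)"
        using r1 r2[unfolded stair_eq] by simp
    qed
    thus ?thesis by (simp only: r3)
  qed
  moreover have "(\<lambda>A. - P m0 n A) \<in> poly_functions (A_coords I0)"
    by (rule poly_functions_uminus[OF spec[OF conjunct1[OF spec[OF P]]]])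
  ultimately show "\<exists>P\<in>poly_functions (A_coords I0). \<forall>A\<in>A_space I0. V_coord m0 n (psi I0 A) = P A"
    by (intro bexI[of _ "\<lambda>A. - P m0 n A"] ballI)
qed

end

theorem theorem3p1:
  fixes I0 :: "'a::field poly poly set"
  assumes "lex_segment_ideal I0"
    and "finite_dim_quotient I0"
  shows "(\<forall>A \<in> A_space I0. psi I0 A \<in> V I0) \<and>
         regular_map I0 (psi I0) \<and>
         bij_betw (psi I0) (A_space I0) (V I0)"
proof -
  interpret lex_segment I0 using assms by unfold_locales
  show ?thesis using psi_in_V psi_regular psi_bij by blast
qed

end
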